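(* Let $0<\rho_-<\rho_+<1$ and consider the LPP model with independent weights $\omega_{0,0}=0$, $\omega_{i,j}$ exponential with rate $1$ for $i,j>0$, with rate $\rho_-$ for $i=0,j\ge1$, and with rate $1-\rho_+$ for $j=0,i\ge1$. Let $(I_n,J_n)_{n\ge1}$ be the competition interface of this model (defined in the context). Let $\eta=\frac{(1-\rho_+)(1-\rho_-)}{\rho_-\rho_+}$, $v_+=\frac{1}{\rho_-^2}-\frac{\eta}{(1-\rho_-)^2}$, $v_-=\frac{\eta}{(1-\rho_+)^2}-\frac{1}{\rho_+^2}$, $m_+=1/(1-\rho_-)$, $m_-=1/(1-\rho_+)$. Then for every $u\in\mathbb{R}$, $$\lim_{t\to\infty}\mathbb{P}\left(I_{\lfloor t\rfloor}-J_{\lfloor t\rfloor}\le -t\frac{1-\eta}{1+\eta}+\frac{2ut^{1/2}}{(1+\eta)^{3/2}}\right)=\int_{u(m_+-m_-)}^\infty \frac{e^{-\frac{x^2}{2(v_-+v_+)}}}{\sqrt{2\pi(v_-+v_+)}}\,\mathrm{d}x.$$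
   Context: An up-right path is a sequence of points of $\mathbb{Z}^2$ with increments in $\{(1,0),(0,1)\}$. For $z=(i,j)$ with $i,j\ge1$, let $L^+(z)$ (resp. $L^-(z)$) be the maximum, over up-right paths $\pi=(\pi(0),\dots,\pi(n))$ from $\pi(0)=(0,0)$ to $z$ with $\pi(1)=(0,1)$ (resp. $\pi(1)=(1,0)$), of $\sum_{(a,b)\in\pi\setminus\{(0,0)\}}\omega_{a,b}$. Let $\Gamma_+^\infty=\{z:L^+(z)>L^-(z)\}$, $\Gamma_-^\infty=\{z:L^-(z)>L^+(z)\}$ (a.s. every $z$ with positive coordinates lies in exactly one). Competition interface: $\phi_0=(0,0)$, $\phi_{n+1}=\phi_n+(1,0)$ if $\phi_n+(1,1)\in\Gamma_+^\infty$ and $\phi_{n+1}=\phi_n+(0,1)$ if $\phi_n+(1,1)\in\Gamma_-^\infty$; $\phi_n=(I_n,J_n)$. *)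

theory Defs
  imports "HOL-Probability.Probability"
begin

definition up_right_path :: "(nat \<times> nat) list \<Rightarrow> bool" where
  "up_right_path \<pi> \<longleftrightarrow> \<pi> \<noteq> [] \<and>
     (\<forall>k. Suc k < length \<pi> \<longrightarrow>
        \<pi> ! Suc k = (fst (\<pi> ! k) + 1, snd (\<pi> ! k)) \<or>
        \<pi> ! Suc k = (fst (\<pi> ! k), snd (\<pi> ! k) + 1))"

definition paths_via :: "nat \<times> nat \<Rightarrow> nat \<times> nat \<Rightarrow> (nat \<times> nat) list set" where
  "paths_via s z = {\<pi>. up_right_path \<pi> \<and> hd \<pi> = (0,0) \<and> last \<pi> = z
                        \<and> length \<pi> \<ge> 2 \<and> \<pi> ! 1 = s}"

definition path_weight :: "(nat \<times> nat \<Rightarrow> real) \<Rightarrow> (nat \<times> nat) list \<Rightarrow> real" where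
  "path_weight w \<pi> = sum_list (map w (tl \<pi>))"

definition Lplus :: "(nat \<times> nat \<Rightarrow> real) \<Rightarrow> nat \<times> nat \<Rightarrow> real" where
  "Lplus w z = Max (path_weight w ` paths_via (0,1) z)"

definition Lminus :: "(nat \<times> nat \<Rightarrow> real) \<Rightarrow> nat \<times> nat \<Rightarrow> real" where
  "Lminus w z = Max (path_weight w ` paths_via (1,0) z)"

text \<open>Competition interface. On the null event of a tie, we step up (convention).\<close>
fun comp_interface :: "(nat \<times> nat \<Rightarrow> real) \<Rightarrow> nat \<Rightarrow> nat \<times> nat" where
  "comp_interface w 0 = (0,0)"
| "comp_interface w (Suc n) =
     (let (i,j) = comp_interface w n in
      if Lplus w (i+1, j+1) > Lminus w (i+1, j+1) then (i+1, j) else (i, j+1))"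

end

theory Submission
  imports Defs
begin

text \<open>The event that the interface lies to the left of a given point is
  \<open>L\<^sup>+(z) \<le> L\<^sup>-(z)\<close> for a deterministic point \<open>z\<close>, so everything reduces to the joint
  fluctuations of \<open>L\<^sup>+\<close> and \<open>L\<^sup>-\<close> at \<open>z \<approx> (\<eta> s, s)\<close> on the scale \<open>\<surd>s\<close>.
  Rescaling the weights of the horizontal axis embeds \<open>L\<^sup>+\<close> into stationary last passage percolation
  of density \<open>\<rho>\<^sub>-\<close>. Because \<open>\<rho>\<^sub>- < \<rho>\<^sub>+\<close>, the maximising path leaves the vertical
  axis at a macroscopic height, about \<open>y\<close>, from which \<open>z\<close> is seen in the characteristic direction;
  hence \<open>L\<^sup>+(z)\<close> equals the stationary passage time with high probability. By Burke's theorem the increment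
  from \<open>(0, y)\<close> to \<open>z\<close> is again a stationary passage time, and its variance is \<open>o(s)\<close>: the identity
  \<open>Var T = n/\<rho>\<^sup>2 - m/(1 - \<rho>)\<^sup>2 + 2 Cov(S, T)\<close>, with \<open>S\<close> the sum of the weights on the south side,
  loses its linear terms, and \<open>Cov(S, T)\<close> is small since long exits along the axis are unlikely, by a
  comparison of first moments with a stationary model of larger density.
  So up to \<open>o(\<surd>s)\<close> the fluctuations of \<open>L\<^sup>+\<close> are those of the first \<open>y\<close> weights on the vertical axis, those of
  \<open>L\<^sup>-\<close> come in the same way from the horizontal axis, and these two sums are independent.\<close>

section \<open>Last passage times and the competition interface\<close>

text \<open>One function decides every exit. At density r the stationary passage time to
  \<open>(a s, b s)\<close> has mean \<open>(a / (1 - r) + b / r) s\<close>, whose slope at r =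
  \<rho> is proportional to \<open>a / (1 - \<rho>)\<^sup>2 - b / \<rho>\<^sup>2\<close>. If the
  slope is negative, a slightly larger density \<rho>' has a mean smaller by order s. A maximising
  path that uses the horizontal axis would force the passage time below a passage time of the
  \<rho>'-model, so below a quantity whose mean is too small by order s; variances linear in s and
  Chebyshev rule this out. In the characteristic direction the slope vanishes and the argument says
  nothing about short exits. It recovers for exits beyond \<open>\<kappa> s\<close>, because the
  remaining displacement \<open>((a - \<kappa>) s, b s)\<close> has negative slope again. Hence the
  covariance is split at a macroscopic \<open>\<kappa> s\<close>, with \<kappa> small compared with
  the target error. This yields the variance only as \<open>o(s)\<close>, far from the sharp order,
  but fluctuations on the scale \<open>sqrt s\<close> ask for no more.\<close>

text \<open>As in \<open>path_weight\<close>, the weight at the origin never enters. The recursive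
  form lets comparisons of environments be proved by induction over the grid, without naming a
  maximising path.\<close>

fun lpt :: "(nat \<times> nat \<Rightarrow> real) \<Rightarrow> nat \<Rightarrow> nat \<Rightarrow> real" where
  "lpt w 0 0 = 0"
| "lpt w (Suc i) 0 = lpt w i 0 + w (Suc i, 0)"
| "lpt w 0 (Suc j) = lpt w 0 j + w (0, Suc j)"
| "lpt w (Suc i) (Suc j) = w (Suc i, Suc j) + max (lpt w i (Suc j)) (lpt w (Suc i) j)"

lemma lpt_row0: "lpt w i 0 = (\<Sum>k=1..i. w (k, 0))"
  by (induction i) auto

lemma lpt_col0: "lpt w 0 j = (\<Sum>k=1..j. w (0, k))"
  by (induction j) auto

lemma lpt_cong:
  assumes "\<And>a b. a \<le> i \<Longrightarrow> b \<le> j \<Longrightarrow> (a, b) \<noteq> (0, 0) \<Longrightarrow> w (a, b) = w' (a, b)"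
  shows "lpt w i j = lpt w' i j"
  using assms by (induction w i j rule: lpt.induct) (auto simp: le_Suc_eq)

lemma lpt_mono:
  assumes "\<And>z. w z \<le> w' z"
  shows "lpt w i j \<le> lpt w' i j"
  using assms
proof (induction w i j rule: lpt.induct)
  case (4 w i j)
  then show ?case by (auto intro!: add_mono max.mono)
qed (auto intro!: add_mono)

lemma lpt_nonneg:
  assumes "\<And>z. 0 \<le> w z"
  shows "0 \<le> lpt w i j"
  using assms by (induction w i j rule: lpt.induct) (auto intro!: add_nonneg_nonneg simp: le_max_iff_disj)

text \<open>A path visits \<open>(Suc k, 0)\<close> at most once. This Lipschitz bound later
  controls the influence of a single axis weight.\<close>

lemma lpt_le_lpt_upd_zero:
  assumes "0 \<le> w (Suc k, 0)"
  shows "lpt w i j \<le> lpt (w((Suc k, 0) := 0)) i j + (if Suc k \<le> i then w (Suc k, 0) else 0)"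
  using assms
proof (induction w i j rule: lpt.induct)
  case (4 w i j)
  then show ?case by (auto simp: max_def split: if_splits)
qed auto

text \<open>Either a maximising path makes no use of the axis beyond column \<open>k\<close>, and
  zeroing those weights changes nothing, or it passes \<open>(k, 0)\<close> and steps right, and the
  rest of it is a path in the quadrant with corner \<open>(k, 0)\<close>. Such a path never returns
  to column \<open>k\<close>, so \<open>w\<close> and \<open>w'\<close> are not compared there; this
  freedom allows \<open>w'\<close> to be a stationary field of another density.\<close>

lemma lpt_exit_right_bound:
  assumes w': "\<And>i. i \<ge> 1 \<Longrightarrow> w (k + i, 0) \<le> w' (i, 0)" "\<And>j. j \<ge> 1 \<Longrightarrow> 0 \<le> w' (0, j)"
    and bulk: "\<And>i j. i \<ge> 1 \<Longrightarrow> j \<ge> 1 \<Longrightarrow> w (k + i, j) \<le> w' (i, j)"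
  shows "lpt w (k + i) j \<le> max (lpt (\<lambda>(a, b). if b = 0 \<and> a > k then 0 else w (a, b)) (k + i) j)
           (lpt w k 0 + lpt w' i j)"
proof -
  define v where "v = (\<lambda>(a, b). if b = 0 \<and> a > k then 0 else w (a, b))"
  have col: "lpt w k j = lpt v k j" for j
    by (rule lpt_cong) (auto simp: v_def)
  have row: "lpt w (k + i) 0 \<le> lpt w k 0 + lpt w' i 0" for i
    using w'(1)[of "Suc i" for i] by (induction i) (auto, smt (verit))
  have "lpt w (k + i) j \<le> max (lpt v (k + i) j) (lpt w k 0 + lpt w' i j)"
  proof (induction j arbitrary: i)
    case 0
    then show ?case using row[of i] by (simp add: le_max_iff_disj)
  next
    case (Suc j)
    note IHj = this
    show ?case
    proof (induction i)
      case 0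
      then show ?case using col[of "Suc j"] by (simp add: le_max_iff_disj)
    next
      case (Suc i)
      have "v (Suc (k + i), Suc j) = w (Suc (k + i), Suc j)"
        by (simp add: v_def)
      moreover have "w (Suc (k + i), Suc j) \<le> w' (Suc i, Suc j)"
        using bulk[of "Suc i" "Suc j"] by simp
      ultimately show ?case
        using Suc IHj[of "Suc i"] by (auto simp: max_def split: if_splits)
    qed
  qed
  then show ?thesis by (simp add: v_def)
qed

section \<open>Recursions for the path maxima \<open>Lplus\<close> and \<open>Lminus\<close>\<close>

lemma up_right_path_snoc:
  assumes "\<pi> \<noteq> []"
  shows "up_right_path (\<pi> @ [z]) \<longleftrightarrow> up_right_path \<pi> \<and>
     (z = (fst (last \<pi>) + 1, snd (last \<pi>)) \<or> z = (fst (last \<pi>), snd (last \<pi>) + 1))"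
proof -
  obtain n where n: "length \<pi> = Suc n"
    using assms by (cases \<pi>) auto
  have last: "last \<pi> = \<pi> ! n"
    using n assms by (simp add: last_conv_nth)
  show ?thesis
    unfolding up_right_path_def last using assms n
    by (auto simp: nth_append less_Suc_eq all_conj_distrib)
qed

text \<open>Removing the last point keeps the prescribed second point, except for the path of length
  two, which is the first set of the union. Splitting at the last point matches the recursion of
  \<open>lpt\<close>.\<close>

lemma paths_via_snoc:
  "paths_via s z = (if z = s \<and> (z = (1, 0) \<or> z = (0, 1)) then {[(0, 0), z]} else {})
     \<union> (\<Union>z'\<in>{z'. z = (fst z' + 1, snd z') \<or> z = (fst z', snd z' + 1)}. (\<lambda>\<pi>. \<pi> @ [z]) ` paths_via s z')"
  (is "_ = ?A \<union> ?B")
proof (intro equalityI subsetI)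
  fix \<pi> assume \<pi>: "\<pi> \<in> paths_via s z"
  then have len: "length \<pi> \<ge> 2" by (simp add: paths_via_def)
  then obtain \<pi>' where \<pi>': "\<pi> = \<pi>' @ [z]" "\<pi>' \<noteq> []"
    using \<pi> by (cases \<pi> rule: rev_cases) (fastforce simp: paths_via_def)+
  show "\<pi> \<in> ?A \<union> ?B"
  proof (cases "length \<pi> = 2")
    case True
    with \<pi>' have "length \<pi>' = 1" by simp
    then obtain a where a: "\<pi>' = [a]" by (auto simp: length_Suc_conv)
    then show ?thesis using \<pi> \<pi>'
      by (auto simp: paths_via_def up_right_path_def)
  next
    case False
    then have len': "length \<pi>' \<ge> 2" using len \<pi>' by auto
    have "\<pi>' \<in> paths_via s (last \<pi>')"
      using \<pi> \<pi>' len' up_right_path_snoc[OF \<pi>'(2), of z]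
      by (auto simp: paths_via_def nth_append)
    moreover have "z = (fst (last \<pi>') + 1, snd (last \<pi>')) \<or> z = (fst (last \<pi>'), snd (last \<pi>') + 1)"
      using \<pi> \<pi>' up_right_path_snoc[OF \<pi>'(2), of z] by (auto simp: paths_via_def)
    ultimately show ?thesis using \<pi>'(1) by blast
  qed
next
  fix \<pi> assume "\<pi> \<in> ?A \<union> ?B"
  then show "\<pi> \<in> paths_via s z"
  proof
    assume "\<pi> \<in> ?A"
    then show ?thesis by (auto simp: paths_via_def up_right_path_def split: if_splits)
  next
    assume "\<pi> \<in> ?B"
    then obtain z' \<pi>' where "z = (fst z' + 1, snd z') \<or> z = (fst z', snd z' + 1)"
      "\<pi>' \<in> paths_via s z'" "\<pi> = \<pi>' @ [z]" by blast
    moreover from this have "\<pi>' \<noteq> []"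
      by (auto simp: paths_via_def)
    ultimately show ?thesis
      by (auto simp: paths_via_def nth_append up_right_path_snoc)
  qed
qed

lemma paths_via_00: "paths_via s (0, 0) = {}"
  by (subst paths_via_snoc) auto

lemma paths_via_Suc_0:
  "paths_via s (Suc i, 0) = (if i = 0 \<and> s = (1, 0) then {[(0, 0), (1, 0)]} else {})
     \<union> (\<lambda>\<pi>. \<pi> @ [(Suc i, 0)]) ` paths_via s (i, 0)"
  by (subst paths_via_snoc) (auto simp: image_iff)

lemma paths_via_0_Suc:
  "paths_via s (0, Suc j) = (if j = 0 \<and> s = (0, 1) then {[(0, 0), (0, 1)]} else {})
     \<union> (\<lambda>\<pi>. \<pi> @ [(0, Suc j)]) ` paths_via s (0, j)"
  by (subst paths_via_snoc) (auto simp: image_iff)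

lemma paths_via_Suc_Suc:
  "paths_via s (Suc i, Suc j) = (\<lambda>\<pi>. \<pi> @ [(Suc i, Suc j)]) ` (paths_via s (i, Suc j) \<union> paths_via s (Suc i, j))"
proof -
  have "{z'. (Suc i, Suc j) = (fst z' + 1, snd z') \<or> (Suc i, Suc j) = (fst z', snd z' + 1)}
      = {(i, Suc j), (Suc i, j)}"
    by (auto simp: prod_eq_iff)
  then show ?thesis
    by (subst paths_via_snoc) (simp add: image_Un)
qed

lemma finite_paths_via: "finite (paths_via s (i, j))"
proof (induction i arbitrary: j)
  case 0
  show ?case by (induction j) (auto simp: paths_via_00 paths_via_0_Suc)
next
  case (Suc i)
  then show ?case by (induction j) (auto simp: paths_via_Suc_0 paths_via_Suc_Suc)
qed

lemma paths_via_01_row0: "paths_via (0, 1) (i, 0) = {}"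
  by (induction i) (auto simp: paths_via_00 paths_via_Suc_0)

lemma paths_via_01_nonempty: "paths_via (0, 1) (i, Suc j) \<noteq> {}"
proof (induction i)
  case 0
  show ?case by (induction j) (auto simp: paths_via_0_Suc)
qed (auto simp: paths_via_Suc_Suc)

lemma Max_path_weight_snoc:
  assumes "A \<noteq> {}" "finite A" "\<And>\<pi>. \<pi> \<in> A \<Longrightarrow> \<pi> \<noteq> []"
  shows "Max (path_weight w ` (\<lambda>\<pi>. \<pi> @ [z]) ` A) = w z + Max (path_weight w ` A)"
proof -
  have "path_weight w ` (\<lambda>\<pi>. \<pi> @ [z]) ` A = (\<lambda>y. w z + y) ` path_weight w ` A"
    unfolding image_image using assms(3) by (intro image_cong) (auto simp: path_weight_def)
  then show ?thesis
    using assms(1,2) by (simp add: mono_Max_commute[of "(+) (w z)"] monoI)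
qed

lemma paths_via_not_Nil: "\<pi> \<in> paths_via s z \<Longrightarrow> \<pi> \<noteq> []"
  by (auto simp: paths_via_def)

text \<open>No path through \<open>(0, 1)\<close> ends on row 0, where \<open>Lplus\<close> would be
  a maximum over the empty set. Hence row 1 has its own clause, with the left predecessor
  only.\<close>

lemma Lplus_rec:
  "Lplus w (0, Suc 0) = w (0, Suc 0)"
  "Lplus w (0, Suc (Suc j)) = w (0, Suc (Suc j)) + Lplus w (0, Suc j)"
  "Lplus w (Suc i, Suc 0) = w (Suc i, Suc 0) + Lplus w (i, Suc 0)"
  "Lplus w (Suc i, Suc (Suc j)) =
     w (Suc i, Suc (Suc j)) + max (Lplus w (i, Suc (Suc j))) (Lplus w (Suc i, Suc j))"
proof -
  note M = Max_path_weight_snoc[OF _ _ paths_via_not_Nil]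
  show "Lplus w (0, Suc 0) = w (0, Suc 0)"
    by (simp add: Lplus_def paths_via_0_Suc paths_via_00 path_weight_def)
  show "Lplus w (0, Suc (Suc j)) = w (0, Suc (Suc j)) + Lplus w (0, Suc j)"
    unfolding Lplus_def
    using M[OF paths_via_01_nonempty finite_paths_via, where w = w and z = "(0, Suc (Suc j))"]
    by (subst paths_via_0_Suc) simp
  show "Lplus w (Suc i, Suc 0) = w (Suc i, Suc 0) + Lplus w (i, Suc 0)"
    unfolding Lplus_def
    using M[OF paths_via_01_nonempty finite_paths_via, where w = w and z = "(Suc i, Suc 0)"]
    by (subst paths_via_Suc_Suc) (simp add: paths_via_01_row0[simplified])
  have "Lplus w (Suc i, Suc (Suc j)) = w (Suc i, Suc (Suc j)) +
     Max (path_weight w ` (paths_via (0, 1) (i, Suc (Suc j)) \<union> paths_via (0, 1) (Suc i, Suc j)))"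
    unfolding Lplus_def paths_via_Suc_Suc[of _ i "Suc j"]
    by (rule Max_path_weight_snoc)
      (use paths_via_01_nonempty finite_paths_via in \<open>auto dest: paths_via_not_Nil\<close>)
  also have "Max (path_weight w ` (paths_via (0, 1) (i, Suc (Suc j)) \<union> paths_via (0, 1) (Suc i, Suc j)))
      = max (Lplus w (i, Suc (Suc j))) (Lplus w (Suc i, Suc j))"
    unfolding Lplus_def image_Un
    by (rule Max_Un) (use paths_via_01_nonempty finite_paths_via in auto)
  finally show "Lplus w (Suc i, Suc (Suc j)) =
     w (Suc i, Suc (Suc j)) + max (Lplus w (i, Suc (Suc j))) (Lplus w (Suc i, Suc j))" .
qed

lemma map_swap_paths_via: "map prod.swap ` paths_via (a, b) (i, j) = paths_via (b, a) (j, i)"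
proof -
  have sub: "map prod.swap ` paths_via (a, b) (i, j) \<subseteq> paths_via (b, a) (j, i)" for a b i j
    by (auto simp: paths_via_def up_right_path_def hd_map last_map prod_eq_iff)
  have "paths_via (b, a) (j, i) = map prod.swap ` map prod.swap ` paths_via (b, a) (j, i)"
    by (simp add: image_image)
  also have "\<dots> \<subseteq> map prod.swap ` paths_via (a, b) (i, j)"
    by (intro image_mono sub)
  finally show ?thesis using sub by blast
qed

lemma path_weight_map_swap: "path_weight w (map prod.swap \<pi>) = path_weight (w \<circ> prod.swap) \<pi>"
  by (cases \<pi>) (simp_all add: path_weight_def)

lemma Lminus_eq_Lplus_swap: "Lminus w (i, j) = Lplus (w \<circ> prod.swap) (j, i)"
proof -
  have "paths_via (1, 0) (i, j) = map prod.swap ` paths_via (0, 1) (j, i)"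
    by (rule map_swap_paths_via[symmetric])
  then show ?thesis
    unfolding Lminus_def Lplus_def by (simp only: image_image path_weight_map_swap)
qed

lemma Lminus_rec:
  "Lminus w (Suc 0, 0) = w (Suc 0, 0)"
  "Lminus w (Suc (Suc i), 0) = w (Suc (Suc i), 0) + Lminus w (Suc i, 0)"
  "Lminus w (Suc 0, Suc j) = w (Suc 0, Suc j) + Lminus w (Suc 0, j)"
  "Lminus w (Suc (Suc i), Suc j) =
     w (Suc (Suc i), Suc j) + max (Lminus w (Suc i, Suc j)) (Lminus w (Suc (Suc i), j))"
  by (simp_all add: Lminus_eq_Lplus_swap Lplus_rec max.commute)

text \<open>For nonnegative weights a path along an axis of weight zero is dominated by one that leaves
  through the other axis, so zeroing the horizontal axis amounts to forbidding it.\<close>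
lemma Lplus_eq_lpt:
  assumes "\<And>z. 0 \<le> w z"
  shows "Lplus w (i, Suc j) = lpt (\<lambda>(a, b). if b = 0 then 0 else w (a, b)) i (Suc j)"
proof -
  define v where "v = (\<lambda>(a, b). if b = 0 then 0 else w (a, b))"
  have v: "v (a, Suc b) = w (a, Suc b)" "v (a, 0) = 0" for a b by (simp_all add: v_def)
  have v0: "lpt v i 0 = 0" for i by (simp add: lpt_row0 v)
  have nn: "0 \<le> lpt v i j" for i j by (rule lpt_nonneg) (auto simp: v_def assms)
  have "Lplus w (i, Suc j) = lpt v i (Suc j)"
  proof (induction j arbitrary: i)
    case 0
    show ?case by (induction i) (simp_all add: Lplus_rec v v0 max_absorb1 nn)
  next
    case (Suc j)
    note IH = this
    show ?case by (induction i) (simp_all add: Lplus_rec v v0 IH)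
  qed
  then show ?thesis by (simp add: v_def)
qed

section \<open>The interface along antidiagonals\<close>

lemma comp_interface_sum: "fst (comp_interface w n) + snd (comp_interface w n) = n"
  by (induction n) (auto simp: Let_def split: prod.splits)

text \<open>Along every antidiagonal the points of the upper cluster precede the others, and the
  interface records the position of the change.\<close>
lemma Lplus_gt_Lminus_iff:
  "i \<ge> 1 \<Longrightarrow> j \<ge> 1 \<Longrightarrow> i + j = Suc n \<Longrightarrow>
    Lplus w (i, j) > Lminus w (i, j) \<longleftrightarrow> i \<le> fst (comp_interface w n)"
proof (induction n arbitrary: i j)
  case 0
  then show ?case by simp
next
  case (Suc n)
  obtain I J where IJ: "comp_interface w n = (I, J)" by fastforce
  have sum: "I + J = n" using comp_interface_sum[of w n] IJ by simp
  have I': "fst (comp_interface w (Suc n)) =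
      (if Lplus w (I + 1, J + 1) > Lminus w (I + 1, J + 1) then I + 1 else I)"
    using IJ by (simp add: Let_def)
  have IH: "Lplus w (i, j) > Lminus w (i, j) \<longleftrightarrow> i \<le> I" if "i \<ge> 1" "j \<ge> 1" "i + j = Suc n" for i j
    using Suc.IH[OF that] IJ by simp
  consider "i = I + 1" | "i \<le> I" | "i > I + 1" by linarith
  then show ?case
  proof cases
    \<comment> \<open>This is the point diagonally above the current position, whose cluster decides
      the next step by definition.\<close>
    case 1
    then have "j = J + 1" using Suc.prems sum by simp
    with 1 I' show ?thesis by simp
  next
    \<comment> \<open>The relevant predecessors lie in the upper cluster by induction, and the
      strict inequality survives the maximum and the common weight. In column 1 the left predecessor
      carries no \<open>Lminus\<close> path, so the lower one alone suffices. The last case is the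
      mirror image.\<close>
    case 2
    define j' where "j' = j - 2"
    have j: "j = Suc (Suc j')"
      using 2 sum Suc.prems by (simp add: j'_def)
    obtain i' where i: "i = Suc i'" using Suc.prems by (cases i) auto
    have p2: "Lplus w (i, Suc j') > Lminus w (i, Suc j')"
      using IH[of i "Suc j'"] 2 Suc.prems j by simp
    have "Lplus w (i, j) > Lminus w (i, j)"
    proof (cases i')
      case 0
      then show ?thesis using p2 by (simp add: i j Lplus_rec Lminus_rec)
    next
      case (Suc i'')
      have "Lplus w (i', j) > Lminus w (i', j)"
        using IH[of i' j] 2 Suc.prems i Suc by simp
      then show ?thesis
        using p2 unfolding i j Suc Lplus_rec(4)[of w "Suc i''" j'] Lminus_rec(4)[of w i'' "Suc j'"]
        by (auto simp: max_def)
    qed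
    then show ?thesis using 2 I' by simp
  next
    case 3
    define i' where "i' = i - 2"
    have i: "i = Suc (Suc i')"
      using 3 by (simp add: i'_def)
    obtain j' where j: "j = Suc j'" using Suc.prems by (cases j) auto
    have p1: "\<not> Lplus w (Suc i', j) > Lminus w (Suc i', j)"
      using IH[of "Suc i'" j] 3 Suc.prems i by simp
    have "\<not> Lplus w (i, j) > Lminus w (i, j)"
    proof (cases j')
      case 0
      then show ?thesis using p1 by (simp add: i j Lplus_rec Lminus_rec)
    next
      case (Suc j'')
      have "\<not> Lplus w (i, j') > Lminus w (i, j')"
        using IH[of i j'] 3 Suc.prems j Suc by simp
      then show ?thesis
        using p1 unfolding i j Suc Lplus_rec(4)[of w "Suc i'" j''] Lminus_rec(4)[of w i' "Suc j''"]
        by (auto simp: max_def)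
    qed
    then show ?thesis using 3 I' by auto
  qed
qed

text \<open>The negated cluster criterion at the first point right of \<open>k\<close> on the next
  antidiagonal; \<open>k < n\<close> keeps its second coordinate positive.\<close>

lemma comp_interface_le_iff:
  assumes "k < n"
  shows "fst (comp_interface w n) \<le> k \<longleftrightarrow> Lplus w (Suc k, n - k) \<le> Lminus w (Suc k, n - k)"
  using Lplus_gt_Lminus_iff[of "Suc k" "n - k" n w] assms by (auto simp: not_less_eq_eq)

section \<open>The corner flip for exponential weights\<close>

text \<open>The pair at \<open>a\<close> and \<open>b\<close> is one block, independent of all other
  variables, and within the block independence is \<open>fg\<close>. The blocks are indexed by
  everything except \<open>b\<close>; single variables are duplicated in \<open>Y\<close> so that
  every block takes values in pairs.\<close>

lemma (in prob_space) indep_vars_update_pair: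
  fixes X :: "'i \<Rightarrow> 'a \<Rightarrow> real"
  assumes X: "indep_vars (\<lambda>_. borel) X UNIV" and ab: "a \<noteq> b"
    and f[measurable]: "case_prod f \<in> borel_measurable (borel \<Otimes>\<^sub>M borel)"
    and g[measurable]: "case_prod g \<in> borel_measurable (borel \<Otimes>\<^sub>M borel)"
    and fg: "indep_var borel (\<lambda>x. f (X a x) (X b x)) borel (\<lambda>x. g (X a x) (X b x))"
  shows "indep_vars (\<lambda>_. borel) (X(a := (\<lambda>x. f (X a x) (X b x)), b := (\<lambda>x. g (X a x) (X b x)))) UNIV"
    (is "indep_vars _ ?Z UNIV")
proof -
  define K where "K = (\<lambda>i. if i = a then {a, b} else {i})"
  define Y where "Y = (\<lambda>i \<phi>. if i = a then (f (\<phi> a) (\<phi> b), g (\<phi> a) (\<phi> b)) else (\<phi> i, \<phi> i :: real))"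
  define W where "W = (\<lambda>i. Y i \<circ> (\<lambda>x. restrict (\<lambda>i. X i x) (K i)))"
  have rvX[measurable]: "X i \<in> borel_measurable M" for i
    using X by (auto simp: indep_vars_def2)
  have rvZ[measurable]: "?Z i \<in> borel_measurable M" for i
    by (cases "i = a"; cases "i = b"; simp)
  have "indep_vars (\<lambda>j. PiM (K j) (\<lambda>_. borel)) (\<lambda>j x. restrict (\<lambda>i. X i x) (K j)) (UNIV - {b})"
    by (rule indep_vars_restrict[OF X]) (auto simp: K_def disjoint_family_on_def)
  then have W: "indep_vars (\<lambda>_. borel \<Otimes>\<^sub>M borel) W (UNIV - {b})"
    unfolding W_def
  proof (rule indep_vars_compose)
    fix i assume "i \<in> UNIV - {b}"
    show "Y i \<in> PiM (K i) (\<lambda>_. borel) \<rightarrow>\<^sub>M borel \<Otimes>\<^sub>M borel"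
    proof (cases "i = a")
      case True
      have [measurable]: "(\<lambda>\<phi>. \<phi> a) \<in> borel_measurable (PiM {a, b} (\<lambda>_. borel))"
         "(\<lambda>\<phi>. \<phi> b) \<in> borel_measurable (PiM {a, b} (\<lambda>_. borel))"
        by (rule measurable_component_singleton; simp)+
      show ?thesis using True by (simp add: Y_def K_def)
    next
      case False
      have [measurable]: "(\<lambda>\<phi>. \<phi> i) \<in> borel_measurable (PiM {i} (\<lambda>_. borel))"
        by (rule measurable_component_singleton; simp)
      show ?thesis using False by (simp add: Y_def K_def)
    qed
  qed
  have Wa: "W a x = (?Z a x, ?Z b x)" for x
    using ab by (auto simp: W_def Y_def K_def)
  have Wi: "W i x = (?Z i x, ?Z i x)" if "i \<noteq> a" "i \<noteq> b" for i x
    using that by (auto simp: W_def Y_def K_def)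
  show ?thesis
    unfolding indep_vars_def2
  proof (intro conjI ballI indep_setsI)
    show "?Z i \<in> borel_measurable M" for i by (rule rvZ)
    show "{?Z i -` A \<inter> space M |A. A \<in> sets borel} \<subseteq> events" for i
      using measurable_sets[OF rvZ[of i]] by auto
    fix A J
    assume J: "J \<noteq> {}" "finite J" and "\<forall>j\<in>J. A j \<in> {?Z j -` A \<inter> space M |A. A \<in> sets borel}"
    then obtain B where B: "\<And>j. j \<in> J \<Longrightarrow> A j = ?Z j -` B j \<inter> space M \<and> B j \<in> sets borel"
      by simp metis
    \<comment> \<open>Indices outside \<open>J\<close> get the trivial event, so that
      \<open>a\<close> and \<open>b\<close> can always be included in the product.\<close>
    define B' where "B' = (\<lambda>j. if j \<in> J then B j else UNIV)"
    have B'[measurable]: "B' j \<in> sets borel" for j using B by (auto simp: B'_def)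
    define C where "C = (\<lambda>j. if j = a then B' a \<times> B' b else B' j \<times> UNIV)"
    define J' where "J' = insert a (J - {b})"
    have J': "finite J'" "a \<in> J'" "b \<notin> J'" "J' \<subseteq> UNIV - {b}" using J ab by (auto simp: J'_def)
    have "(\<Inter>j\<in>J. A j) = (\<Inter>j\<in>J'. W j -` C j \<inter> space M)"
    proof -
      have m1: "x \<in> (\<Inter>j\<in>J. A j) \<longleftrightarrow> x \<in> space M \<and> (\<forall>j. ?Z j x \<in> B' j)" for x
        using B J by (auto simp: B'_def)
      have m2: "x \<in> (\<Inter>j\<in>J'. W j -` C j \<inter> space M) \<longleftrightarrow> x \<in> space M \<and> (\<forall>j. ?Z j x \<in> B' j)" for x
      proof -
        have "x \<in> (\<Inter>j\<in>J'. W j -` C j \<inter> space M) \<longleftrightarrow> x \<in> space M \<and> W a x \<in> C a \<and> (\<forall>j\<in>J'-{a}. W j x \<in> C j)"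
          using J' by auto
        also have "(\<forall>j\<in>J'-{a}. W j x \<in> C j) \<longleftrightarrow> (\<forall>j\<in>J'-{a}. ?Z j x \<in> B' j)"
        proof (intro ball_cong refl)
          fix j assume "j \<in> J' - {a}"
          then have "j \<noteq> a" "j \<noteq> b" using J' by auto
          then show "W j x \<in> C j \<longleftrightarrow> ?Z j x \<in> B' j"
            unfolding Wi[OF \<open>j \<noteq> a\<close> \<open>j \<noteq> b\<close>] by (simp add: C_def)
        qed
        also have "W a x \<in> C a \<longleftrightarrow> ?Z a x \<in> B' a \<and> ?Z b x \<in> B' b"
          unfolding Wa C_def by simp
        finally show ?thesis
          by (auto simp: J'_def B'_def simp del: fun_upd_apply)
      qed
      show ?thesis by (rule set_eqI) (rule trans[OF m1 m2[symmetric]])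
    qed
    then have "prob (\<Inter>j\<in>J. A j) = prob (\<Inter>j\<in>J'. W j -` C j \<inter> space M)" by simp
    also have "\<dots> = (\<Prod>j\<in>J'. prob (W j -` C j \<inter> space M))"
      using J' by (intro indep_varsD[OF W]) (auto simp: C_def)
    also have "\<dots> = prob (W a -` C a \<inter> space M) * (\<Prod>j\<in>J'-{a}. prob (W j -` C j \<inter> space M))"
      using J' by (simp add: prod.remove)
    also have "W a -` C a \<inter> space M = (\<lambda>x. (?Z a x, ?Z b x)) -` (B' a \<times> B' b) \<inter> space M"
      by (auto simp: Wa C_def simp del: fun_upd_apply)
    also have "prob \<dots> = prob (?Z a -` B' a \<inter> space M) * prob (?Z b -` B' b \<inter> space M)"
      using fg ab by (intro indep_varD[where Ma = borel and Mb = borel]) auto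
    also have "(\<Prod>j\<in>J'-{a}. prob (W j -` C j \<inter> space M)) = (\<Prod>j\<in>J'-{a}. prob (?Z j -` B' j \<inter> space M))"
    proof (intro prod.cong refl arg_cong[where f = prob])
      fix j assume "j \<in> J' - {a}"
      then have j: "j \<noteq> a" "j \<noteq> b" using J' by auto
      show "W j -` C j \<inter> space M = ?Z j -` B' j \<inter> space M"
        using Wi[OF j] j by (auto simp: C_def)
    qed
    also have "prob (?Z a -` B' a \<inter> space M) * prob (?Z b -` B' b \<inter> space M) * \<dots>
        = (\<Prod>j\<in>J\<union>{a,b}. prob (?Z j -` B' j \<inter> space M))"
    proof -
      have "J \<union> {a,b} = insert a (insert b (J' - {a}))" using ab by (auto simp: J'_def)
      then show ?thesis using J' ab by (simp del: fun_upd_apply add: mult.assoc)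
    qed
    also have "\<dots> = (\<Prod>j\<in>J. prob (?Z j -` B' j \<inter> space M))"
      using J by (intro prod.mono_neutral_right) (auto simp: B'_def prob_space)
    also have "\<dots> = (\<Prod>j\<in>J. prob (A j))"
      using B by (intro prod.cong refl) (auto simp: B'_def)
    finally show "prob (\<Inter>j\<in>J. A j) = (\<Prod>j\<in>J. prob (A j))" .
  qed
qed

lemma (in prob_space) indep_vars_inj_reindex:
  fixes X :: "'i \<Rightarrow> 'a \<Rightarrow> real" and h :: "'j \<Rightarrow> 'i"
  assumes X: "indep_vars (\<lambda>_. borel) X UNIV" and h: "inj h"
  shows "indep_vars (\<lambda>_. borel) (\<lambda>j. X (h j)) UNIV"
proof -
  have "indep_vars (\<lambda>j. PiM {h j} (\<lambda>_. borel)) (\<lambda>j x. restrict (\<lambda>i. X i x) {h j}) UNIV"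
    using h by (intro indep_vars_restrict[OF X]) (auto simp: disjoint_family_on_def inj_def)
  then have "indep_vars (\<lambda>_. borel) (\<lambda>j. (\<lambda>\<phi>. \<phi> (h j)) \<circ> (\<lambda>x. restrict (\<lambda>i. X i x) {h j})) UNIV"
    by (rule indep_vars_compose) (auto intro!: measurable_component_singleton)
  then show ?thesis by (simp add: comp_def)
qed

lemma (in prob_space) indep_vars_pair:
  fixes X :: "'i \<Rightarrow> 'a \<Rightarrow> real"
  assumes X: "indep_vars (\<lambda>_. borel) X UNIV" and ab: "a \<noteq> b"
  shows "indep_var borel (X a) borel (X b)"
proof -
  have "indep_vars (\<lambda>_. borel) (\<lambda>c. X (case_bool a b c)) UNIV"
    using ab by (intro indep_vars_inj_reindex[OF X]) (auto simp: inj_def split: bool.splits)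
  moreover have "(\<lambda>c. X (case_bool a b c)) = case_bool (X a) (X b)" "(\<lambda>_. borel) = case_bool borel borel"
    by (auto simp: fun_eq_iff split: bool.splits)
  ultimately show ?thesis unfolding indep_var_def by metis
qed

text \<open>The hypothesis \<open>inv\<close> says that \<open>F\<close> ignores coordinate
  \<open>a\<close>. Evaluating it with a constant in that slot makes it a function of the other
  coordinates alone.\<close>

lemma (in prob_space) indep_var_rest:
  fixes X :: "'i \<Rightarrow> 'a \<Rightarrow> real"
  assumes X: "indep_vars (\<lambda>_. borel) X UNIV"
    and F[measurable]: "F \<in> borel_measurable (PiM UNIV (\<lambda>_. borel))"
    and inv: "\<And>y c. F (y(a := c)) = F y"
  shows "indep_var borel (X a) borel (\<lambda>x. F (\<lambda>i. X i x) :: real)"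
proof -
  have "indep_var (PiM {a} (\<lambda>_. borel)) (\<lambda>x. restrict (\<lambda>i. X i x) {a})
     (PiM (UNIV - {a}) (\<lambda>_. borel)) (\<lambda>x. restrict (\<lambda>i. X i x) (UNIV - {a}))"
    by (rule indep_var_restrict[OF X]) auto
  then have "indep_var borel ((\<lambda>\<phi>. \<phi> a) \<circ> (\<lambda>x. restrict (\<lambda>i. X i x) {a}))
     borel ((\<lambda>\<phi>. F (\<phi>(a := 0))) \<circ> (\<lambda>x. restrict (\<lambda>i. X i x) (UNIV - {a})))"
  proof (rule indep_var_compose)
    have "(\<lambda>\<phi>. \<phi>(a := 0)) \<in> PiM (UNIV - {a}) (\<lambda>_. borel) \<rightarrow>\<^sub>M PiM UNIV (\<lambda>_. borel :: real measure)"
      by (rule measurable_fun_upd[where J = "UNIV - {a}"]) auto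
    from measurable_compose[OF this F]
    show "(\<lambda>\<phi>. F (\<phi>(a := 0))) \<in> PiM (UNIV - {a}) (\<lambda>_. borel) \<rightarrow>\<^sub>M borel" .
  qed (auto intro!: measurable_component_singleton)
  moreover have "F ((restrict (\<lambda>i. X i x) (UNIV - {a}))(a := 0)) = F (\<lambda>i. X i x)" for x
  proof -
    have "(restrict (\<lambda>i. X i x) (UNIV - {a}))(a := 0) = (\<lambda>i. X i x)(a := 0)" by (auto simp: fun_eq_iff)
    then show ?thesis by (simp add: inv)
  qed
  ultimately show ?thesis by (simp add: comp_def)
qed

lemma (in prob_space) indep_vars_scale:
  fixes X :: "'i \<Rightarrow> 'a \<Rightarrow> real"
  assumes "indep_vars (\<lambda>_. borel) X UNIV"
  shows "indep_vars (\<lambda>_. borel) (\<lambda>i x. c i * X i x) UNIV"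
  using indep_vars_compose2[OF assms, of "\<lambda>i y. c i * y" "\<lambda>_. borel"] by simp

lemma (in prob_space) exponential_distributed_scale:
  assumes "distributed M lborel X (exponential_density l)" "0 < l" "0 < c"
  shows "distributed M lborel (\<lambda>x. c * X x) (exponential_density (l / c))"
proof -
  have rv[measurable]: "X \<in> borel_measurable M"
    using distributed_measurable[OF assms(1)] by simp
  have "\<P>(x in M. c * X x \<le> a) = 1 - exp (- a * (l / c))" if "0 \<le> a" for a
  proof -
    have "\<P>(x in M. c * X x \<le> a) = \<P>(x in M. X x \<le> a / c)"
      using assms by (intro arg_cong[where f = prob]) (auto simp: field_simps)
    then show ?thesis using exponential_distributedD_le[OF assms(1), of "a / c"] that assms by simp
  qed
  then show ?thesis using assms by (simp add: exponential_distributed_iff)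
qed

text \<open>Lack of memory along the diagonal: translating both coordinates by \<open>s\<close>
  keeps their difference and multiplies the joint density by
  \<open>exp (- (l + u) * s)\<close>.\<close>

lemma (in prob_space) exponential_min_diff_shift:
  assumes l: "0 < l" "0 < u" and s: "0 \<le> s"
    and X: "distributed M lborel X (exponential_density l)"
    and Y: "distributed M lborel Y (exponential_density u)"
    and ind: "indep_var borel X borel Y" and A[measurable]: "A \<in> sets borel"
  shows "emeasure M {x \<in> space M. X x - Y x \<in> A \<and> s < min (X x) (Y x)}
    = ennreal (exp (- (l + u) * s)) * emeasure M {x \<in> space M. X x - Y x \<in> A \<and> 0 < min (X x) (Y x)}"
proof -
  have ind': "indep_var lborel X lborel Y"
    using indep_var_compose[OF ind, of "\<lambda>x. x" lborel "\<lambda>x. x" lborel] by (simp add: comp_def)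
  have J: "distributed M (lborel \<Otimes>\<^sub>M lborel) (\<lambda>x. (X x, Y x))
      (\<lambda>(x, y). ennreal (exponential_density l x) * ennreal (exponential_density u y))"
    by (rule distributed_joint_indep[OF _ _ X Y ind'])
      (auto intro!: sigma_finite_lborel)
  define S where "S = (\<lambda>r. {z :: real \<times> real. fst z - snd z \<in> A \<and> r < min (fst z) (snd z)})"
  have S[measurable]: "S r \<in> sets (lborel \<Otimes>\<^sub>M lborel)" for r
  proof -
    have "S r = {z \<in> space (lborel \<Otimes>\<^sub>M lborel). fst z - snd z \<in> A \<and> r < min (fst z) (snd z)}"
      by (auto simp: S_def space_pair_measure)
    also have "\<dots> \<in> sets (lborel \<Otimes>\<^sub>M lborel)" by measurable
    finally show ?thesis .
  qed
  have eq: "emeasure M {x \<in> space M. X x - Y x \<in> A \<and> r < min (X x) (Y x)}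
    = (\<integral>\<^sup>+x. \<integral>\<^sup>+y. ennreal (exponential_density l x) * ennreal (exponential_density u y) * indicator (S r) (x, y) \<partial>lborel \<partial>lborel)" for r
  proof -
    have "emeasure M {x \<in> space M. X x - Y x \<in> A \<and> r < min (X x) (Y x)}
      = emeasure M ((\<lambda>x. (X x, Y x)) -` S r \<inter> space M)"
      by (intro arg_cong[where f = "emeasure M"]) (auto simp: S_def)
    also have "\<dots> = (\<integral>\<^sup>+z. (case z of (x, y) \<Rightarrow> ennreal (exponential_density l x) * ennreal (exponential_density u y)) * indicator (S r) z \<partial>(lborel \<Otimes>\<^sub>M lborel))"
      by (rule distributed_emeasure[OF J S])
    also have "\<dots> = (\<integral>\<^sup>+x. \<integral>\<^sup>+y. ennreal (exponential_density l x) * ennreal (exponential_density u y) * indicator (S r) (x, y) \<partial>lborel \<partial>lborel)"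
      by (subst lborel.nn_integral_fst[symmetric]) simp_all
    finally show ?thesis .
  qed
  have pt: "ennreal (exponential_density l (s + x)) * ennreal (exponential_density u (s + y)) * indicator (S s) (s + x, s + y)
    = ennreal (exp (- (l + u) * s)) * (ennreal (exponential_density l x) * ennreal (exponential_density u y) * indicator (S 0) (x, y))" for x y
  proof (cases "(x, y) \<in> S 0")
    case True
    then have "x > 0" "y > 0" "(s + x, s + y) \<in> S s" by (auto simp: S_def)
    then show ?thesis using True s l
      by (simp add: exponential_density_def ennreal_mult'[symmetric] exp_add[symmetric] algebra_simps)
        (simp add: exp_add exp_diff exp_minus field_simps)?
  next
    case False
    then have "(s + x, s + y) \<notin> S s" by (auto simp: S_def)
    then show ?thesis using False by simp
  qed
  have "(\<integral>\<^sup>+x. \<integral>\<^sup>+y. ennreal (exponential_density l x) * ennreal (exponential_density u y) * indicator (S s) (x, y) \<partial>lborel \<partial>lborel)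
    = (\<integral>\<^sup>+x. \<integral>\<^sup>+y. ennreal (exponential_density l (s + x)) * ennreal (exponential_density u (s + y)) * indicator (S s) (s + x, s + y) \<partial>lborel \<partial>lborel)"
    (is "(\<integral>\<^sup>+x. \<integral>\<^sup>+y. ?h x y \<partial>lborel \<partial>lborel) = _")
  proof -
    have "(\<integral>\<^sup>+x. \<integral>\<^sup>+y. ?h x y \<partial>lborel \<partial>lborel) = (\<integral>\<^sup>+x. \<integral>\<^sup>+y. ?h (s + x) y \<partial>lborel \<partial>lborel)"
      by (subst nn_integral_real_affine[where c = 1 and t = s]) simp_all
    also have "\<dots> = (\<integral>\<^sup>+x. \<integral>\<^sup>+y. ?h (s + x) (s + y) \<partial>lborel \<partial>lborel)"
    proof (rule nn_integral_cong)
      show "(\<integral>\<^sup>+y. ?h (s + x) y \<partial>lborel) = (\<integral>\<^sup>+y. ?h (s + x) (s + y) \<partial>lborel)" for x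
        by (subst nn_integral_real_affine[where c = 1 and t = s]) simp_all
    qed
    finally show ?thesis .
  qed
  also have "\<dots> = ennreal (exp (- (l + u) * s)) * (\<integral>\<^sup>+x. \<integral>\<^sup>+y. ennreal (exponential_density l x) * ennreal (exponential_density u y) * indicator (S 0) (x, y) \<partial>lborel \<partial>lborel)"
    unfolding pt by (simp add: nn_integral_cmult)
  finally show ?thesis unfolding eq .
qed

text \<open>The factor in the shift identity does not depend on \<open>A\<close> and is the tail of
  the minimum. So the joint law factorises on events \<open>A\<close> times a half-line, and
  half-lines form an intersection-stable generator of the Borel sets.\<close>

lemma (in prob_space) exponential_min_indep_diff:
  assumes l: "0 < l" "0 < u"
    and X: "distributed M lborel X (exponential_density l)"
    and Y: "distributed M lborel Y (exponential_density u)"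
    and ind: "indep_var borel X borel Y"
  shows "indep_var borel (\<lambda>x. X x - Y x) borel (\<lambda>x. min (X x) (Y x))"
proof -
  have [measurable]: "X \<in> borel_measurable M" "Y \<in> borel_measurable M"
    using distributed_measurable[OF X] distributed_measurable[OF Y] by simp_all
  let ?D = "\<lambda>x. X x - Y x" and ?m = "\<lambda>x. min (X x) (Y x)"
  have m: "distributed M lborel ?m (exponential_density (l + u))"
    by (rule exponential_distributed_min[OF l X Y ind])
  have pos: "AE x in M. 0 < ?m x"
    using prob_Collect_eq_1[of "\<lambda>x. 0 < ?m x"] exponential_distributedD_gt[OF m, of 0] l by simp
  have *: "prob {x \<in> space M. ?D x \<in> A \<and> s < ?m x} = prob {x \<in> space M. ?D x \<in> A} * prob {x \<in> space M. s < ?m x}"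
    if [measurable]: "A \<in> sets borel" for A s
  proof (cases "0 \<le> s")
    case True
    have "prob {x \<in> space M. ?D x \<in> A \<and> 0 < ?m x} = prob {x \<in> space M. ?D x \<in> A}"
      by (rule finite_measure_eq_AE) (use pos in auto)
    moreover have "prob {x \<in> space M. s < ?m x} = exp (- (l + u) * s)"
      using exponential_distributedD_gt[OF m True] l by (simp add: algebra_simps)
    ultimately show ?thesis
      using arg_cong[where f = enn2real, OF exponential_min_diff_shift[OF l True X Y ind that]]
      by (simp add: measure_def enn2real_mult)
  next
    case False
    have "prob {x \<in> space M. ?D x \<in> A \<and> s < ?m x} = prob {x \<in> space M. ?D x \<in> A}"
      by (rule finite_measure_eq_AE) (use pos False in auto)
    moreover have "prob {x \<in> space M. s < ?m x} = 1"
      using pos False by (subst prob_Collect_eq_1) auto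
    ultimately show ?thesis by simp
  qed
  show ?thesis
    unfolding indep_var_def
  proof (subst indep_vars_finite[where E = "case_bool (sets borel) (insert UNIV (range greaterThan))"])
    show "\<forall>A\<in>\<Pi> i\<in>UNIV. (case i of True \<Rightarrow> sets borel | False \<Rightarrow> insert UNIV (range greaterThan)).
       prob (\<Inter>j\<in>UNIV. (case j of True \<Rightarrow> ?D | False \<Rightarrow> ?m) -` A j \<inter> space M) =
       (\<Prod>j\<in>UNIV. prob ((case j of True \<Rightarrow> ?D | False \<Rightarrow> ?m) -` A j \<inter> space M))"
    proof
      fix A :: "bool \<Rightarrow> real set"
      assume "A \<in> (\<Pi> i\<in>UNIV. (case i of True \<Rightarrow> sets borel | False \<Rightarrow> insert UNIV (range greaterThan)))"
      note A' = this
      have A: "A True \<in> sets borel" "A False = UNIV \<or> (\<exists>s. A False = {s<..})"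
        using Pi_mem[OF A', of True] Pi_mem[OF A', of False] by auto
      have "prob (?D -` A True \<inter> space M \<inter> (?m -` A False \<inter> space M))
         = prob (?D -` A True \<inter> space M) * prob (?m -` A False \<inter> space M)"
        using A(2)
      proof (elim disjE)
        assume "\<exists>s. A False = {s<..}"
        then obtain s where "A False = {s<..}" ..
        then show ?thesis using *[OF A(1), of s]
          by (simp add: vimage_def Int_def conj_ac)
      next
        assume "A False = UNIV"
        then show ?thesis by (simp add: prob_space)
      qed
      then show "prob (\<Inter>j\<in>UNIV. (case j of True \<Rightarrow> ?D | False \<Rightarrow> ?m) -` A j \<inter> space M) =
       (\<Prod>j\<in>UNIV. prob ((case j of True \<Rightarrow> ?D | False \<Rightarrow> ?m) -` A j \<inter> space M))"
        by (simp add: UNIV_bool Int_ac)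
    qed
    show "sets (case i of True \<Rightarrow> borel | False \<Rightarrow> (borel :: real measure)) = sigma_sets (space (case i of True \<Rightarrow> borel | False \<Rightarrow> borel))
      (case i of True \<Rightarrow> sets borel | False \<Rightarrow> insert UNIV (range greaterThan))" for i :: bool
    proof (cases i)
      case True
      then show ?thesis using sets.sigma_sets_eq[of "borel :: real measure"] by simp
    next
      case False
      have "sets borel = sigma_sets UNIV (range (greaterThan :: real \<Rightarrow> _))"
        by (subst borel_Ioi) simp
      also have "\<dots> = sigma_sets UNIV (insert UNIV (range greaterThan))"
        by (intro sigma_sets_eqI) (auto intro: sigma_sets_top)
      finally show ?thesis using False by simp
    qed
    have "{a<..} \<inter> {b<..} \<in> range (greaterThan :: real \<Rightarrow> _)" for a b
      by (rule range_eqI[where x = "max a b"]) auto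
    then show "Int_stable (case i of True \<Rightarrow> sets borel | False \<Rightarrow> insert UNIV (range (greaterThan :: real \<Rightarrow> _)))" for i :: bool
      by (cases i) (auto simp: Int_stable_def)
    show "(case i of True \<Rightarrow> sets borel | False \<Rightarrow> insert UNIV (range greaterThan))
      \<subseteq> Pow (space (case i of True \<Rightarrow> borel | False \<Rightarrow> (borel :: real measure)))" for i :: bool
      by (cases i) auto
    show "random_variable (case i of True \<Rightarrow> borel | False \<Rightarrow> borel) (case i of True \<Rightarrow> ?D | False \<Rightarrow> ?m)" for i :: bool
      by (cases i) auto
    show "space (case i of True \<Rightarrow> borel | False \<Rightarrow> (borel :: real measure))
      \<in> (case i of True \<Rightarrow> sets borel | False \<Rightarrow> insert UNIV (range greaterThan))" for i :: bool
      by (cases i) auto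
  qed simp_all
qed

text \<open>With \<open>X = min I J\<close> and \<open>D = I - J\<close> the corner flip is the exchange of \<open>X\<close> and \<open>w\<close>,
  which are independent of \<open>D\<close> and equidistributed.\<close>
lemma (in prob_space) indep_vars_corner_flip:
  fixes w :: "'i \<Rightarrow> 'a \<Rightarrow> real"
  assumes w: "indep_vars (\<lambda>_. borel) w UNIV" and abc: "a \<noteq> b" "a \<noteq> c" "b \<noteq> c"
    and l: "0 < l" "0 < u"
    and a: "distributed M lborel (w a) (exponential_density l)"
    and b: "distributed M lborel (w b) (exponential_density u)"
    and c: "distributed M lborel (w c) (exponential_density (l + u))"
  defines "w' \<equiv> w(a := (\<lambda>x. w c x + max 0 (w a x - w b x)),
                   b := (\<lambda>x. w c x + max 0 (w b x - w a x)), c := (\<lambda>x. min (w a x) (w b x)))"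
  shows "indep_vars (\<lambda>_. borel) w' UNIV"
    and "distributed M lborel (w' a) (exponential_density l)"
    and "distributed M lborel (w' b) (exponential_density u)"
    and "distributed M lborel (w' c) (exponential_density (l + u))"
proof -
  let ?D = "\<lambda>x. w a x - w b x" and ?m = "\<lambda>x. min (w a x) (w b x)"
  have ind: "indep_var borel (w a) borel (w b)" by (rule indep_vars_pair[OF w abc(1)])
  have rv[measurable]: "w i \<in> borel_measurable M" for i using w by (auto simp: indep_vars_def2)
  have Dm: "indep_var borel ?D borel ?m" by (rule exponential_min_indep_diff[OF l a b ind])
  have m: "distributed M lborel ?m (exponential_density (l + u))"
    by (rule exponential_distributed_min[OF l a b ind])
  have w1: "indep_vars (\<lambda>_. borel) (w(a := ?D, b := ?m)) UNIV" (is "indep_vars _ ?w1 _")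
    by (rule indep_vars_update_pair[OF w abc(1) _ _ Dm]) simp_all
  \<comment> \<open>The transposition places the difference, \<open>w c\<close> and the minimum in
    slots \<open>a\<close>, \<open>b\<close>, \<open>c\<close>, still jointly independent with the
    remaining weights.\<close>
  define w2 where "w2 = (\<lambda>i. ?w1 (Transposition.transpose b c i))"
  have w2: "indep_vars (\<lambda>_. borel) w2 UNIV"
    unfolding w2_def by (rule indep_vars_inj_reindex[OF w1]) (metis injI transpose_involutory)
  have w2_eq: "w2 a = ?D" "w2 b = w c" "w2 c = ?m" "i \<noteq> a \<Longrightarrow> i \<noteq> b \<Longrightarrow> i \<noteq> c \<Longrightarrow> w2 i = w i" for i
    using abc by (auto simp: w2_def Transposition.transpose_def)
  have Dc: "indep_var borel ?D borel (w c)"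
    using indep_vars_pair[OF w2 abc(1)] by (simp add: w2_eq)
  have cm: "distr M borel (w c) = distr M borel ?m"
    using distributed_distr_eq_density[OF c] distributed_distr_eq_density[OF m]
    by (simp cong: distr_cong add: distr_def)
  have joint: "distr M (borel \<Otimes>\<^sub>M borel) (\<lambda>x. (?D x, w c x)) = distr M (borel \<Otimes>\<^sub>M borel) (\<lambda>x. (?D x, ?m x))"
    using Dm Dc cm by (simp add: indep_var_distribution_eq)
  \<comment> \<open>\<open>T\<close> recovers two numbers from their minimum and difference. Applied
    to the difference and \<open>w c\<close> it gives the flipped pair; since \<open>w c\<close> has
    the law of the minimum, the flipped pair has the law of the original one.\<close>
  define T where "T = (\<lambda>(d :: real, y). (y + max 0 d, y + max 0 (- d)))"
  have [measurable]: "T \<in> borel \<Otimes>\<^sub>M borel \<rightarrow>\<^sub>M borel \<Otimes>\<^sub>M borel"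
    unfolding T_def by measurable
  have T: "T (?D x, ?m x) = (w a x, w b x)" "T (?D x, w c x) = (w c x + max 0 (w a x - w b x), w c x + max 0 (w b x - w a x))" for x
    by (auto simp: T_def max_def min_def)
  have joint': "distr M (borel \<Otimes>\<^sub>M borel) (\<lambda>x. (w c x + max 0 (w a x - w b x), w c x + max 0 (w b x - w a x)))
       = distr M (borel \<Otimes>\<^sub>M borel) (\<lambda>x. (w a x, w b x))"
    using arg_cong[where f = "\<lambda>N. distr N (borel \<Otimes>\<^sub>M borel) T", OF joint]
    by (subst (asm) (1 2) distr_distr) (simp_all add: comp_def T)
  let ?a' = "\<lambda>x. w c x + max 0 (w a x - w b x)" and ?b' = "\<lambda>x. w c x + max 0 (w b x - w a x)"
  have a': "distr M borel ?a' = distr M borel (w a)"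
    using arg_cong[where f = "\<lambda>N. distr N borel fst", OF joint']
    by (subst (asm) (1 2) distr_distr) (simp_all add: comp_def)
  have b': "distr M borel ?b' = distr M borel (w b)"
    using arg_cong[where f = "\<lambda>N. distr N borel snd", OF joint']
    by (subst (asm) (1 2) distr_distr) (simp_all add: comp_def)
  have ind': "indep_var borel ?a' borel ?b'"
    unfolding indep_var_distribution_eq a' b' joint'
    using ind[unfolded indep_var_distribution_eq] by simp
  have "indep_vars (\<lambda>_. borel) (w2(a := (\<lambda>x. w2 b x + max 0 (w2 a x)), b := (\<lambda>x. w2 b x + max 0 (- w2 a x)))) UNIV"
    by (rule indep_vars_update_pair[OF w2 abc(1), where f = "\<lambda>d y. y + max 0 d" and g = "\<lambda>d y. y + max 0 (- d)"])
      (use ind' in \<open>simp_all add: w2_eq\<close>)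
  moreover have "w2(a := (\<lambda>x. w2 b x + max 0 (w2 a x)), b := (\<lambda>x. w2 b x + max 0 (- w2 a x))) = w'"
    using abc by (auto simp: fun_eq_iff w'_def w2_eq)
  ultimately show "indep_vars (\<lambda>_. borel) w' UNIV" by simp
  have ex: "distributed M lborel Z (exponential_density r)"
    if "distr M borel Z = distr M borel W" "distributed M lborel W (exponential_density r)" "Z \<in> borel_measurable M" for Z W r
    using that by (auto simp: distributed_def cong: distr_cong)
  show "distributed M lborel (w' a) (exponential_density l)"
    using ex[OF a' a] abc by (simp add: w'_def)
  show "distributed M lborel (w' b) (exponential_density u)"
    using ex[OF b' b] abc by (simp add: w'_def)
  show "distributed M lborel (w' c) (exponential_density (l + u))"
    using m abc by (simp add: w'_def)
qed

section \<open>Shifting the field by one row\<close>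

text \<open>During the sweep over a row, \<open>(0, 1)\<close> carries the current vertical increment of the passage
  time and \<open>(i, 0)\<close> is overwritten by the horizontal increment one row up.\<close>
definition corner_flip :: "nat \<Rightarrow> (nat \<times> nat \<Rightarrow> real) \<Rightarrow> nat \<times> nat \<Rightarrow> real" where
  "corner_flip i w = w((i, 0) := w (i, 1) + max 0 (w (i, 0) - w (0, 1)),
     (0, 1) := w (i, 1) + max 0 (w (0, 1) - w (i, 0)), (i, 1) := min (w (i, 0)) (w (0, 1)))"

primrec row_flip :: "nat \<Rightarrow> (nat \<times> nat \<Rightarrow> real) \<Rightarrow> nat \<times> nat \<Rightarrow> real" where
  "row_flip 0 w = w"
| "row_flip (Suc m) w = corner_flip (Suc m) (row_flip m w)"

text \<open>The rows above row 1 move down by one. Row 1 is dropped: after a sweep it holds the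
  minima and, at \<open>(0, 1)\<close>, the vertical increment at the right end.\<close>

definition skip_row :: "nat \<times> nat \<Rightarrow> nat \<times> nat" where
  "skip_row z = (if snd z = 0 then z else (fst z, Suc (snd z)))"

definition row_shift :: "nat \<Rightarrow> (nat \<times> nat \<Rightarrow> real) \<Rightarrow> nat \<times> nat \<Rightarrow> real" where
  "row_shift m w = row_flip m w \<circ> skip_row"

text \<open>In terms of increments the passage time recursion is the corner flip: incoming
  increments \<open>I\<close>, \<open>J\<close> and a weight \<open>w\<close> produce
  \<open>w + max 0 (I - J)\<close> above and \<open>w + max 0 (J - I)\<close> on the right. The four
  clauses together form the invariant of the sweep.\<close>

lemma row_flip_facts:
  "(\<forall>i<m. row_flip m w (Suc i, 0) = lpt w (Suc i) 1 - lpt w i 1) \<and>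
   row_flip m w (0, 1) = lpt w m 1 - lpt w m 0 \<and>
   (\<forall>i>m. row_flip m w (i, 0) = w (i, 0) \<and> row_flip m w (i, 1) = w (i, 1)) \<and>
   (\<forall>i j. 2 \<le> j \<longrightarrow> row_flip m w (i, j) = w (i, j))"
proof (induction m)
  case (Suc m)
  then show ?case
    by (auto simp: corner_flip_def less_Suc_eq max_def)
qed simp

text \<open>The new horizontal axis carries the increments along row 1, so the new field sees the
  old passage times from \<open>(0, 1)\<close>. Only columns up to \<open>m\<close> have been swept,
  whence \<open>i \<le> m\<close>.\<close>

lemma lpt_row_shift:
  "i \<le> m \<Longrightarrow> lpt (row_shift m w) i j = lpt w i (Suc j) - w (0, 1)"
proof (induction j arbitrary: i)
  case 0
  then show ?case
  proof (induction i)
    case (Suc i)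
    then show ?case using row_flip_facts[of m w] by (simp add: row_shift_def skip_row_def)
  qed simp
next
  case (Suc j)
  note IHj = this
  have bulk: "row_shift m w (i, Suc j) = w (i, Suc (Suc j))" for i
    using row_flip_facts[of m w] by (simp add: row_shift_def skip_row_def)
  from Suc.prems show ?case
  proof (induction i)
    case 0
    then show ?case using IHj(1)[of 0] by (simp add: bulk)
  next
    case (Suc i)
    then show ?case using IHj(1)[of "Suc i"] by (simp add: bulk)
  qed
qed

lemma lpt_row_shift_pow:
  assumes "i \<le> m"
  shows "lpt ((row_shift m ^^ k) w) i j = lpt w i (k + j) - lpt w 0 k"
proof (induction k arbitrary: w j)
  case (Suc k)
  show ?case
    unfolding funpow_Suc_right comp_def Suc using assms by (simp add: lpt_row_shift)
qed simp

lemma lpt_measurable[measurable (raw)]: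
  assumes [measurable]: "\<And>z. X z \<in> borel_measurable N"
  shows "(\<lambda>x. lpt (\<lambda>z. X z x) i j) \<in> borel_measurable N"
proof (induction i arbitrary: j)
  case 0
  show ?case by (induction j) simp_all
next
  case (Suc i)
  show ?case
  proof (induction j)
    case (Suc j)
    then show ?case using \<open>\<And>j. (\<lambda>x. lpt (\<lambda>z. X z x) i j) \<in> borel_measurable N\<close> by simp
  qed (use Suc in simp)
qed

section \<open>Covariances\<close>

context prob_space
begin

definition cov :: "('a \<Rightarrow> real) \<Rightarrow> ('a \<Rightarrow> real) \<Rightarrow> real" where
  "cov X Y = expectation (\<lambda>x. X x * Y x) - expectation X * expectation Y"

definition sq_int :: "('a \<Rightarrow> real) \<Rightarrow> bool" where
  "sq_int X \<longleftrightarrow> X \<in> borel_measurable M \<and> integrable M (\<lambda>x. (X x)\<^sup>2)"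

lemma sq_int_measurable: "sq_int X \<Longrightarrow> X \<in> borel_measurable M"
  by (simp add: sq_int_def)

lemma sq_int_integrable: "sq_int X \<Longrightarrow> integrable M X"
  by (auto simp: sq_int_def intro: square_integrable_imp_integrable)

lemma sq_int_mult_integrable:
  assumes "sq_int X" "sq_int Y"
  shows "integrable M (\<lambda>x. X x * Y x)"
proof (rule Bochner_Integration.integrable_bound)
  show "integrable M (\<lambda>x. (X x)\<^sup>2 + (Y x)\<^sup>2)" using assms by (simp add: sq_int_def)
  show "(\<lambda>x. X x * Y x) \<in> borel_measurable M" using assms by (auto simp: sq_int_def)
  have "\<bar>a * b\<bar> \<le> a\<^sup>2 + b\<^sup>2" for a b :: real
  proof -
    have "0 \<le> (\<bar>a\<bar> - \<bar>b\<bar>)\<^sup>2" "0 \<le> \<bar>a\<bar> * \<bar>b\<bar>" by simp_all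
    then have "2 * (\<bar>a\<bar> * \<bar>b\<bar>) \<le> a\<^sup>2 + b\<^sup>2" by (simp add: power2_diff)
    with \<open>0 \<le> \<bar>a\<bar> * \<bar>b\<bar>\<close> show ?thesis unfolding abs_mult by linarith
  qed
  then show "AE x in M. norm (X x * Y x) \<le> norm ((X x)\<^sup>2 + (Y x)\<^sup>2)" by simp
qed

lemma sq_int_add:
  assumes "sq_int X" "sq_int Y"
  shows "sq_int (\<lambda>x. X x + Y x)"
  using assms sq_int_mult_integrable[OF assms] by (auto simp: sq_int_def power2_sum mult.assoc)

lemma sq_int_cmult: "sq_int X \<Longrightarrow> sq_int (\<lambda>x. c * X x)"
  by (auto simp: sq_int_def power_mult_distrib)

lemma sq_int_diff:
  assumes "sq_int X" "sq_int Y"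
  shows "sq_int (\<lambda>x. X x - Y x)"
  using sq_int_add[OF assms(1) sq_int_cmult[OF assms(2), of "-1"]] by simp

lemma sq_int_const: "sq_int (\<lambda>_. c)"
  by (simp add: sq_int_def)

lemma sq_int_max:
  assumes "sq_int X" "sq_int Y"
  shows "sq_int (\<lambda>x. max (X x) (Y x))"
  unfolding sq_int_def
proof
  have [measurable]: "X \<in> borel_measurable M" "Y \<in> borel_measurable M"
    using assms by (simp_all add: sq_int_def)
  show "(\<lambda>x. max (X x) (Y x)) \<in> borel_measurable M" by simp
  show "integrable M (\<lambda>x. (max (X x) (Y x))\<^sup>2)"
  proof (rule Bochner_Integration.integrable_bound)
    show "integrable M (\<lambda>x. (X x)\<^sup>2 + (Y x)\<^sup>2)" using assms by (simp add: sq_int_def)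
  qed (auto simp: max_def)
qed

lemma sq_int_sum: "(\<And>i. i \<in> A \<Longrightarrow> sq_int (X i)) \<Longrightarrow> sq_int (\<lambda>x. \<Sum>i\<in>A. X i x)"
  by (induction A rule: infinite_finite_induct) (auto intro: sq_int_add sq_int_const)

lemma sq_int_lpt:
  assumes "\<And>z. z \<noteq> (0, 0) \<Longrightarrow> sq_int (X z)"
  shows "sq_int (\<lambda>x. lpt (\<lambda>z. X z x) i j)"
proof (induction i arbitrary: j)
  case 0
  show ?case by (induction j) (auto intro!: sq_int_const sq_int_add assms)
next
  case (Suc i)
  note IH = this
  show ?case
    by (induction j) (auto intro!: sq_int_add sq_int_max assms IH)
qed

lemma cov_commute: "cov X Y = cov Y X"
  by (simp add: cov_def mult.commute)

lemma cov_add_left: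
  assumes "sq_int X" "sq_int Y" "sq_int Z"
  shows "cov (\<lambda>x. X x + Y x) Z = cov X Z + cov Y Z"
  using assms by (simp add: cov_def distrib_right sq_int_mult_integrable sq_int_integrable)

lemma cov_diff_left:
  assumes "sq_int X" "sq_int Y" "sq_int Z"
  shows "cov (\<lambda>x. X x - Y x) Z = cov X Z - cov Y Z"
  using assms by (simp add: cov_def left_diff_distrib sq_int_mult_integrable sq_int_integrable)

lemma cov_add_right:
  assumes "sq_int X" "sq_int Y" "sq_int Z"
  shows "cov Z (\<lambda>x. X x + Y x) = cov Z X + cov Z Y"
  using cov_add_left[OF assms] by (simp add: cov_commute[of Z])

lemma cov_diff_right:
  assumes "sq_int X" "sq_int Y" "sq_int Z"
  shows "cov Z (\<lambda>x. X x - Y x) = cov Z X - cov Z Y"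
  using cov_diff_left[OF assms] by (simp add: cov_commute[of Z])

lemma cov_self_cmult: "cov (\<lambda>x. c * X x) (\<lambda>x. c * X x) = c\<^sup>2 * cov X X"
proof -
  have "(\<lambda>x. c * X x * (c * X x)) = (\<lambda>x. c\<^sup>2 * (X x * X x))"
    by (simp add: fun_eq_iff power2_eq_square ac_simps)
  then show ?thesis by (simp add: cov_def power2_eq_square algebra_simps)
qed

lemma cov_const: "cov (\<lambda>_. c) Z = 0"
  by (simp add: cov_def prob_space)

lemma cov_sum_left:
  assumes "\<And>i. i \<in> A \<Longrightarrow> sq_int (X i)" "sq_int Z"
  shows "cov (\<lambda>x. \<Sum>i\<in>A. X i x) Z = (\<Sum>i\<in>A. cov (X i) Z)"
  using assms(1)
  by (induction A rule: infinite_finite_induct)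
    (simp_all add: cov_const cov_add_left sq_int_sum assms(2))

lemma cov_self: "sq_int X \<Longrightarrow> cov X X = variance X"
  by (subst variance_eq) (auto simp: cov_def power2_eq_square sq_int_def intro: sq_int_integrable)

lemma cov_self_nonneg: "sq_int X \<Longrightarrow> 0 \<le> cov X X"
  by (simp add: cov_self)

text \<open>The variance of \<open>X - Y\<close> is nonnegative, which absorbs the mixed term. This
  bounds variances of sums whose dependence is unknown.\<close>

lemma cov_self_add_le:
  assumes "sq_int X" "sq_int Y"
  shows "cov (\<lambda>x. X x + Y x) (\<lambda>x. X x + Y x) \<le> 2 * (cov X X + cov Y Y)"
proof -
  have "0 \<le> cov (\<lambda>x. X x - Y x) (\<lambda>x. X x - Y x)"
    by (intro cov_self_nonneg sq_int_diff assms)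
  then have "0 \<le> cov X X - cov Y X - (cov X Y - cov Y Y)"
    using assms by (simp add: cov_diff_left cov_diff_right sq_int_diff)
  moreover have "cov (\<lambda>x. X x + Y x) (\<lambda>x. X x + Y x) = cov X X + cov Y X + (cov X Y + cov Y Y)"
    using assms by (simp add: cov_add_left cov_add_right sq_int_add)
  ultimately show ?thesis by simp
qed

lemma cov_indep:
  assumes "indep_var borel X borel Y" "sq_int X" "sq_int Y"
  shows "cov X Y = 0"
  using indep_var_lebesgue_integral[OF assms(1)] assms by (simp add: cov_def sq_int_integrable)

lemma cov_self_indep_sum:
  assumes "indep_vars (\<lambda>_. borel) X UNIV" "\<And>i. i \<in> A \<Longrightarrow> sq_int (X i)" "finite A"
  shows "cov (\<lambda>x. \<Sum>i\<in>A. X i x) (\<lambda>x. \<Sum>i\<in>A. X i x) = (\<Sum>i\<in>A. cov (X i) (X i))"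
  using assms(3,2)
proof (induction A)
  case (insert a A)
  have "cov (\<lambda>x. \<Sum>i\<in>A. X i x) (X a) = (\<Sum>i\<in>A. cov (X i) (X a))"
    using insert by (intro cov_sum_left) auto
  also have "\<dots> = 0"
    using insert by (intro sum.neutral ballI cov_indep indep_vars_pair[OF assms(1)]) auto
  finally have 0: "cov (\<lambda>x. \<Sum>i\<in>A. X i x) (X a) = 0" "cov (X a) (\<lambda>x. \<Sum>i\<in>A. X i x) = 0"
    by (simp_all add: cov_commute[of "X a" "\<lambda>x. \<Sum>i\<in>A. X i x"])
  show ?case
    using insert by (simp add: cov_add_left cov_add_right sq_int_sum sq_int_add 0)
qed (simp add: cov_const)

text \<open>The fourth moment serves twice: for the influence of axis weights on rare events, and
  for the third-order error in the central limit theorem.\<close>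

lemma exponential_moments:
  assumes D: "distributed M lborel X (exponential_density l)" and l: "0 < l"
  shows "sq_int X" "expectation X = 1 / l" "cov X X = 1 / l\<^sup>2" "expectation (\<lambda>x. X x ^ 2) = 2 / l ^ 2"
    "integrable M (\<lambda>x. X x ^ 4)" "expectation (\<lambda>x. X x ^ 4) = 24 / l ^ 4" "AE x in M. 0 \<le> X x"
proof -
  have [measurable]: "X \<in> borel_measurable M" using distributed_measurable[OF D] by simp
  show sq: "sq_int X"
    using erlang_ith_moment_integrable[OF l D, of 2] by (simp add: sq_int_def)
  show "expectation X = 1 / l" by (rule exponential_distributed_expectation[OF l D])
  show "cov X X = 1 / l\<^sup>2"
    using exponential_distributed_variance[OF l D] by (simp add: cov_self[OF sq])
  show "expectation (\<lambda>x. X x ^ 2) = 2 / l ^ 2"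
    using erlang_ith_moment[OF l D, of 2] by (simp add: fact_numeral)
  show "integrable M (\<lambda>x. X x ^ 4)" by (rule erlang_ith_moment_integrable[OF l D])
  show "expectation (\<lambda>x. X x ^ 4) = 24 / l ^ 4"
    using erlang_ith_moment[OF l D, of 4] by (simp add: fact_numeral)
  have "prob {x \<in> space M. 0 < X x} = 1"
    using exponential_distributedD_gt[OF D, of 0] l by simp
  then have "AE x in M. 0 < X x" by (subst (asm) prob_Collect_eq_1) auto
  then show "AE x in M. 0 \<le> X x" by eventually_elim simp
qed

end

section \<open>Stationary last passage percolation\<close>

context prob_space
begin

text \<open>The two axis rates are free, so that the given model, its reflection and all rescaled
  stationary models are instances. The law at the origin is left open because passage times do not
  see it.\<close>

definition boundary_field :: "real \<Rightarrow> real \<Rightarrow> (nat \<times> nat \<Rightarrow> 'a \<Rightarrow> real) \<Rightarrow> bool" where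
  "boundary_field \<alpha> \<beta> w \<longleftrightarrow> indep_vars (\<lambda>_. borel) w UNIV \<and>
     (\<forall>i\<ge>1. distributed M lborel (w (i, 0)) (exponential_density \<alpha>)) \<and>
     (\<forall>j\<ge>1. distributed M lborel (w (0, j)) (exponential_density \<beta>)) \<and>
     (\<forall>i\<ge>1. \<forall>j\<ge>1. distributed M lborel (w (i, j)) (exponential_density 1))"

text \<open>The boundary rates for which the last passage increments are stationary.\<close>
abbreviation stationary_field :: "real \<Rightarrow> (nat \<times> nat \<Rightarrow> 'a \<Rightarrow> real) \<Rightarrow> bool" where
  "stationary_field \<rho> \<equiv> boundary_field (1 - \<rho>) \<rho>"

text \<open>The axis rates add up to the bulk rate 1, which is exactly the condition under which the
  corner flip preserves the law.\<close>

lemma stationary_field_corner_flip: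
  assumes w: "stationary_field \<rho> w" and \<rho>: "0 < \<rho>" "\<rho> < 1" and i: "i \<ge> 1"
  shows "stationary_field \<rho> (\<lambda>z x. corner_flip i (\<lambda>z. w z x) z)"
proof -
  have ne: "(i, 0) \<noteq> (0, 1 :: nat)" "(i, 0) \<noteq> (i, 1 :: nat)" "(0, 1) \<noteq> (i, 1 :: nat)" using i by auto
  have eq: "(\<lambda>z x. corner_flip i (\<lambda>z. w z x) z) = w((i, 0) := (\<lambda>x. w (i, 1) x + max 0 (w (i, 0) x - w (0, 1) x)),
       (0, 1) := (\<lambda>x. w (i, 1) x + max 0 (w (0, 1) x - w (i, 0) x)), (i, 1) := (\<lambda>x. min (w (i, 0) x) (w (0, 1) x)))"
    (is "?w' = ?w''")
    by (auto simp: corner_flip_def fun_eq_iff)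
  have d: "distributed M lborel (w (i, 0)) (exponential_density (1 - \<rho>))"
    "distributed M lborel (w (0, 1)) (exponential_density \<rho>)"
    "distributed M lborel (w (i, 1)) (exponential_density (1 - \<rho> + \<rho>))"
    using w i by (auto simp: boundary_field_def)
  have ind: "indep_vars (\<lambda>_. borel) w UNIV" using w by (simp add: boundary_field_def)
  note flip = indep_vars_corner_flip[OF ind ne _ \<rho>(1) d, folded eq]
  have other: "?w' z = w z" if "z \<noteq> (i, 0)" "z \<noteq> (0, 1)" "z \<noteq> (i, 1)" for z
    using that by (auto simp: corner_flip_def fun_eq_iff)
  show ?thesis
    unfolding boundary_field_def
  proof (intro conjI allI impI)
    show "indep_vars (\<lambda>_. borel) ?w' UNIV" using flip(1) \<rho> by simp
    fix a assume a: "a \<ge> (1 :: nat)"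
    show "distributed M lborel (?w' (a, 0)) (exponential_density (1 - \<rho>))"
      using flip(2) \<rho> w other[of "(a, 0)"] a by (cases "a = i") (auto simp: boundary_field_def)
    show "distributed M lborel (?w' (0, a)) (exponential_density \<rho>)"
      using flip(3) \<rho> w other[of "(0, a)"] a i by (cases "a = 1") (auto simp: boundary_field_def)
    fix b assume b: "b \<ge> (1 :: nat)"
    show "distributed M lborel (?w' (a, b)) (exponential_density 1)"
      using flip(4) \<rho> w other[of "(a, b)"] a b by (cases "a = i \<and> b = 1") (auto simp: boundary_field_def)
  qed
qed

lemma stationary_field_row_flip:
  assumes "stationary_field \<rho> w" "0 < \<rho>" "\<rho> < 1"
  shows "stationary_field \<rho> (\<lambda>z x. row_flip m (\<lambda>z. w z x) z)"
proof (induction m)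
  case (Suc m)
  show ?case using stationary_field_corner_flip[OF Suc assms(2,3), of "Suc m"] by simp
qed (use assms in simp)

lemma inj_skip_row: "inj skip_row"
  by (auto simp: inj_def skip_row_def prod_eq_iff split: if_splits)

lemma stationary_field_row_shift:
  assumes "stationary_field \<rho> w" "0 < \<rho>" "\<rho> < 1"
  shows "stationary_field \<rho> (\<lambda>z x. row_shift m (\<lambda>z. w z x) z)"
  using stationary_field_row_flip[OF assms, of m] indep_vars_inj_reindex[OF _ inj_skip_row]
  by (auto simp: boundary_field_def row_shift_def skip_row_def)

lemma stationary_field_row_shift_pow:
  assumes "stationary_field \<rho> w" "0 < \<rho>" "\<rho> < 1"
  shows "stationary_field \<rho> (\<lambda>z x. (row_shift m ^^ k) (\<lambda>z. w z x) z)"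
proof (induction k)
  case (Suc k)
  show ?case using stationary_field_row_shift[OF Suc assms(2,3)] by simp
qed (use assms in simp)

end

section \<open>Comparison of densities on common weights\<close>

text \<open>The environment for a path that leaves \<open>(k, 0)\<close> to the right. It never
  meets column \<open>k\<close> again, so that column can be replaced by a rescaled copy of the
  original vertical axis. With \<open>c = (1 - \<rho>) / (1 - \<rho>')\<close> and
  \<open>d = \<rho> / \<rho>'\<close> the axis rates become those of density \<rho>'.\<close>

definition right_field :: "nat \<Rightarrow> real \<Rightarrow> real \<Rightarrow> (nat \<times> nat \<Rightarrow> real) \<Rightarrow> nat \<times> nat \<Rightarrow> real" where
  "right_field k c d w = (\<lambda>(i, j). if j = 0 then c * w (k + i, 0) else if i = 0 then d * w (0, j) else w (k + i, j))"

text \<open>If zeroing one axis weight beyond \<open>k\<close> lowers the passage time, so does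
  zeroing all of them. This excludes the first entry of the maximum in
  \<open>lpt_exit_right_bound\<close>.\<close>

lemma exit_right_cases:
  assumes w: "\<And>z. z \<noteq> (0, 0) \<Longrightarrow> 0 \<le> w z" and cd: "1 \<le> c" "0 \<le> d" and k: "k < i" "k \<le> m"
    and less: "lpt (w((i, 0) := 0)) m n < lpt w m n"
  shows "lpt w m n \<le> lpt w k 0 + lpt (right_field k c d w) (m - k) n"
proof -
  let ?v = "\<lambda>(a, b). if b = 0 \<and> a > k then 0 else w (a, b)"
  have "lpt w (k + (m - k)) n \<le> max (lpt ?v (k + (m - k)) n) (lpt w k 0 + lpt (right_field k c d w) (m - k) n)"
  proof (rule lpt_exit_right_bound)
    fix i j :: nat assume "i \<ge> 1"
    then have "0 \<le> w (k + i, 0)" by (intro w) auto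
    then show "w (k + i, 0) \<le> right_field k c d w (i, 0)"
      using cd mult_right_mono[of 1 c "w (k + i, 0)"] by (simp add: right_field_def)
  next
    fix j :: nat assume "j \<ge> 1"
    then have "0 \<le> w (0, j)" by (intro w) auto
    then show "0 \<le> right_field k c d w (0, j)"
      using cd \<open>j \<ge> 1\<close> by (simp add: right_field_def)
  qed (simp add: right_field_def)
  moreover have "lpt ?v m n \<le> lpt (w((i, 0) := 0)) m n"
  proof (rule lpt_mono)
    show "?v z \<le> (w((i, 0) := 0)) z" for z
      using k w[of z] by (cases z) auto
  qed
  ultimately show ?thesis using k less by auto
qed

context prob_space
begin

lemma boundary_field_measurable: "boundary_field \<alpha> \<beta> w \<Longrightarrow> w z \<in> borel_measurable M"
  by (cases z) (auto simp: boundary_field_def indep_vars_def2)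

text \<open>The new field is an injective reindexing of the old one with deterministic factors, and
  a factor \<open>c\<close> divides an exponential rate by \<open>c\<close>.\<close>

lemma boundary_field_right_field:
  assumes w: "boundary_field \<alpha> \<beta> w" and p: "0 < \<alpha>" "0 < \<beta>" "0 < c" "0 < d"
  shows "boundary_field (\<alpha> / c) (\<beta> / d) (\<lambda>z x. right_field k c d (\<lambda>z. w z x) z)"
proof -
  define h where "h = (\<lambda>(i, j). if i = 0 \<and> j \<noteq> 0 then (0, j) else (k + i, j :: nat))"
  define r where "r = (\<lambda>(i, j). if j = (0 :: nat) then c else if i = (0 :: nat) then d else 1 :: real)"
  have ind: "indep_vars (\<lambda>_. borel) w UNIV" using w by (simp add: boundary_field_def)
  have eq: "(\<lambda>z x. right_field k c d (\<lambda>z. w z x) z) = (\<lambda>z x. r z * w (h z) x)"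
    by (auto simp: right_field_def h_def r_def fun_eq_iff)
  have "inj h" by (auto simp: inj_def h_def split: if_splits)
  then have "indep_vars (\<lambda>_. borel) (\<lambda>z x. r z * w (h z) x) UNIV"
    by (intro indep_vars_scale indep_vars_inj_reindex[OF ind])
  moreover have "distributed M lborel (\<lambda>x. c * w (k + i, 0) x) (exponential_density (\<alpha> / c))" if "i \<ge> 1" for i
    using w p that by (intro exponential_distributed_scale) (auto simp: boundary_field_def)
  moreover have "distributed M lborel (\<lambda>x. d * w (0, j) x) (exponential_density (\<beta> / d))" if "j \<ge> 1" for j
    using w p that by (intro exponential_distributed_scale) (auto simp: boundary_field_def)
  moreover have "distributed M lborel (\<lambda>x. w (k + i, j) x) (exponential_density 1)" if "i \<ge> 1" "j \<ge> 1" for i j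
    using w that by (simp add: boundary_field_def)
  ultimately show ?thesis
    unfolding eq boundary_field_def by (auto simp: h_def r_def)
qed

context
  fixes w \<alpha> \<beta>
  assumes w: "boundary_field \<alpha> \<beta> w" and pos: "0 < \<alpha>" "0 < \<beta>"
begin

lemma boundary_field_exponential:
  assumes "z \<noteq> (0, 0)"
  shows "\<exists>r>0. distributed M lborel (w z) (exponential_density r)"
proof -
  obtain i j where z: "z = (i, j)" by fastforce
  consider "j = 0" "i \<ge> 1" | "i = 0" "j \<ge> 1" | "i \<ge> 1" "j \<ge> 1"
    using assms z by (cases "i = 0"; cases "j = 0") auto
  then show ?thesis
    using w pos unfolding z by cases (auto simp: boundary_field_def intro: exI[of _ "1 :: real"])
qed

lemma boundary_field_sq_int: "z \<noteq> (0, 0) \<Longrightarrow> sq_int (w z)"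
  using boundary_field_exponential exponential_moments(1) by blast

lemma boundary_field_AE_nonneg: "AE x in M. \<forall>z. z \<noteq> (0, 0) \<longrightarrow> 0 \<le> w z x"
  unfolding AE_all_countable
proof
  fix z :: "nat \<times> nat"
  show "AE x in M. z \<noteq> (0, 0) \<longrightarrow> 0 \<le> w z x"
    using boundary_field_exponential[of z] exponential_moments(7)[of "w z"] by (cases "z = (0, 0)") auto
qed

lemma boundary_field_sq_int_lpt: "sq_int (\<lambda>x. lpt (\<lambda>z. w z x) i j)"
  by (rule sq_int_lpt) (rule boundary_field_sq_int)

lemma boundary_field_row0:
  "expectation (\<lambda>x. lpt (\<lambda>z. w z x) m 0) = m / \<alpha>"
  "cov (\<lambda>x. lpt (\<lambda>z. w z x) m 0) (\<lambda>x. lpt (\<lambda>z. w z x) m 0) = m / \<alpha>\<^sup>2"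
proof -
  have d: "distributed M lborel (w (i, 0)) (exponential_density \<alpha>)" if "i \<ge> 1" for i
    using w that by (simp add: boundary_field_def)
  note mom = exponential_moments[OF d pos(1)]
  show "expectation (\<lambda>x. lpt (\<lambda>z. w z x) m 0) = m / \<alpha>"
    unfolding lpt_row0 by (subst Bochner_Integration.integral_sum) (simp_all add: mom sq_int_integrable)
  have "indep_vars (\<lambda>_. borel) (\<lambda>i. w (i, 0)) UNIV"
    using w by (intro indep_vars_inj_reindex[where h = "\<lambda>i. (i, 0)"]) (auto simp: boundary_field_def inj_def)
  from cov_self_indep_sum[OF this, of "{1..m}"]
  show "cov (\<lambda>x. lpt (\<lambda>z. w z x) m 0) (\<lambda>x. lpt (\<lambda>z. w z x) m 0) = m / \<alpha>\<^sup>2"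
    unfolding lpt_row0 by (simp add: mom)
qed

lemma boundary_field_col0:
  "expectation (\<lambda>x. lpt (\<lambda>z. w z x) 0 n) = n / \<beta>"
  "cov (\<lambda>x. lpt (\<lambda>z. w z x) 0 n) (\<lambda>x. lpt (\<lambda>z. w z x) 0 n) = n / \<beta>\<^sup>2"
proof -
  have d: "distributed M lborel (w (0, i)) (exponential_density \<beta>)" if "i \<ge> 1" for i
    using w that by (simp add: boundary_field_def)
  note mom = exponential_moments[OF d pos(2)]
  show "expectation (\<lambda>x. lpt (\<lambda>z. w z x) 0 n) = n / \<beta>"
    unfolding lpt_col0 by (subst Bochner_Integration.integral_sum) (simp_all add: mom sq_int_integrable)
  have "indep_vars (\<lambda>_. borel) (\<lambda>i. w (0, i)) UNIV"
    using w by (intro indep_vars_inj_reindex[where h = "\<lambda>i. (0, i)"]) (auto simp: boundary_field_def inj_def)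
  from cov_self_indep_sum[OF this, of "{1..n}"]
  show "cov (\<lambda>x. lpt (\<lambda>z. w z x) 0 n) (\<lambda>x. lpt (\<lambda>z. w z x) 0 n) = n / \<beta>\<^sup>2"
    unfolding lpt_col0 by (simp add: mom)
qed

lemma boundary_field_cov_row0_col0:
  "cov (\<lambda>x. lpt (\<lambda>z. w z x) m 0) (\<lambda>x. lpt (\<lambda>z. w z x) 0 n) = 0"
proof -
  have ind: "indep_vars (\<lambda>_. borel) w UNIV" using w by (simp add: boundary_field_def)
  have "cov (w (i, 0)) (w (0, j)) = 0" if "i \<ge> 1" "j \<ge> 1" for i j
    using that by (intro cov_indep indep_vars_pair[OF ind] boundary_field_sq_int) auto
  moreover have "cov (w (i, 0)) (\<lambda>x. \<Sum>k = 1..n. w (0, k) x) = (\<Sum>j=1..n. cov (w (i, 0)) (w (0, j)))" if "i \<ge> 1" for i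
    using that unfolding cov_commute[of "w (i, 0)"]
    by (intro cov_sum_left boundary_field_sq_int) auto
  ultimately show ?thesis
    unfolding lpt_row0 lpt_col0
    by (subst cov_sum_left) (auto intro!: sq_int_sum boundary_field_sq_int sum.neutral)
qed

end

text \<open>Burke's theorem, reduced to the moments that enter the variance identity.\<close>
lemma stationary_north_east:
  assumes "stationary_field \<rho> w" "0 < \<rho>" "\<rho> < 1"
  shows "expectation (\<lambda>x. lpt (\<lambda>z. w z x) m n - lpt (\<lambda>z. w z x) 0 n) = m / (1 - \<rho>) \<and>
    cov (\<lambda>x. lpt (\<lambda>z. w z x) m n - lpt (\<lambda>z. w z x) 0 n)
      (\<lambda>x. lpt (\<lambda>z. w z x) m n - lpt (\<lambda>z. w z x) 0 n) = m / (1 - \<rho>)\<^sup>2 \<and>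
    cov (\<lambda>x. lpt (\<lambda>z. w z x) m n - lpt (\<lambda>z. w z x) m 0)
      (\<lambda>x. lpt (\<lambda>z. w z x) m n - lpt (\<lambda>z. w z x) 0 n) = 0"
  using assms(1)
proof (induction n arbitrary: w)
  case 0
  then show ?case
    using boundary_field_row0[OF 0, of m] assms(2,3) by (simp add: cov_const)
next
  case (Suc n)
  define f where "f = (\<lambda>z x. row_flip m (\<lambda>z. w z x) z)"
  define w' where "w' = (\<lambda>z x. row_shift m (\<lambda>z. w z x) z)"
  let ?N' = "\<lambda>x. lpt (\<lambda>z. w' z x) m n - lpt (\<lambda>z. w' z x) 0 n"
  let ?E' = "\<lambda>x. lpt (\<lambda>z. w' z x) m n - lpt (\<lambda>z. w' z x) m 0"
  have f: "stationary_field \<rho> f"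
    unfolding f_def by (rule stationary_field_row_flip[OF Suc.prems assms(2,3)])
  have w': "stationary_field \<rho> w'"
    unfolding w'_def by (rule stationary_field_row_shift[OF Suc.prems assms(2,3)])
  have w'_eq: "w' z x = f (skip_row z) x" for z x
    by (simp add: w'_def f_def row_shift_def)
  have sh: "lpt (\<lambda>z. w' z x) i j = lpt (\<lambda>z. w z x) i (Suc j) - w (0, 1) x" if "i \<le> m" for i j x
    using lpt_row_shift[OF that, of "\<lambda>z. w z x" j] by (simp add: w'_def)
  have J: "f (0, 1) x = lpt (\<lambda>z. w z x) m 1 - lpt (\<lambda>z. w z x) m 0" for x
    using row_flip_facts[of m "\<lambda>z. w z x"] by (simp add: f_def)
  have N: "lpt (\<lambda>z. w z x) m (Suc n) - lpt (\<lambda>z. w z x) 0 (Suc n) = ?N' x" for x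
    by (simp add: sh)
  have E: "lpt (\<lambda>z. w z x) m (Suc n) - lpt (\<lambda>z. w z x) m 0 = f (0, 1) x + ?E' x" for x
    by (simp add: sh J[unfolded One_nat_def])
  have sqw: "sq_int (\<lambda>x. lpt (\<lambda>z. w' z x) i j)" for i j
    using assms by (intro boundary_field_sq_int_lpt[OF w']) auto
  have sqf: "sq_int (f (0, 1))"
    using assms by (intro boundary_field_sq_int[OF f]) auto
  \<comment> \<open>Peeling off the lowest row adds \<open>f (0, 1)\<close> to the east side and
    leaves the north side unchanged. As \<open>skip_row\<close> never reaches \<open>(0, 1)\<close>,
    this added increment is independent of the shifted field, and north and east stay
    uncorrelated.\<close>
  have "cov (f (0, 1)) (\<lambda>x. lpt (\<lambda>z. f (skip_row z) x) m n - lpt (\<lambda>z. f (skip_row z) x) 0 n) = 0"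
  proof (intro cov_indep indep_var_rest[where F = "\<lambda>y. lpt (\<lambda>z. y (skip_row z)) m n - lpt (\<lambda>z. y (skip_row z)) 0 n"])
    show "indep_vars (\<lambda>_. borel) f UNIV" using f by (simp add: boundary_field_def)
    show "(\<lambda>y. lpt (\<lambda>z. y (skip_row z)) m n - lpt (\<lambda>z. y (skip_row z)) 0 n) \<in> borel_measurable (Pi\<^sub>M UNIV (\<lambda>_. borel))"
      by measurable
    show "sq_int (\<lambda>x. lpt (\<lambda>z. f (skip_row z) x) m n - lpt (\<lambda>z. f (skip_row z) x) 0 n)"
      using sq_int_diff[OF sqw[of m n] sqw[of 0 n]] by (simp add: w'_eq)
    show "sq_int (f (0, 1))" by (rule sqf)
    have "skip_row z \<noteq> (0, 1)" for z by (auto simp: skip_row_def prod_eq_iff)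
    then show "lpt (\<lambda>z. (y((0, 1) := c)) (skip_row z)) m n - lpt (\<lambda>z. (y((0, 1) := c)) (skip_row z)) 0 n
      = lpt (\<lambda>z. y (skip_row z)) m n - lpt (\<lambda>z. y (skip_row z)) 0 n" for y c
      by simp
  qed
  then have JN: "cov (f (0, 1)) ?N' = 0" by (simp add: w'_eq)
  have "cov (\<lambda>x. f (0, 1) x + ?E' x) ?N' = 0"
    using Suc.IH[OF w'] JN by (subst cov_add_left) (simp_all add: sq_int_diff sqw sqf[simplified])
  then show ?case
    unfolding N E using Suc.IH[OF w'] by simp
qed

context
  fixes w \<rho>
  assumes w: "stationary_field \<rho> w" and \<rho>: "0 < \<rho>" "\<rho> < 1"
begin

private lemma sq: "sq_int (\<lambda>x. lpt (\<lambda>z. w z x) i j)"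
  using \<rho> by (intro boundary_field_sq_int_lpt[OF w]) auto

lemma stationary_expectation:
  "expectation (\<lambda>x. lpt (\<lambda>z. w z x) m n) = m / (1 - \<rho>) + n / \<rho>"
  using stationary_north_east[OF w \<rho>, of m n] boundary_field_col0(1)[OF w, of n] \<rho>
  by (simp add: sq sq_int_integrable)

text \<open>Let \<open>W\<close>, \<open>S\<close>, \<open>N\<close>, \<open>E\<close> be the sums
  along the west, south, north and east sides, so \<open>T = W + N = S + E\<close>. Expanding the
  variance of \<open>N = T - W\<close> and the vanishing covariance of \<open>E = T - S\<close> with
  \<open>N\<close> gives two equations, from which \<open>cov T W\<close> is eliminated;
  \<open>S\<close> and \<open>W\<close> are uncorrelated.\<close>

lemma stationary_variance:
  "cov (\<lambda>x. lpt (\<lambda>z. w z x) m n) (\<lambda>x. lpt (\<lambda>z. w z x) m n)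
    = n / \<rho>\<^sup>2 - m / (1 - \<rho>)\<^sup>2 + 2 * cov (\<lambda>x. lpt (\<lambda>z. w z x) m 0) (\<lambda>x. lpt (\<lambda>z. w z x) m n)"
proof -
  let ?T = "\<lambda>x. lpt (\<lambda>z. w z x) m n" and ?W = "\<lambda>x. lpt (\<lambda>z. w z x) 0 n" and ?S = "\<lambda>x. lpt (\<lambda>z. w z x) m 0"
  have "cov ?T ?T - cov ?T ?W - (cov ?W ?T - cov ?W ?W) = m / (1 - \<rho>)\<^sup>2"
    "cov ?T ?T - cov ?T ?W - (cov ?S ?T - cov ?S ?W) = 0"
    using stationary_north_east[OF w \<rho>, of m n]
    by (simp_all add: cov_diff_left cov_diff_right sq_int_diff sq)
  moreover have "cov ?W ?T = cov ?T ?W" by (rule cov_commute)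
  moreover have "cov ?S ?W = 0" "cov ?W ?W = n / \<rho>\<^sup>2"
    using boundary_field_cov_row0_col0[OF w, of m n] boundary_field_col0(2)[OF w, of n] \<rho> by simp_all
  ultimately show ?thesis by simp
qed

lemma stationary_variance_le:
  "cov (\<lambda>x. lpt (\<lambda>z. w z x) m n) (\<lambda>x. lpt (\<lambda>z. w z x) m n) \<le> 2 * (m / (1 - \<rho>)\<^sup>2 + n / \<rho>\<^sup>2)"
  using cov_self_add_le[of "\<lambda>x. lpt (\<lambda>z. w z x) m n - lpt (\<lambda>z. w z x) 0 n" "\<lambda>x. lpt (\<lambda>z. w z x) 0 n"]
    stationary_north_east[OF w \<rho>, of m n] boundary_field_col0(2)[OF w, of n] \<rho>
  by (simp add: sq sq_int_diff)

text \<open>Exits through \<open>(k, 0)\<close> are compared with the stationary model of a larger density \<open>\<rho>'\<close>,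
  built on the same weights.\<close>
lemma stationary_exit_prob:
  fixes \<rho>' :: real and k m n :: nat
  defines "w' \<equiv> \<lambda>z x. right_field k ((1 - \<rho>) / (1 - \<rho>')) (\<rho> / \<rho>') (\<lambda>z. w z x) z"
    and "\<Delta> \<equiv> n * (1 / \<rho> - 1 / \<rho>') - (real m - k) * (1 / (1 - \<rho>') - 1 / (1 - \<rho>))"
  assumes \<rho>': "\<rho> < \<rho>'" "\<rho>' < 1" and k: "k \<le> m" and \<Delta>: "0 < \<Delta>"
  shows "prob {x \<in> space M. lpt (\<lambda>z. w z x) m n \<le> lpt (\<lambda>z. w z x) k 0 + lpt (\<lambda>z. w' z x) (m - k) n}
    \<le> 16 * (m / (1 - \<rho>')\<^sup>2 + n / \<rho>\<^sup>2) / \<Delta>\<^sup>2"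
proof -
  have w': "stationary_field \<rho>' w'"
    using boundary_field_right_field[OF w, of "(1 - \<rho>) / (1 - \<rho>')" "\<rho> / \<rho>'" k] \<rho> \<rho>' by (simp add: w'_def)
  have \<rho>'0: "0 < \<rho>'" using \<rho> \<rho>' by simp
  let ?T = "\<lambda>x. lpt (\<lambda>z. w z x) m n" and ?S = "\<lambda>x. lpt (\<lambda>z. w z x) k 0" and ?T' = "\<lambda>x. lpt (\<lambda>z. w' z x) (m - k) n"
  \<comment> \<open>The event says \<open>?Z \<le> 0\<close>, while \<open>\<Delta>\<close> is the
    mean of \<open>?Z\<close>: the first \<open>k\<close> axis weights have the same mean in both
    models, and the rest is the difference of the stationary means from \<open>(k, 0)\<close>. So
    the event is a deviation of at least \<open>\<Delta>\<close>.\<close>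
  let ?Z = "\<lambda>x. ?T x - (?S x + ?T' x)"
  have sq': "sq_int ?T'" using \<rho>' \<rho>'0 by (intro boundary_field_sq_int_lpt[OF w']) auto
  have sqZ: "sq_int ?Z" by (intro sq_int_diff sq_int_add sq sq')
  have EZ: "expectation ?Z = \<Delta>"
  proof -
    have "expectation ?T' = (m - k) / (1 - \<rho>') + n / \<rho>'"
      using stationary_north_east[OF w' \<rho>'0 \<rho>'(2), of "m - k" n] boundary_field_col0(1)[OF w', of n] \<rho>' \<rho>'0 sq'
        boundary_field_sq_int_lpt[OF w', of 0 n]
      by (simp add: sq_int_integrable)
    then show ?thesis
      using k \<rho> boundary_field_row0(1)[OF w, of k] stationary_expectation[of m n]
      by (simp add: sq sq' sq_int_integrable sq_int_add \<Delta>_def of_nat_diff)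
        (simp add: algebra_simps diff_divide_distrib add_divide_distrib)
  qed
  have vT': "cov ?T' ?T' \<le> 2 * ((m - k) / (1 - \<rho>')\<^sup>2 + n / \<rho>'\<^sup>2)"
    using cov_self_add_le[of "\<lambda>x. lpt (\<lambda>z. w' z x) (m - k) n - lpt (\<lambda>z. w' z x) 0 n" "\<lambda>x. lpt (\<lambda>z. w' z x) 0 n"]
      stationary_north_east[OF w' \<rho>'0 \<rho>'(2), of "m - k" n] boundary_field_col0(2)[OF w', of n] \<rho>' \<rho>'0
      boundary_field_sq_int_lpt[OF w', of 0 n]
    by (simp add: sq' sq_int_diff)
  have "?Z = (\<lambda>x. ?T x + (- 1) * (?S x + ?T' x))"
    by (simp add: fun_eq_iff)
  then have "cov ?Z ?Z = cov (\<lambda>x. ?T x + (- 1) * (?S x + ?T' x)) (\<lambda>x. ?T x + (- 1) * (?S x + ?T' x))"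
    by (simp only:)
  also have "\<dots> \<le> 2 * (cov ?T ?T + cov (\<lambda>x. (- 1) * (?S x + ?T' x)) (\<lambda>x. (- 1) * (?S x + ?T' x)))"
    by (intro cov_self_add_le sq sq_int_cmult sq_int_add sq')
  also have "cov (\<lambda>x. (- 1) * (?S x + ?T' x)) (\<lambda>x. (- 1) * (?S x + ?T' x)) = cov (\<lambda>x. ?S x + ?T' x) (\<lambda>x. ?S x + ?T' x)"
    unfolding cov_self_cmult by simp
  also have "\<dots> \<le> 2 * (cov ?S ?S + cov ?T' ?T')"
    by (intro cov_self_add_le sq sq')
  also have "cov ?S ?S = k / (1 - \<rho>)\<^sup>2" using boundary_field_row0(2)[OF w, of k] \<rho> by simp
  finally have "cov ?Z ?Z \<le> 2 * (cov ?T ?T + 2 * (k / (1 - \<rho>)\<^sup>2 + cov ?T' ?T'))" by simp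
  also have "\<dots> \<le> 16 * (m / (1 - \<rho>')\<^sup>2 + n / \<rho>\<^sup>2)"
  proof -
    \<comment> \<open>All variances are measured against \<open>m / (1 - \<rho>')\<^sup>2\<close>
      and \<open>n / \<rho>\<^sup>2\<close>. The two applications of the sum bound then give
      coefficients 16 and 12, rounded up to 16.\<close>
    have "(1 - \<rho>')\<^sup>2 \<le> (1 - \<rho>)\<^sup>2" "\<rho>\<^sup>2 \<le> \<rho>'\<^sup>2" using \<rho> \<rho>' by (auto intro!: power_mono)
    then have "m / (1 - \<rho>)\<^sup>2 \<le> m / (1 - \<rho>')\<^sup>2" "k / (1 - \<rho>)\<^sup>2 \<le> m / (1 - \<rho>')\<^sup>2"
      "(m - k) / (1 - \<rho>')\<^sup>2 \<le> m / (1 - \<rho>')\<^sup>2" "n / \<rho>'\<^sup>2 \<le> n / \<rho>\<^sup>2" "0 \<le> n / \<rho>\<^sup>2"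
      using \<rho> \<rho>' k by (auto intro!: frac_le divide_right_mono)
    note le = this
    have "2 * (t + 2 * (a + t')) \<le> 16 * (b + e)"
      if "a0 \<le> b" "a \<le> b" "c \<le> b" "d \<le> e" "0 \<le> e" "t' \<le> 2 * (c + d)" "t \<le> 2 * (a0 + e)"
      for a a0 b c d e t t' :: real
      using that by simp
    from this[OF le vT' stationary_variance_le[of m n]] show ?thesis .
  qed
  finally have var: "variance ?Z \<le> 16 * (m / (1 - \<rho>')\<^sup>2 + n / \<rho>\<^sup>2)"
    using cov_self[OF sqZ] by simp
  have [measurable]: "?Z \<in> borel_measurable M" by (rule sq_int_measurable[OF sqZ])
  have "prob {x \<in> space M. ?T x \<le> ?S x + ?T' x} \<le> prob {x \<in> space M. \<Delta> \<le> \<bar>?Z x - expectation ?Z\<bar>}"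
    unfolding EZ by (rule finite_measure_mono) (use \<Delta> in \<open>auto simp: abs_if\<close>)
  also have "\<dots> \<le> variance ?Z / \<Delta>\<^sup>2"
    using sqZ \<Delta> by (intro Chebyshev_inequality) (auto simp: sq_int_def)
  also have "\<dots> \<le> 16 * (m / (1 - \<rho>')\<^sup>2 + n / \<rho>\<^sup>2) / \<Delta>\<^sup>2"
    by (intro divide_right_mono var) simp
  finally show ?thesis .
qed

text \<open>The passage time with \<open>w (i, 0)\<close> zeroed is independent of that weight, so
  only the difference contributes to the covariance; the product of means that is subtracted is
  nonnegative. The difference vanishes unless the axis is used at column \<open>i\<close>.\<close>

lemma cov_boundary_weight_lpt_le:
  fixes i m n :: nat
  assumes i: "1 \<le> i"
  shows "cov (w (i, 0)) (\<lambda>x. lpt (\<lambda>z. w z x) m n)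
    \<le> expectation (\<lambda>x. w (i, 0) x * (lpt (\<lambda>z. w z x) m n - lpt ((\<lambda>z. w z x)((i, 0) := 0)) m n))"
    and "AE x in M. 0 \<le> lpt (\<lambda>z. w z x) m n - lpt ((\<lambda>z. w z x)((i, 0) := 0)) m n \<and>
      lpt (\<lambda>z. w z x) m n - lpt ((\<lambda>z. w z x)((i, 0) := 0)) m n \<le> w (i, 0) x"
    and "sq_int (\<lambda>x. lpt (\<lambda>z. w z x) m n - lpt ((\<lambda>z. w z x)((i, 0) := 0)) m n)"
proof -
  let ?T = "\<lambda>x. lpt (\<lambda>z. w z x) m n" and ?U = "\<lambda>x. lpt ((\<lambda>z. w z x)((i, 0) := 0)) m n"
  obtain k where k: "i = Suc k" using i by (cases i) auto
  have ind: "indep_vars (\<lambda>_. borel) w UNIV" using w by (simp add: boundary_field_def)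
  have nonneg: "AE x in M. \<forall>z. z \<noteq> (0, 0) \<longrightarrow> 0 \<le> w z x"
    using boundary_field_AE_nonneg[OF w] \<rho> by simp
  then have AE: "AE x in M. 0 \<le> ?T x - ?U x \<and> ?T x - ?U x \<le> w (i, 0) x"
  proof eventually_elim
    case (elim x)
    then have nn: "0 \<le> w (i, 0) x" using i by auto
    then have "?U x \<le> ?T x" by (intro lpt_mono) auto
    moreover have "?T x \<le> ?U x + w (i, 0) x"
      using lpt_le_lpt_upd_zero[of "\<lambda>z. w z x" k m n] nn k by (auto split: if_splits)
    ultimately show ?case by simp
  qed
  show "AE x in M. 0 \<le> ?T x - ?U x \<and> ?T x - ?U x \<le> w (i, 0) x" by (rule AE)
  have sqw: "sq_int (w (i, 0))" using \<rho> i by (intro boundary_field_sq_int[OF w]) auto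
  have eq0: "?U x = lpt (\<lambda>z. (if z = (i, 0) then 0 else w z x)) m n" for x
    by (rule arg_cong[where f = "\<lambda>v. lpt v m n"]) auto
  have sq0: "sq_int ?U"
    unfolding eq0
  proof (rule sq_int_lpt)
    show "sq_int (\<lambda>x. if z = (i, 0) then 0 else w z x)" if "z \<noteq> (0, 0)" for z
      using that \<rho> boundary_field_sq_int[OF w, of z] by (cases "z = (i, 0)") (simp_all add: sq_int_const)
  qed
  show sqd: "sq_int (\<lambda>x. ?T x - ?U x)" by (intro sq_int_diff sq sq0)
  have "cov (w (i, 0)) ?U = 0"
  proof (intro cov_indep indep_var_rest[OF ind, where F = "\<lambda>y. lpt (y((i, 0) := 0)) m n"] sqw sq0)
    have "(\<lambda>y. lpt (y((i, 0) := 0)) m n) = (\<lambda>y. lpt (\<lambda>z. if z = (i, 0) then 0 else y z) m n)"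
      by (rule ext, rule arg_cong[where f = "\<lambda>v. lpt v m n"]) auto
    also have "\<dots> \<in> borel_measurable (Pi\<^sub>M UNIV (\<lambda>_. borel))" by measurable
    finally show "(\<lambda>y. lpt (y((i, 0) := 0)) m n) \<in> borel_measurable (Pi\<^sub>M UNIV (\<lambda>_. borel))" .
  qed simp
  then have "cov (w (i, 0)) ?T = cov (w (i, 0)) (\<lambda>x. ?T x - ?U x)"
    by (simp add: cov_diff_right sq sq0 sqw)
  also have "\<dots> \<le> expectation (\<lambda>x. w (i, 0) x * (?T x - ?U x))"
  proof -
    have "0 \<le> expectation (w (i, 0))"
      using nonneg by (intro integral_nonneg_AE) (use i in auto)
    moreover have "0 \<le> expectation (\<lambda>x. ?T x - ?U x)"
      using AE by (intro integral_nonneg_AE) auto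
    ultimately show ?thesis by (simp add: cov_def)
  qed
  finally show "cov (w (i, 0)) ?T \<le> expectation (\<lambda>x. w (i, 0) x * (?T x - ?U x))" .
qed

text \<open>Each of the first \<open>k\<close> axis weights contributes at most its second moment.
  Beyond \<open>k\<close> the contribution lives on \<open>D\<close>, and the square of the weight
  is split by Young's inequality with parameter \<open>\<delta>\<close> into a fourth moment,
  \<open>24 / (1 - \<rho>) ^ 4\<close>, and the indicator of \<open>D\<close>. Thus smallness of
  \<open>prob D\<close> suffices although weight and event are dependent.\<close>

lemma stationary_cov_le:
  fixes \<rho>' \<delta> :: real and k m n :: nat
  defines "w' \<equiv> \<lambda>z x. right_field k ((1 - \<rho>) / (1 - \<rho>')) (\<rho> / \<rho>') (\<lambda>z. w z x) z"
  defines "D \<equiv> {x \<in> space M. lpt (\<lambda>z. w z x) m n \<le> lpt (\<lambda>z. w z x) k 0 + lpt (\<lambda>z. w' z x) (m - k) n}"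
  assumes \<rho>': "\<rho> < \<rho>'" "\<rho>' < 1" and k: "k \<le> m" and \<delta>: "0 < \<delta>"
  shows "cov (\<lambda>x. lpt (\<lambda>z. w z x) m 0) (\<lambda>x. lpt (\<lambda>z. w z x) m n)
    \<le> k * (2 / (1 - \<rho>)\<^sup>2) + m * (12 * \<delta> / (1 - \<rho>) ^ 4 + prob D / (2 * \<delta>))"
proof -
  let ?T = "\<lambda>x. lpt (\<lambda>z. w z x) m n"
  let ?d = "\<lambda>i x. ?T x - lpt ((\<lambda>z. w z x)((i, 0) := 0)) m n"
  have d: "distributed M lborel (w (i, 0)) (exponential_density (1 - \<rho>))" if "i \<ge> 1" for i
    using w that by (simp add: boundary_field_def)
  note mom = exponential_moments[OF d, simplified]
  have w': "stationary_field \<rho>' w'"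
    using boundary_field_right_field[OF w, of "(1 - \<rho>) / (1 - \<rho>')" "\<rho> / \<rho>'" k] \<rho> \<rho>' by (simp add: w'_def)
  have [measurable]: "w z \<in> borel_measurable M" "w' z \<in> borel_measurable M" for z
    using boundary_field_measurable[OF w] boundary_field_measurable[OF w'] by auto
  have [measurable]: "D \<in> events" unfolding D_def by measurable
  have nonneg: "AE x in M. \<forall>z. z \<noteq> (0, 0) \<longrightarrow> 0 \<le> w z x"
    using boundary_field_AE_nonneg[OF w] \<rho> by simp
  have small: "cov (w (i, 0)) ?T \<le> 2 / (1 - \<rho>)\<^sup>2" if i: "1 \<le> i" for i
  proof -
    have "cov (w (i, 0)) ?T \<le> expectation (\<lambda>x. w (i, 0) x * ?d i x)"
      by (rule cov_boundary_weight_lpt_le(1)[OF i])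
    also have "\<dots> \<le> expectation (\<lambda>x. (w (i, 0) x)\<^sup>2)"
    proof (rule integral_mono_AE)
      show "integrable M (\<lambda>x. w (i, 0) x * ?d i x)"
        using \<rho> i by (intro sq_int_mult_integrable mom cov_boundary_weight_lpt_le(3)) auto
      show "integrable M (\<lambda>x. (w (i, 0) x)\<^sup>2)" using mom(1)[of i] \<rho> i by (simp add: sq_int_def)
      show "AE x in M. w (i, 0) x * ?d i x \<le> (w (i, 0) x)\<^sup>2"
        using nonneg cov_boundary_weight_lpt_le(2)[OF i, of m n]
        by eventually_elim (use i in \<open>auto simp: power2_eq_square intro!: mult_left_mono\<close>)
    qed
    also have "\<dots> = 2 / (1 - \<rho>)\<^sup>2" using mom(4)[of i] \<rho> i by simp
    finally show ?thesis .
  qed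
  have large: "cov (w (i, 0)) ?T \<le> 12 * \<delta> / (1 - \<rho>) ^ 4 + prob D / (2 * \<delta>)" if i: "k < i" for i
  proof -
    have i1: "1 \<le> i" using i by simp
    have int4: "integrable M (\<lambda>x. \<delta> / 2 * w (i, 0) x ^ 4)" using mom(5)[of i] \<rho> i1 by simp
    have intD: "integrable M (\<lambda>x. indicator D x / (2 * \<delta>) :: real)"
      by (rule integrable_const_bound[where B = "1 / (2 * \<delta>)"])
        (use \<delta> in \<open>auto split: split_indicator\<close>)
    have "cov (w (i, 0)) ?T \<le> expectation (\<lambda>x. w (i, 0) x * ?d i x)"
      by (rule cov_boundary_weight_lpt_le(1)[OF i1])
    also have "\<dots> \<le> expectation (\<lambda>x. \<delta> / 2 * w (i, 0) x ^ 4 + indicator D x / (2 * \<delta>))"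
    proof (rule integral_mono_AE)
      show "integrable M (\<lambda>x. w (i, 0) x * ?d i x)"
        using \<rho> i1 by (intro sq_int_mult_integrable mom cov_boundary_weight_lpt_le(3)) auto
      show "integrable M (\<lambda>x. \<delta> / 2 * w (i, 0) x ^ 4 + indicator D x / (2 * \<delta>))"
        by (intro Bochner_Integration.integrable_add int4 intD)
      show "AE x in M. w (i, 0) x * ?d i x \<le> \<delta> / 2 * w (i, 0) x ^ 4 + indicator D x / (2 * \<delta>)"
        using nonneg cov_boundary_weight_lpt_le(2)[OF i1, of m n] AE_space
      proof eventually_elim
        case (elim x)
        have nn: "0 \<le> w (i, 0) x" using elim i1 by auto
        show ?case
        proof (cases "?d i x = 0")
          case True
          then show ?thesis using \<delta> nn by simp
        next
          case False
          then have "?T x \<le> lpt (\<lambda>z. w z x) k 0 + lpt (\<lambda>z. w' z x) (m - k) n"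
            using exit_right_cases[of "\<lambda>z. w z x" "(1 - \<rho>) / (1 - \<rho>')" "\<rho> / \<rho>'" k i m n] elim i k \<rho> \<rho>'
            by (simp add: w'_def)
          then have D: "x \<in> D" using elim by (simp add: D_def)
          \<comment> \<open>Young's inequality for \<open>(w (i, 0) x)\<^sup>2\<close> times 1,
            obtained from a completed square.\<close>
          have "0 \<le> (\<delta> * (w (i, 0) x)\<^sup>2 - 1)\<^sup>2 / (2 * \<delta>)" using \<delta> by simp
          also have "\<dots> = \<delta> / 2 * w (i, 0) x ^ 4 + 1 / (2 * \<delta>) - (w (i, 0) x)\<^sup>2"
            using \<delta> by (simp add: field_simps power2_eq_square power4_eq_xxxx)
          finally have "(w (i, 0) x)\<^sup>2 \<le> \<delta> / 2 * w (i, 0) x ^ 4 + 1 / (2 * \<delta>)" by simp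
          moreover have "w (i, 0) x * ?d i x \<le> (w (i, 0) x)\<^sup>2"
            using elim nn by (auto simp: power2_eq_square intro!: mult_left_mono)
          ultimately show ?thesis using D by simp
        qed
      qed
    qed
    also have "\<dots> = 12 * \<delta> / (1 - \<rho>) ^ 4 + prob D / (2 * \<delta>)"
      using mom(6)[of i] \<rho> i1 by (subst Bochner_Integration.integral_add[OF int4 intD]) simp
    finally show ?thesis .
  qed
  let ?B = "12 * \<delta> / (1 - \<rho>) ^ 4 + prob D / (2 * \<delta>)"
  have B: "0 \<le> ?B" using \<delta> \<rho> by simp
  have "cov (\<lambda>x. lpt (\<lambda>z. w z x) m 0) ?T = (\<Sum>i=1..m. cov (w (i, 0)) ?T)"
    unfolding lpt_row0[of _ m] using \<rho> by (intro cov_sum_left sq boundary_field_sq_int[OF w]) auto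
  also have "\<dots> = (\<Sum>i\<in>{1..k}. cov (w (i, 0)) ?T) + (\<Sum>i\<in>{k<..m}. cov (w (i, 0)) ?T)"
    using k by (subst sum.union_disjoint[symmetric]) (auto intro!: sum.cong)
  also have "\<dots> \<le> (\<Sum>i\<in>{1..k}. 2 / (1 - \<rho>)\<^sup>2) + (\<Sum>i\<in>{k<..m}. ?B)"
    by (intro add_mono sum_mono small large) auto
  also have "\<dots> = k * (2 / (1 - \<rho>)\<^sup>2) + real (m - k) * ?B" by simp
  also have "\<dots> \<le> k * (2 / (1 - \<rho>)\<^sup>2) + m * ?B"
    by (intro add_left_mono mult_right_mono B) simp
  finally show ?thesis .
qed

end

end

section \<open>Fluctuations of the last passage time from one axis\<close>

text \<open>The quantity is the drop of \<open>a / (1 - r) + b / r\<close> between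
  \<open>r = \<rho>\<close> and \<open>r = \<rho>'\<close>. Divided by
  \<open>\<rho>' - \<rho>\<close> it tends to
  \<open>b / \<rho>\<^sup>2 - a / (1 - \<rho>)\<^sup>2\<close>, which is positive by
  assumption.\<close>

lemma density_gap_exists:
  fixes a b \<rho> :: real
  assumes \<rho>: "0 < \<rho>" "\<rho> < 1" and ab: "a / (1 - \<rho>)\<^sup>2 < b / \<rho>\<^sup>2"
  shows "\<exists>\<rho>'>\<rho>. \<rho>' < 1 \<and> 0 < b * (1 / \<rho> - 1 / \<rho>') - a * (1 / (1 - \<rho>') - 1 / (1 - \<rho>))"
proof -
  have "((\<lambda>r. b / (\<rho> * r) - a / ((1 - \<rho>) * (1 - r))) \<longlongrightarrow> b / (\<rho> * \<rho>) - a / ((1 - \<rho>) * (1 - \<rho>))) (at_right \<rho>)"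
    using \<rho> by (intro tendsto_intros) auto
  moreover have "0 < b / (\<rho> * \<rho>) - a / ((1 - \<rho>) * (1 - \<rho>))"
    using ab by (simp add: power2_eq_square)
  ultimately have "eventually (\<lambda>r. 0 < b / (\<rho> * r) - a / ((1 - \<rho>) * (1 - r))) (at_right \<rho>)"
    by (rule order_tendstoD)
  moreover have "eventually (\<lambda>r. r \<in> {\<rho><..<1}) (at_right \<rho>)"
    using \<rho> by (rule_tac eventually_at_right_real)
  ultimately have "eventually (\<lambda>r. r \<in> {\<rho><..<1} \<and> 0 < b / (\<rho> * r) - a / ((1 - \<rho>) * (1 - r))) (at_right \<rho>)"
    by eventually_elim simp
  then obtain r where r: "\<rho> < r" "r < 1" "0 < b / (\<rho> * r) - a / ((1 - \<rho>) * (1 - r))"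
    using eventually_happens'[of "at_right \<rho>"] by auto
  have "b * (1 / \<rho> - 1 / r) - a * (1 / (1 - r) - 1 / (1 - \<rho>)) = (r - \<rho>) * (b / (\<rho> * r) - a / ((1 - \<rho>) * (1 - r)))"
    using \<rho> r(1,2) by (simp add: divide_simps) (simp add: algebra_simps)
  also have "\<dots> > 0" using r by (intro mult_pos_pos) auto
  finally show ?thesis using r by auto
qed

lemma nat_floor_ratio_tendsto:
  fixes s :: "nat \<Rightarrow> real"
  assumes s: "filterlim s at_top sequentially" and c: "0 \<le> c"
  shows "(\<lambda>N. real (nat \<lfloor>c * s N\<rfloor>) / s N) \<longlonglongrightarrow> c"
proof (rule tendsto_sandwich)
  have spos: "eventually (\<lambda>N. 0 < s N) sequentially"
    using s by (simp add: filterlim_at_top_dense)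
  show "(\<lambda>N. c - inverse (s N)) \<longlonglongrightarrow> c"
    using tendsto_diff[OF tendsto_const[of c] tendsto_inverse_0_at_top[OF s]] by simp
  show "eventually (\<lambda>N. c - inverse (s N) \<le> real (nat \<lfloor>c * s N\<rfloor>) / s N) sequentially"
    using spos
  proof eventually_elim
    case (elim N)
    have "c * s N - 1 \<le> real (nat \<lfloor>c * s N\<rfloor>)" by linarith
    then have "(c * s N - 1) / s N \<le> real (nat \<lfloor>c * s N\<rfloor>) / s N"
      using elim by (intro divide_right_mono) auto
    then show ?case using elim by (simp add: diff_divide_distrib inverse_eq_divide)
  qed
  show "eventually (\<lambda>N. real (nat \<lfloor>c * s N\<rfloor>) / s N \<le> c) sequentially"
    using spos
  proof eventually_elim
    case (elim N)
    have "real (nat \<lfloor>c * s N\<rfloor>) \<le> c * s N" using c elim by simp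
    then show ?case using elim by (simp add: field_simps)
  qed
qed simp

lemma Lplus_measurable[measurable (raw)]:
  assumes [measurable]: "\<And>z. X z \<in> borel_measurable N"
  shows "(\<lambda>x. Lplus (\<lambda>z. X z x) (i, j)) \<in> borel_measurable N"
proof (cases j)
  \<comment> \<open>No path through \<open>(0, 1)\<close> ends on the horizontal axis, so
    \<open>Lplus\<close> is the constant \<open>Max {}\<close>.\<close>
  case 0
  then show ?thesis by (simp add: Lplus_def paths_via_01_row0[simplified])
next
  case (Suc j')
  have "(\<lambda>x. Lplus (\<lambda>z. X z x) (i, Suc j)) \<in> borel_measurable N" for j
  proof (induction i arbitrary: j)
    case 0
    show ?case by (induction j) (simp_all add: Lplus_rec)
  next
    case (Suc i)
    show ?case
    proof (induction j)
      case 0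
      show ?case using Suc[of 0] by (simp add: Lplus_rec)
    next
      case (Suc j)
      then show ?case using \<open>\<And>j. (\<lambda>x. Lplus (\<lambda>z. X z x) (i, Suc j)) \<in> borel_measurable N\<close>
        by (simp add: Lplus_rec)
    qed
  qed
  then show ?thesis by (simp add: Suc)
qed

context prob_space
begin

text \<open>The gap \<Delta> grows linearly in \<open>s\<close>, as do the variances, so the
  Chebyshev bound is of order \<open>1 / s\<close>. The hypothesis involves
  \<open>a - \<kappa>\<close> because the target is seen from the exit point.\<close>

lemma exit_prob_tendsto_0:
  fixes s :: "nat \<Rightarrow> real" and k m n :: "nat \<Rightarrow> nat" and \<kappa> a b :: real
  assumes w: "\<And>N. stationary_field \<rho> (w N)" and \<rho>: "0 < \<rho>" "\<rho> < 1"
    and s: "filterlim s at_top sequentially"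
    and lim: "(\<lambda>N. m N / s N) \<longlonglongrightarrow> a" "(\<lambda>N. n N / s N) \<longlonglongrightarrow> b" "(\<lambda>N. k N / s N) \<longlonglongrightarrow> \<kappa>"
    and km: "eventually (\<lambda>N. k N \<le> m N) sequentially"
    and ab: "(a - \<kappa>) / (1 - \<rho>)\<^sup>2 < b / \<rho>\<^sup>2"
  shows "\<exists>\<rho>'>\<rho>. \<rho>' < 1 \<and> (\<lambda>N. prob {x \<in> space M. lpt (\<lambda>z. w N z x) (m N) (n N) \<le> lpt (\<lambda>z. w N z x) (k N) 0 +
    lpt (right_field (k N) ((1 - \<rho>) / (1 - \<rho>')) (\<rho> / \<rho>') (\<lambda>z. w N z x)) (m N - k N) (n N)}) \<longlonglongrightarrow> 0"
proof -
  obtain \<rho>' where \<rho>': "\<rho> < \<rho>'" "\<rho>' < 1"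
    and gap: "0 < b * (1 / \<rho> - 1 / \<rho>') - (a - \<kappa>) * (1 / (1 - \<rho>') - 1 / (1 - \<rho>))" (is "0 < ?g")
    using density_gap_exists[OF \<rho> ab] by blast
  define \<Delta> where "\<Delta> N = n N * (1 / \<rho> - 1 / \<rho>') - (real (m N) - k N) * (1 / (1 - \<rho>') - 1 / (1 - \<rho>))" for N
  define p where "p N = prob {x \<in> space M. lpt (\<lambda>z. w N z x) (m N) (n N) \<le> lpt (\<lambda>z. w N z x) (k N) 0 +
    lpt (right_field (k N) ((1 - \<rho>) / (1 - \<rho>')) (\<rho> / \<rho>') (\<lambda>z. w N z x)) (m N - k N) (n N)}" for N
  have spos: "eventually (\<lambda>N. 0 < s N) sequentially"
    using s by (simp add: filterlim_at_top_dense)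
  have "(\<lambda>N. n N / s N * (1 / \<rho> - 1 / \<rho>') - (m N / s N - k N / s N) * (1 / (1 - \<rho>') - 1 / (1 - \<rho>))) \<longlonglongrightarrow> ?g"
    by (intro tendsto_intros lim)
  then have \<Delta>: "(\<lambda>N. \<Delta> N / s N) \<longlonglongrightarrow> ?g"
    by (simp add: \<Delta>_def diff_divide_distrib[symmetric] left_diff_distrib)
  have \<Delta>pos: "eventually (\<lambda>N. 0 < \<Delta> N) sequentially"
    using order_tendstoD(1)[OF \<Delta> gap] spos by eventually_elim (simp add: zero_less_divide_iff)
  have bound: "eventually (\<lambda>N. p N \<le> 16 * (m N / (1 - \<rho>')\<^sup>2 + n N / \<rho>\<^sup>2) / (\<Delta> N)\<^sup>2) sequentially"
    using \<Delta>pos km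
  proof eventually_elim
    case (elim N)
    then show ?case
      using stationary_exit_prob[OF w \<rho> \<rho>', of "k N" "m N" "n N" N] by (simp add: p_def \<Delta>_def)
  qed
  have "(\<lambda>N. inverse (s N) * (16 * (m N / s N / (1 - \<rho>')\<^sup>2 + n N / s N / \<rho>\<^sup>2) / (\<Delta> N / s N)\<^sup>2)) \<longlonglongrightarrow>
     0 * (16 * (a / (1 - \<rho>')\<^sup>2 + b / \<rho>\<^sup>2) / ?g\<^sup>2)"
    using gap \<rho> \<rho>' by (intro tendsto_intros lim \<Delta> tendsto_inverse_0_at_top s) auto
  moreover have "eventually (\<lambda>N. inverse (s N) * (16 * (m N / s N / (1 - \<rho>')\<^sup>2 + n N / s N / \<rho>\<^sup>2) / (\<Delta> N / s N)\<^sup>2)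
     = 16 * (m N / (1 - \<rho>')\<^sup>2 + n N / \<rho>\<^sup>2) / (\<Delta> N)\<^sup>2) sequentially"
    using spos
  proof eventually_elim
    case (elim N)
    have "inverse r * (16 * (x / r / c + y / r / d) / (D / r)\<^sup>2) = 16 * (x / c + y / d) / D\<^sup>2"
      if "0 < r" for x y c d D r :: real
    proof -
      have "x / r / c + y / r / d = (x / c + y / d) / r" using that by (simp add: add_divide_distrib mult.commute)
      then show ?thesis using that by (simp add: power_divide power2_eq_square)
    qed
    from this[OF elim] show ?case .
  qed
  ultimately have "(\<lambda>N. 16 * (m N / (1 - \<rho>')\<^sup>2 + n N / \<rho>\<^sup>2) / (\<Delta> N)\<^sup>2) \<longlonglongrightarrow> 0"
    using tendsto_cong by fastforce
  then have "p \<longlonglongrightarrow> 0"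
    by (rule tendsto_sandwich[rotated 3]) (use bound in \<open>auto simp: p_def\<close>)
  then show ?thesis using \<rho>' unfolding p_def by blast
qed

text \<open>Along the characteristic direction the linear terms of the variance identity cancel.\<close>
lemma stationary_variance_tendsto_0:
  fixes s :: "nat \<Rightarrow> real" and m n :: "nat \<Rightarrow> nat" and a b :: real
  assumes w: "\<And>N. stationary_field \<rho> (w N)" and \<rho>: "0 < \<rho>" "\<rho> < 1"
    and s: "filterlim s at_top sequentially"
    and lim: "(\<lambda>N. m N / s N) \<longlonglongrightarrow> a" "(\<lambda>N. n N / s N) \<longlonglongrightarrow> b"
    and ab: "0 < a" "a / (1 - \<rho>)\<^sup>2 = b / \<rho>\<^sup>2"
  defines "v \<equiv> \<lambda>N. cov (\<lambda>x. lpt (\<lambda>z. w N z x) (m N) (n N)) (\<lambda>x. lpt (\<lambda>z. w N z x) (m N) (n N))"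
  shows "(\<lambda>N. v N / s N) \<longlonglongrightarrow> 0"
proof (rule order_tendstoI)
  have spos: "eventually (\<lambda>N. 0 < s N) sequentially"
    using s by (simp add: filterlim_at_top_dense)
  have v0: "0 \<le> v N" for N
    unfolding v_def using \<rho> by (intro cov_self_nonneg boundary_field_sq_int_lpt[OF w]) auto
  show "eventually (\<lambda>N. e < v N / s N) sequentially" if "e < 0" for e
    using spos by eventually_elim (use v0 that in \<open>auto intro: less_le_trans\<close>)
  fix e :: real assume e: "0 < e"
  \<comment> \<open>In the limit the first \<open>\<kappa> s\<close> weights contribute at most
    \<open>e / 4\<close> to the variance over \<open>s\<close>, and the fourth-moment term
    contributes \<open>e / 4\<close> by the choice of \<open>\<delta>\<close>. The cap
    \<open>a / 2\<close> keeps the cut left of the target.\<close>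
  define \<kappa> where "\<kappa> = min (a / 2) (e * (1 - \<rho>)\<^sup>2 / 16)"
  define \<delta> where "\<delta> = e * (1 - \<rho>) ^ 4 / (96 * a)"
  have \<kappa>: "0 < \<kappa>" "\<kappa> < a" "2 * \<kappa> * (2 / (1 - \<rho>)\<^sup>2) \<le> e / 4"
  proof -
    show "0 < \<kappa>" "\<kappa> < a" using e ab \<rho> by (auto simp: \<kappa>_def min_def)
    have "2 * \<kappa> * (2 / (1 - \<rho>)\<^sup>2) \<le> 2 * (e * (1 - \<rho>)\<^sup>2 / 16) * (2 / (1 - \<rho>)\<^sup>2)"
      by (intro mult_right_mono mult_left_mono) (auto simp: \<kappa>_def)
    also have "\<dots> = e / 4" using \<rho> by simp
    finally show "2 * \<kappa> * (2 / (1 - \<rho>)\<^sup>2) \<le> e / 4" .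
  qed
  have \<delta>: "0 < \<delta>" "2 * (a * (12 * \<delta> / (1 - \<rho>) ^ 4)) = e / 4"
    using e ab \<rho> by (auto simp: \<delta>_def field_simps)
  define k where "k N = nat \<lfloor>\<kappa> * s N\<rfloor>" for N
  have k: "(\<lambda>N. k N / s N) \<longlonglongrightarrow> \<kappa>"
    unfolding k_def using \<kappa> by (intro nat_floor_ratio_tendsto s) simp
  have km: "eventually (\<lambda>N. k N \<le> m N) sequentially"
  proof -
    have "eventually (\<lambda>N. 0 < m N / s N - k N / s N) sequentially"
      using order_tendstoD(1)[OF tendsto_diff[OF lim(1) k], of 0] \<kappa> by simp
    then show ?thesis using spos by eventually_elim (simp add: diff_divide_distrib[symmetric] zero_less_divide_iff)
  qed
  \<comment> \<open>In the characteristic direction itself there is equality; moving the start to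
    \<open>\<kappa>\<close> creates the strict inequality needed for a density gap.\<close>
  have "(a - \<kappa>) / (1 - \<rho>)\<^sup>2 < a / (1 - \<rho>)\<^sup>2" using \<kappa> \<rho> by (intro divide_strict_right_mono) auto
  then obtain \<rho>' where \<rho>': "\<rho> < \<rho>'" "\<rho>' < 1" and p: "(\<lambda>N. prob {x \<in> space M. lpt (\<lambda>z. w N z x) (m N) (n N) \<le> lpt (\<lambda>z. w N z x) (k N) 0 +
    lpt (right_field (k N) ((1 - \<rho>) / (1 - \<rho>')) (\<rho> / \<rho>') (\<lambda>z. w N z x)) (m N - k N) (n N)}) \<longlonglongrightarrow> 0"
    (is "?p \<longlonglongrightarrow> 0")
    using exit_prob_tendsto_0[where w = w, OF w \<rho> s lim k km] ab by auto
  let ?u = "\<lambda>N. (n N / s N / \<rho>\<^sup>2 - m N / s N / (1 - \<rho>)\<^sup>2) + 2 * (k N / s N * (2 / (1 - \<rho>)\<^sup>2) +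
     m N / s N * (12 * \<delta> / (1 - \<rho>) ^ 4 + ?p N / (2 * \<delta>)))"
  have "?u \<longlonglongrightarrow> (b / \<rho>\<^sup>2 - a / (1 - \<rho>)\<^sup>2) + 2 * (\<kappa> * (2 / (1 - \<rho>)\<^sup>2) + a * (12 * \<delta> / (1 - \<rho>) ^ 4 + 0 / (2 * \<delta>)))"
    using \<rho> \<delta> by (intro tendsto_intros lim k p) auto
  moreover have "(b / \<rho>\<^sup>2 - a / (1 - \<rho>)\<^sup>2) + 2 * (\<kappa> * (2 / (1 - \<rho>)\<^sup>2) + a * (12 * \<delta> / (1 - \<rho>) ^ 4 + 0 / (2 * \<delta>))) < e"
  proof -
    have "(b / \<rho>\<^sup>2 - a / (1 - \<rho>)\<^sup>2) + 2 * (\<kappa> * (2 / (1 - \<rho>)\<^sup>2) + a * (12 * \<delta> / (1 - \<rho>) ^ 4 + 0 / (2 * \<delta>)))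
      = 2 * \<kappa> * (2 / (1 - \<rho>)\<^sup>2) + 2 * (a * (12 * \<delta> / (1 - \<rho>) ^ 4))"
      unfolding ab(2) by simp
    also have "\<dots> \<le> e / 4 + e / 4" by (rule add_mono[OF \<kappa>(3) eq_refl[OF \<delta>(2)]])
    also have "\<dots> < e" using e by simp
    finally show ?thesis .
  qed
  ultimately have "eventually (\<lambda>N. ?u N < e) sequentially" by (rule order_tendstoD)
  then show "eventually (\<lambda>N. v N / s N < e) sequentially"
    using spos km
  proof eventually_elim
    case (elim N)
    have "v N \<le> n N / \<rho>\<^sup>2 - m N / (1 - \<rho>)\<^sup>2 + 2 * (k N * (2 / (1 - \<rho>)\<^sup>2) +
      m N * (12 * \<delta> / (1 - \<rho>) ^ 4 + ?p N / (2 * \<delta>)))"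
      using stationary_variance[OF w \<rho>, of N "m N" "n N"] stationary_cov_le[OF w \<rho> \<rho>' elim(3) \<delta>(1), of N "n N"]
      by (simp add: v_def)
    then have "v N / s N \<le> (n N / \<rho>\<^sup>2 - m N / (1 - \<rho>)\<^sup>2 + 2 * (k N * (2 / (1 - \<rho>)\<^sup>2) +
      m N * (12 * \<delta> / (1 - \<rho>) ^ 4 + ?p N / (2 * \<delta>)))) / s N"
      using elim by (intro divide_right_mono) auto
    also have "\<dots> = ?u N"
      by (simp add: add_divide_distrib diff_divide_distrib mult.commute[of _ "s N"])
    finally show ?case using elim(1) by simp
  qed
qed

text \<open>The strict inequality places the target above the characteristic of density \<rho>. The
  limit of \<open>y\<close> is chosen so that the displacement left from \<open>(0, y)\<close> is
  asymptotically \<open>(a, a * \<rho>\<^sup>2 / (1 - \<rho>)\<^sup>2)\<close>, which is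
  characteristic; \<open>R\<close> subtracts the mean of that remaining stationary passage
  time.\<close>

lemma Lplus_fluctuations:
  fixes s :: "nat \<Rightarrow> real" and m n y :: "nat \<Rightarrow> nat" and a b \<alpha> \<rho> \<epsilon> :: real
  assumes w: "boundary_field \<alpha> \<rho> w" "\<forall>x\<in>space M. w (0, 0) x = 0" and \<alpha>: "0 < \<alpha>" and \<rho>: "0 < \<rho>" "\<rho> < 1"
    and s: "filterlim s at_top sequentially"
    and lim: "(\<lambda>N. m N / s N) \<longlonglongrightarrow> a" "(\<lambda>N. n N / s N) \<longlonglongrightarrow> b"
      "(\<lambda>N. y N / s N) \<longlonglongrightarrow> b - a * \<rho>\<^sup>2 / (1 - \<rho>)\<^sup>2"
    and ab: "0 < a" "a / (1 - \<rho>)\<^sup>2 < b / \<rho>\<^sup>2" and \<epsilon>: "0 < \<epsilon>"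
  defines "R \<equiv> \<lambda>N x. Lplus (\<lambda>z. w z x) (m N, n N) - (\<Sum>j=1..y N. w (0, j) x) - (m N / (1 - \<rho>) + (real (n N) - y N) / \<rho>)"
  shows "(\<lambda>N. prob {x \<in> space M. \<epsilon> * sqrt (s N) < \<bar>R N x\<bar>}) \<longlonglongrightarrow> 0"
proof -
  \<comment> \<open>This factor gives the horizontal axis the rate \<open>1 - \<rho>\<close>.
    \<open>Lplus\<close> does not see that axis, so it is the same for \<open>w\<close> and
    \<open>v\<close>.\<close>
  define c where "c = \<alpha> / (1 - \<rho>)"
  have c: "0 < c" using \<alpha> \<rho> by (simp add: c_def)
  define v where "v = (\<lambda>z x. right_field 0 c 1 (\<lambda>z. w z x) z)"
  have v: "stationary_field \<rho> v"
    using boundary_field_right_field[OF w(1) \<alpha> \<rho>(1) c, of 1 0] \<alpha> \<rho> by (simp add: v_def c_def)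
  have spos: "eventually (\<lambda>N. 0 < s N) sequentially"
    using s by (simp add: filterlim_at_top_dense)
  define B where "B N x = lpt (\<lambda>z. (row_shift (m N) ^^ y N) (\<lambda>z. v z x) z) (m N) (n N - y N)" for N x
  have vN: "stationary_field \<rho> (\<lambda>z x. (row_shift (m N) ^^ y N) (\<lambda>z. v z x) z)" for N
    by (rule stationary_field_row_shift_pow[OF v \<rho>])
  have sqB: "sq_int (B N)" for N
    unfolding B_def using \<rho> by (intro boundary_field_sq_int_lpt[OF vN]) auto
  have yn: "eventually (\<lambda>N. y N < n N) sequentially"
  proof -
    have "0 < b - (b - a * \<rho>\<^sup>2 / (1 - \<rho>)\<^sup>2)" using ab \<rho> by simp
    then have "eventually (\<lambda>N. 0 < n N / s N - y N / s N) sequentially"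
      using order_tendstoD(1)[OF tendsto_diff[OF lim(2,3)], of 0] by simp
    then show ?thesis using spos by eventually_elim (simp add: diff_divide_distrib[symmetric] zero_less_divide_iff)
  qed
  have "(\<lambda>N. cov (B N) (B N) / s N) \<longlonglongrightarrow> 0"
    unfolding B_def
  proof (rule stationary_variance_tendsto_0[OF vN \<rho> s lim(1)])
    show "(\<lambda>N. real (n N - y N) / s N) \<longlonglongrightarrow> a * \<rho>\<^sup>2 / (1 - \<rho>)\<^sup>2"
    proof (rule Lim_transform_eventually)
      show "(\<lambda>N. n N / s N - y N / s N) \<longlonglongrightarrow> a * \<rho>\<^sup>2 / (1 - \<rho>)\<^sup>2"
        using tendsto_diff[OF lim(2,3)] by simp
      show "eventually (\<lambda>N. n N / s N - y N / s N = real (n N - y N) / s N) sequentially"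
        using yn by eventually_elim (simp add: of_nat_diff diff_divide_distrib)
    qed
    show "a / (1 - \<rho>)\<^sup>2 = a * \<rho>\<^sup>2 / (1 - \<rho>)\<^sup>2 / \<rho>\<^sup>2" using \<rho> by simp
  qed (use ab in simp)
  then have cheb0: "(\<lambda>N. cov (B N) (B N) / s N / \<epsilon>\<^sup>2) \<longlonglongrightarrow> 0"
    by (rule tendsto_divide_zero)
  \<comment> \<open>With \<open>k = 0\<close> the event covers any profitable use of the horizontal
    axis. Here the inequality is strict already, so no macroscopic cut is involved.\<close>
  obtain \<rho>' where \<rho>': "\<rho> < \<rho>'" "\<rho>' < 1"
    and p: "(\<lambda>N. prob {x \<in> space M. lpt (\<lambda>z. v z x) (m N) (n N) \<le> lpt (\<lambda>z. v z x) 0 0 +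
      lpt (right_field 0 ((1 - \<rho>) / (1 - \<rho>')) (\<rho> / \<rho>') (\<lambda>z. v z x)) (m N - 0) (n N)}) \<longlonglongrightarrow> 0"
    using exit_prob_tendsto_0[where w = "\<lambda>_. v", OF v \<rho> s lim(1,2), of "\<lambda>_. 0" 0] ab by auto
  define D where "D N = {x \<in> space M. lpt (\<lambda>z. v z x) (m N) (n N) \<le>
      lpt (right_field 0 ((1 - \<rho>) / (1 - \<rho>')) (\<rho> / \<rho>') (\<lambda>z. v z x)) (m N) (n N)}" for N
  have v': "stationary_field \<rho>' (\<lambda>z x. right_field 0 ((1 - \<rho>) / (1 - \<rho>')) (\<rho> / \<rho>') (\<lambda>z. v z x) z)"
    using boundary_field_right_field[OF v, of "(1 - \<rho>) / (1 - \<rho>')" "\<rho> / \<rho>'" 0] \<rho> \<rho>' by simp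
  have [measurable]: "w z \<in> borel_measurable M" "v z \<in> borel_measurable M"
    "(\<lambda>x. right_field 0 ((1 - \<rho>) / (1 - \<rho>')) (\<rho> / \<rho>') (\<lambda>z. v z x) z) \<in> borel_measurable M" "B N \<in> borel_measurable M" for z N
    using boundary_field_measurable[OF w(1)] boundary_field_measurable[OF v] boundary_field_measurable[OF v'] sqB
    by (auto simp: sq_int_def)
  have [measurable]: "D N \<in> events" for N unfolding D_def by measurable
  have pD: "(\<lambda>N. prob (D N)) \<longlonglongrightarrow> 0" using p by (simp add: D_def)
  have nonneg: "AE x in M. \<forall>z. 0 \<le> w z x"
    using boundary_field_AE_nonneg[OF w(1) \<alpha> \<rho>(1)] AE_space
  proof eventually_elim
    case (elim x)
    show ?case
    proof
      fix z :: "nat \<times> nat"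
      show "0 \<le> w z x"
      proof (cases "z = (0, 0)")
        case True
        then show ?thesis using elim w(2) by simp
      next
        case False
        then show ?thesis using elim by blast
      qed
    qed
  qed
  have EB: "expectation (B N) = m N / (1 - \<rho>) + real (n N - y N) / \<rho>" for N
    unfolding B_def by (rule stationary_expectation[OF vN \<rho>])
  define E where "E N = {x \<in> space M. \<epsilon> * sqrt (s N) \<le> \<bar>B N x - expectation (B N)\<bar>}" for N
  have [measurable]: "E N \<in> events" for N unfolding E_def by measurable
  have "eventually (\<lambda>N. prob {x \<in> space M. \<epsilon> * sqrt (s N) < \<bar>R N x\<bar>} \<le> prob (D N) + cov (B N) (B N) / s N / \<epsilon>\<^sup>2) sequentially"
    using spos yn
  proof eventually_elim
    case (elim N)
    have "AE x in M. x \<in> {x \<in> space M. \<epsilon> * sqrt (s N) < \<bar>R N x\<bar>} \<longrightarrow> x \<in> D N \<union> E N"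
      using nonneg AE_space
    proof eventually_elim
      case (elim x)
      have wx: "0 \<le> w z x" for z using elim by blast
      have vx: "0 \<le> v z x" for z using wx c by (auto simp: v_def right_field_def split: prod.splits)
      let ?v0 = "\<lambda>(a, b). if b = 0 \<and> a > 0 then 0 else v (a, b) x"
      have T: "lpt (\<lambda>z. v z x) 0 (y N) = (\<Sum>j=1..y N. w (0, j) x)"
        unfolding lpt_col0 by (intro sum.cong) (auto simp: v_def right_field_def)
      have BN: "B N x = lpt (\<lambda>z. v z x) (m N) (n N) - (\<Sum>j=1..y N. w (0, j) x)"
        using lpt_row_shift_pow[of "m N" "m N" "y N" "\<lambda>z. v z x" "n N - y N"] \<open>y N < n N\<close> T
        by (simp add: B_def)
      have Lp: "Lplus (\<lambda>z. w z x) (m N, n N) = lpt ?v0 (m N) (n N)"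
      proof -
        obtain n' where n': "n N = Suc n'" using \<open>y N < n N\<close> by (cases "n N") auto
        show ?thesis
          unfolding n' Lplus_eq_lpt[of "\<lambda>z. w z x", OF wx]
          by (rule lpt_cong) (auto simp: v_def right_field_def)
      qed
      have "lpt ?v0 (m N) (n N) \<le> lpt (\<lambda>z. v z x) (m N) (n N)"
        by (rule lpt_mono) (use vx in \<open>auto split: prod.splits\<close>)
      moreover have "lpt (\<lambda>z. v z x) (0 + m N) (n N) \<le> max (lpt ?v0 (0 + m N) (n N)) (lpt (\<lambda>z. v z x) 0 0 +
          lpt (right_field 0 ((1 - \<rho>) / (1 - \<rho>')) (\<rho> / \<rho>') (\<lambda>z. v z x)) (m N) (n N))"
      proof (rule lpt_exit_right_bound)
        have "v z x \<le> (1 - \<rho>) / (1 - \<rho>') * v z x" for z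
          using vx[of z] \<rho> \<rho>' mult_right_mono[of 1 "(1 - \<rho>) / (1 - \<rho>')" "v z x"] by simp
        then show "v (0 + i, 0) x \<le> right_field 0 ((1 - \<rho>) / (1 - \<rho>')) (\<rho> / \<rho>') (\<lambda>z. v z x) (i, 0)" for i
          by (simp add: right_field_def)
        show "0 \<le> right_field 0 ((1 - \<rho>) / (1 - \<rho>')) (\<rho> / \<rho>') (\<lambda>z. v z x) (0, j)" for j
          using vx \<rho> \<rho>' by (simp add: right_field_def)
      qed (simp add: right_field_def)
      \<comment> \<open>\<open>?v0\<close> ignores the horizontal axis and its passage time is
        \<open>Lplus\<close>. If that falls short of the stationary time, the second entry of the
        maximum must dominate, which is the event \<open>D N\<close>.\<close>
      ultimately have cases: "x \<in> D N \<or> Lplus (\<lambda>z. w z x) (m N, n N) = lpt (\<lambda>z. v z x) (m N) (n N)"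
        using elim unfolding Lp D_def by (auto simp: max_def split: if_splits)
      show ?case
      proof (intro impI)
        assume x: "x \<in> {x \<in> space M. \<epsilon> * sqrt (s N) < \<bar>R N x\<bar>}"
        show "x \<in> D N \<union> E N"
        proof (cases "x \<in> D N")
          case False
          then have "R N x = B N x - expectation (B N)"
            using cases BN \<open>y N < n N\<close> by (simp add: R_def EB of_nat_diff)
          then show ?thesis using x by (simp add: E_def)
        qed simp
      qed
    qed
    then have "prob {x \<in> space M. \<epsilon> * sqrt (s N) < \<bar>R N x\<bar>} \<le> prob (D N \<union> E N)"
      by (rule finite_measure_mono_AE) simp
    also have "\<dots> \<le> prob (D N) + prob (E N)" by (rule measure_Un_le) simp_all
    also have "prob (E N) \<le> variance (B N) / (\<epsilon> * sqrt (s N))\<^sup>2"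
      unfolding E_def using sqB \<epsilon> elim by (intro Chebyshev_inequality) (auto simp: sq_int_def)
    also have "\<dots> = cov (B N) (B N) / s N / \<epsilon>\<^sup>2"
      using elim by (simp add: cov_self[OF sqB] power_mult_distrib mult.commute)
    finally show ?case by simp
  qed
  moreover have "(\<lambda>N. prob (D N) + cov (B N) (B N) / s N / \<epsilon>\<^sup>2) \<longlonglongrightarrow> 0"
    using tendsto_add[OF pD cheb0] by simp
  ultimately show ?thesis
    by (rule_tac tendsto_sandwich[OF _ _ tendsto_const]) auto
qed

end

section \<open>Central limit theorem for the boundary sums\<close>

lemma isCont_cdf_std_normal: "isCont (cdf std_normal_distribution) a"
proof -
  interpret real_distribution std_normal_distribution by (rule real_dist_normal_dist)
  show ?thesis
    unfolding isCont_cdf by (simp add: measure_def emeasure_density nn_integral_cmult_indicator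
        nn_integral_indicator_singleton)
qed

context prob_space
begin

text \<open>Both functions agree with \<open>1 - \<tau>\<^sup>2 / (2 * l\<^sup>2)\<close> up to
  third order. Cubic error is enough: order \<open>s\<close> factors at \<tau> of order
  \<open>1 / sqrt s\<close> leave a vanishing total. The sign \<open>c\<close> covers the two axes,
  which enter with opposite signs.\<close>

lemma char_centered_exponential:
  assumes D: "distributed M lborel X (exponential_density l)" and l: "0 < l" and c: "\<bar>c\<bar> = 1" and \<tau>: "\<bar>\<tau>\<bar> \<le> 1"
  shows "cmod (char (distr M borel (\<lambda>x. c * (X x - 1 / l))) \<tau> - exp (- (\<tau>\<^sup>2 / (2 * l\<^sup>2))))
    \<le> ((1 + 200 / l ^ 4) / 6 + 1 / l ^ 4) * \<bar>\<tau>\<bar> ^ 3"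
proof -
  note mom = exponential_moments[OF D l]
  have [measurable]: "X \<in> borel_measurable M" using mom(1) by (simp add: sq_int_def)
  let ?Y = "\<lambda>x. c * (X x - 1 / l)"
  have c2: "c\<^sup>2 = 1" using c by (metis power2_abs power_one)
  have c4: "c ^ 4 = 1" using c2 by (metis power_even_eq power_one mult_2 numeral_Bit0 one_power2 power_add)
  have sqY: "sq_int ?Y" by (intro sq_int_cmult sq_int_diff mom sq_int_const)
  have EY: "expectation ?Y = 0" using mom by (simp add: sq_int_integrable prob_space)
  have VY: "variance ?Y = 1 / l\<^sup>2"
  proof -
    have "variance ?Y = cov ?Y ?Y" by (rule cov_self[OF sqY, symmetric])
    also have "\<dots> = cov (\<lambda>x. X x - 1 / l) (\<lambda>x. X x - 1 / l)" by (simp add: cov_self_cmult c2)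
    also have "\<dots> = cov X X"
      using cov_const[of "1 / l"] cov_commute[of _ "\<lambda>_. 1 / l"]
      by (simp add: cov_diff_left cov_diff_right mom sq_int_const sq_int_diff)
    finally show ?thesis by (simp add: mom)
  qed
  have int4: "integrable M (\<lambda>x. 1 + 8 * (X x ^ 4 + 1 / l ^ 4))" using mom by simp
  \<comment> \<open>The cube is bounded by 1 plus the fourth power, and the 8 comes from applying
    \<open>(a - b)\<^sup>2 \<le> 2 * (a\<^sup>2 + b\<^sup>2)\<close> twice. In expectation,
    \<open>8 * (24 + 1)\<close> gives the constant 200.\<close>
  have pt: "\<bar>?Y x\<bar> ^ 3 \<le> 1 + 8 * (X x ^ 4 + 1 / l ^ 4)" for x
  proof -
    let ?y = "\<bar>?Y x\<bar>"
    have "?y ^ 3 \<le> 1 + ?y ^ 4"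
    proof (cases "?y \<le> 1")
      case True
      then have "?y ^ 3 \<le> 1" by (intro power_le_one) auto
      then show ?thesis using zero_le_power[of ?y 4] by linarith
    next
      case False
      then have "?y ^ 3 \<le> ?y ^ 4" by (intro power_increasing) auto
      then show ?thesis by simp
    qed
    also have "?y ^ 4 = (X x - 1 / l) ^ 4" by (simp add: power_mult_distrib c4 power_even_abs)
    also have "\<dots> \<le> 8 * (X x ^ 4 + (1 / l) ^ 4)"
    proof -
      have sq: "(a - b)\<^sup>2 \<le> 2 * (a\<^sup>2 + b\<^sup>2)" for a b :: real
        using zero_le_power2[of "a + b"] by (simp add: power2_sum power2_diff)
      have "((X x - 1 / l)\<^sup>2)\<^sup>2 \<le> (2 * ((X x)\<^sup>2 + (1 / l)\<^sup>2))\<^sup>2"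
        by (intro power_mono sq) simp
      also have "\<dots> = 4 * ((X x)\<^sup>2 - - (1 / l)\<^sup>2)\<^sup>2" unfolding power_mult_distrib by simp
      also have "\<dots> \<le> 4 * (2 * (((X x)\<^sup>2)\<^sup>2 + (- (1 / l)\<^sup>2)\<^sup>2))"
        by (intro mult_left_mono sq) simp
      finally show ?thesis by simp
    qed
    finally show ?thesis by (simp add: power_divide)
  qed
  have "expectation (\<lambda>x. min (6 * (?Y x)\<^sup>2) (\<bar>\<tau>\<bar> * \<bar>?Y x\<bar> ^ 3)) \<le> expectation (\<lambda>x. \<bar>\<tau>\<bar> * (1 + 8 * (X x ^ 4 + 1 / l ^ 4)))"
  proof (rule integral_mono)
    show "integrable M (\<lambda>x. min (6 * (?Y x)\<^sup>2) (\<bar>\<tau>\<bar> * \<bar>?Y x\<bar> ^ 3))"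
      by (rule Bochner_Integration.integrable_bound[of _ "\<lambda>x. 6 * (?Y x)\<^sup>2"])
        (use sqY in \<open>auto simp: sq_int_def\<close>)
    show "integrable M (\<lambda>x. \<bar>\<tau>\<bar> * (1 + 8 * (X x ^ 4 + 1 / l ^ 4)))" using int4 by simp
    show "min (6 * (?Y x)\<^sup>2) (\<bar>\<tau>\<bar> * \<bar>?Y x\<bar> ^ 3) \<le> \<bar>\<tau>\<bar> * (1 + 8 * (X x ^ 4 + 1 / l ^ 4))" for x
      using pt[of x] by (intro min.coboundedI2 mult_left_mono) auto
  qed
  also have "\<dots> = \<bar>\<tau>\<bar> * (1 + 200 / l ^ 4)"
    using mom by (simp add: prob_space)
  finally have E: "expectation (\<lambda>x. min (6 * (?Y x)\<^sup>2) (\<bar>\<tau>\<bar> * \<bar>?Y x\<bar> ^ 3)) \<le> \<bar>\<tau>\<bar> * (1 + 200 / l ^ 4)" .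
  have "cmod (char (distr M borel ?Y) \<tau> - (1 - \<tau>\<^sup>2 * (1 / l\<^sup>2) / 2))
     \<le> (\<tau>\<^sup>2 / 6) * expectation (\<lambda>x. min (6 * (?Y x)\<^sup>2) (\<bar>\<tau>\<bar> * \<bar>?Y x\<bar> ^ 3))"
    by (rule char_approx3'[OF _ sq_int_integrable[OF sqY] _ EY VY refl])
      (use sqY in \<open>simp_all only: sq_int_def\<close>)
  also have "\<dots> \<le> (\<tau>\<^sup>2 / 6) * (\<bar>\<tau>\<bar> * (1 + 200 / l ^ 4))"
    by (intro mult_left_mono E) simp
  also have "\<dots> = (1 + 200 / l ^ 4) / 6 * \<bar>\<tau>\<bar> ^ 3"
  proof -
    have "\<bar>\<tau>\<bar> ^ 3 = \<bar>\<tau>\<bar>\<^sup>2 * \<bar>\<tau>\<bar>" unfolding power3_eq_cube power2_eq_square ..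
    then show ?thesis by (simp add: mult.assoc)
  qed
  finally have 1: "cmod (char (distr M borel ?Y) \<tau> - (1 - \<tau>\<^sup>2 * (1 / l\<^sup>2) / 2)) \<le> (1 + 200 / l ^ 4) / 6 * \<bar>\<tau>\<bar> ^ 3" .
  define v where "v = \<tau>\<^sup>2 / (2 * l\<^sup>2)"
  have v0: "0 \<le> v" by (simp add: v_def)
  have "\<bar>exp (- v) - (1 - v)\<bar> \<le> v\<^sup>2"
  proof -
    have "1 + (- v) \<le> exp (- v)" by (rule exp_ge_add_one_self)
    moreover have "exp (- v) \<le> 1 - v + v\<^sup>2"
    proof -
      have "exp (- v) = inverse (exp v)" by (rule exp_minus)
      also have "\<dots> \<le> inverse (1 + v)"
        using exp_ge_add_one_self[of v] v0 by (intro le_imp_inverse_le) auto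
      also have "\<dots> \<le> 1 - v + v\<^sup>2"
      proof -
        have "1 \<le> (1 - v + v\<^sup>2) * (1 + v)"
          using v0 by (simp add: algebra_simps power2_eq_square)
        then show ?thesis using v0 by (simp add: inverse_eq_divide divide_le_eq)
      qed
      finally show ?thesis .
    qed
    ultimately show ?thesis by (simp add: abs_le_iff)
  qed
  also have "v\<^sup>2 \<le> 1 / l ^ 4 * \<bar>\<tau>\<bar> ^ 3"
  proof -
    have "v\<^sup>2 = (1 / l ^ 4) * (\<bar>\<tau>\<bar> ^ 4 / 4)" by (simp add: v_def power_divide power_mult_distrib power_even_abs)
    also have "\<dots> \<le> 1 / l ^ 4 * \<bar>\<tau>\<bar> ^ 3"
    proof (intro mult_left_mono)
      have "\<bar>\<tau>\<bar> ^ 4 \<le> \<bar>\<tau>\<bar> ^ 3" using \<tau> by (intro power_decreasing) auto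
      then show "\<bar>\<tau>\<bar> ^ 4 / 4 \<le> \<bar>\<tau>\<bar> ^ 3" using zero_le_power[of "\<bar>\<tau>\<bar>" 3] by linarith
    qed simp
    finally show ?thesis .
  qed
  finally have "\<bar>exp (- v) - (1 - v)\<bar> \<le> 1 / l ^ 4 * \<bar>\<tau>\<bar> ^ 3" .
  moreover have "cmod (of_real (1 - v) - of_real (exp (- v))) = \<bar>exp (- v) - (1 - v)\<bar>"
    unfolding of_real_diff[symmetric] norm_of_real by (rule abs_minus_commute)
  moreover have "1 - \<tau>\<^sup>2 * (1 / l\<^sup>2) / 2 = 1 - v" by (simp add: v_def)
  ultimately have 2: "cmod (of_real (1 - \<tau>\<^sup>2 * (1 / l\<^sup>2) / 2) - of_real (exp (- v))) \<le> 1 / l ^ 4 * \<bar>\<tau>\<bar> ^ 3"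
    by simp
  have "cmod (char (distr M borel ?Y) \<tau> - of_real (exp (- v))) \<le> (1 + 200 / l ^ 4) / 6 * \<bar>\<tau>\<bar> ^ 3 + 1 / l ^ 4 * \<bar>\<tau>\<bar> ^ 3"
    using norm_triangle_mono[OF 1 2] by simp
  then show ?thesis by (simp add: v_def distrib_right)
qed

lemma char_distr_divide:
  assumes [measurable]: "Y \<in> borel_measurable M"
  shows "char (distr M borel (\<lambda>x. Y x / r)) t = char (distr M borel Y) (t / r)"
  by (simp add: char_def integral_distr)

text \<open>The summands have two different rates and their number varies with \<open>N\<close>. The
  characteristic function is therefore compared factor by factor with Gaussian ones: a difference of
  products of numbers of modulus at most 1 is at most the sum of the differences. The two index sets
  on the axes are disjoint, so the variances add.\<close>

lemma boundary_sums_clt: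
  fixes s :: "nat \<Rightarrow> real" and x y :: "nat \<Rightarrow> nat" and \<alpha> \<beta> cx cy :: real
  assumes w: "boundary_field \<alpha> \<beta> w" and pos: "0 < \<alpha>" "0 < \<beta>"
    and s: "filterlim s at_top sequentially"
    and lim: "(\<lambda>N. x N / s N) \<longlonglongrightarrow> cx" "(\<lambda>N. y N / s N) \<longlonglongrightarrow> cy"
    and c: "0 < cx / \<alpha>\<^sup>2 + cy / \<beta>\<^sup>2"
  defines "\<sigma> \<equiv> sqrt (cx / \<alpha>\<^sup>2 + cy / \<beta>\<^sup>2)"
  shows "weak_conv_m (\<lambda>N. distr M borel (\<lambda>\<xi>. (((\<Sum>j=1..y N. w (0, j) \<xi>) - y N / \<beta>) - ((\<Sum>i=1..x N. w (i, 0) \<xi>) - x N / \<alpha>)) / (\<sigma> * sqrt (s N))))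
    std_normal_distribution"
proof -
  define Y where "Y = (\<lambda>z \<xi>. if fst z = (0 :: nat) then 1 * (w z \<xi> - 1 / \<beta>) else (- 1) * (w z \<xi> - 1 / \<alpha>))"
  define A where "A N = (\<lambda>j. (0 :: nat, j)) ` {1..y N} \<union> (\<lambda>i. (i, 0 :: nat)) ` {1..x N}" for N
  have [measurable]: "w z \<in> borel_measurable M" for z by (rule boundary_field_measurable[OF w])
  have Ym[measurable]: "Y z \<in> borel_measurable M" for z unfolding Y_def by (cases "fst z = 0") simp_all
  have \<sigma>: "0 < \<sigma>" "\<sigma>\<^sup>2 = cx / \<alpha>\<^sup>2 + cy / \<beta>\<^sup>2" using c by (auto simp: \<sigma>_def)
  have ind: "indep_vars (\<lambda>_. borel) Y UNIV"
  proof -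
    define g where "g = (\<lambda>(z :: nat \<times> nat) v. if fst z = (0 :: nat) then 1 * (v - 1 / \<beta>) else (- 1) * (v - 1 / \<alpha>))"
    have "indep_vars (\<lambda>_. borel) (\<lambda>z \<xi>. g z (w z \<xi>)) UNIV"
    proof (rule indep_vars_compose2[where X = w and Y = g and M' = "\<lambda>_. borel"])
      show "indep_vars (\<lambda>_. borel) w UNIV" using w by (simp add: boundary_field_def)
      show "g z \<in> borel_measurable borel" for z :: "nat \<times> nat"
        unfolding g_def by (cases "fst z = 0") simp_all
    qed
    then show ?thesis by (simp add: Y_def g_def)
  qed
  have sum_A: "(\<Sum>z\<in>A N. f z) = (\<Sum>j=1..y N. f (0, j)) + (\<Sum>i=1..x N. f (i, 0))" for f :: "nat \<times> nat \<Rightarrow> real" and N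
  proof -
    have "(\<Sum>z\<in>A N. f z) = sum f ((\<lambda>j. (0, j)) ` {1..y N}) + sum f ((\<lambda>i. (i, 0)) ` {1..x N})"
      unfolding A_def by (rule sum.union_disjoint) auto
    then show ?thesis by (simp add: sum.reindex inj_on_def)
  qed
  define Z where "Z N \<xi> = (\<Sum>z\<in>A N. Y z \<xi> / (\<sigma> * sqrt (s N)))" for N \<xi>
  have Z: "Z N \<xi> = (((\<Sum>j=1..y N. w (0, j) \<xi>) - y N / \<beta>) - ((\<Sum>i=1..x N. w (i, 0) \<xi>) - x N / \<alpha>)) / (\<sigma> * sqrt (s N))" for N \<xi>
    unfolding Z_def sum_divide_distrib[symmetric] sum_A
    by (simp add: Y_def sum_subtractf sum_negf)
  have spos: "eventually (\<lambda>N. 0 < s N) sequentially"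
    using s by (simp add: filterlim_at_top_dense)
  define K where "K = ((1 + 200 / \<beta> ^ 4) / 6 + 1 / \<beta> ^ 4) + ((1 + 200 / \<alpha> ^ 4) / 6 + 1 / \<alpha> ^ 4)"
  define V where "V z = (if fst z = (0 :: nat) then 1 / \<beta>\<^sup>2 else 1 / \<alpha>\<^sup>2)" for z :: "nat \<times> nat"
  have factor: "cmod (char (distr M borel (Y z)) \<tau> - exp (- (\<tau>\<^sup>2 / 2 * V z))) \<le> K * \<bar>\<tau>\<bar> ^ 3"
    if "\<bar>\<tau>\<bar> \<le> 1" "z \<in> A N" for \<tau> z N
  proof -
    have z: "z \<noteq> (0, 0)" "fst z = 0 \<or> snd z = 0" using that(2) by (auto simp: A_def)
    have nn: "0 \<le> (1 + 200 / \<beta> ^ 4) / 6 + 1 / \<beta> ^ 4" "0 \<le> (1 + 200 / \<alpha> ^ 4) / 6 + 1 / \<alpha> ^ 4" by simp_all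
    show ?thesis
    proof (cases "fst z = 0")
      case True
      then have d: "distributed M lborel (w z) (exponential_density \<beta>)"
        using w z by (cases z) (auto simp: boundary_field_def)
      have "Y z = (\<lambda>\<xi>. 1 * (w z \<xi> - 1 / \<beta>))" using True by (simp add: Y_def)
      then have "cmod (char (distr M borel (Y z)) \<tau> - exp (- (\<tau>\<^sup>2 / 2 * V z))) \<le> ((1 + 200 / \<beta> ^ 4) / 6 + 1 / \<beta> ^ 4) * \<bar>\<tau>\<bar> ^ 3"
        using char_centered_exponential[OF d pos(2) _ that(1), of 1] True by (simp add: V_def)
      also have "\<dots> \<le> K * \<bar>\<tau>\<bar> ^ 3" unfolding K_def using nn by (intro mult_right_mono) simp_all
      finally show ?thesis .
    next
      case False
      then have d: "distributed M lborel (w z) (exponential_density \<alpha>)"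
        using w z by (cases z) (auto simp: boundary_field_def)
      have "Y z = (\<lambda>\<xi>. (- 1) * (w z \<xi> - 1 / \<alpha>))" using False by (simp add: Y_def)
      then have "cmod (char (distr M borel (Y z)) \<tau> - exp (- (\<tau>\<^sup>2 / 2 * V z))) \<le> ((1 + 200 / \<alpha> ^ 4) / 6 + 1 / \<alpha> ^ 4) * \<bar>\<tau>\<bar> ^ 3"
        using char_centered_exponential[OF d pos(1) _ that(1), of "- 1"] False by (simp add: V_def)
      also have "\<dots> \<le> K * \<bar>\<tau>\<bar> ^ 3" unfolding K_def using nn by (intro mult_right_mono) simp_all
      finally show ?thesis .
    qed
  qed
  have "weak_conv_m (\<lambda>N. distr M borel (Z N)) std_normal_distribution"
  proof (rule levy_continuity)
    show "real_distribution (distr M borel (Z N))" for N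
      unfolding Z_def[abs_def] by (rule real_distribution_distr) measurable
    show "real_distribution std_normal_distribution" by (rule real_dist_normal_dist)
    fix t :: real
    let ?\<tau> = "\<lambda>N. t / (\<sigma> * sqrt (s N))"
    have char_Z: "char (distr M borel (Z N)) t = (\<Prod>z\<in>A N. char (distr M borel (Y z)) (?\<tau> N))" for N
    proof -
      have "indep_vars (\<lambda>_. borel) (\<lambda>z \<xi>. Y z \<xi> / (\<sigma> * sqrt (s N))) (A N)"
        by (rule indep_vars_compose2[OF indep_vars_subset[OF ind], of "A N" "\<lambda>_ v. v / (\<sigma> * sqrt (s N))"]) simp_all
      from char_distr_sum[OF this] show ?thesis by (simp add: Z_def[abs_def] char_distr_divide)
    qed
    have \<tau>0: "?\<tau> \<longlonglongrightarrow> 0"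
      by (rule tendsto_divide_0[OF tendsto_const filterlim_at_top_imp_at_infinity[OF
        filterlim_tendsto_pos_mult_at_top[OF tendsto_const \<sigma>(1) filterlim_compose[OF sqrt_at_top s]]]])
    then have \<tau>1: "eventually (\<lambda>N. \<bar>?\<tau> N\<bar> \<le> 1) sequentially"
      using order_tendstoD(2)[OF tendsto_rabs[OF \<tau>0], of 1] by (auto elim: eventually_mono)
    have "eventually (\<lambda>N. cmod (char (distr M borel (Z N)) t - exp (- (t\<^sup>2 / (2 * \<sigma>\<^sup>2) * (x N / s N / \<alpha>\<^sup>2 + y N / s N / \<beta>\<^sup>2))))
      \<le> (x N / s N + y N / s N) * (K * (\<bar>t\<bar> ^ 3 / \<sigma> ^ 3)) * inverse (sqrt (s N))) sequentially"
      using \<tau>1 spos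
    proof eventually_elim
      case (elim N)
      have cardA: "real (card (A N)) = x N + y N" using sum_A[of "\<lambda>_. 1" N] by simp
      have \<tau>2: "(?\<tau> N)\<^sup>2 = t\<^sup>2 / \<sigma>\<^sup>2 / s N" using elim by (simp add: power_divide power_mult_distrib)
      have \<tau>3: "\<bar>?\<tau> N\<bar> ^ 3 = \<bar>t\<bar> ^ 3 / \<sigma> ^ 3 / s N * inverse (sqrt (s N))"
      proof -
        have "sqrt (s N) ^ 3 = s N * sqrt (s N)" using elim by (simp add: power3_eq_cube)
        then show ?thesis using \<sigma> elim by (simp add: abs_mult power_divide power_mult_distrib inverse_eq_divide)
      qed
      have "(\<Prod>z\<in>A N. exp (complex_of_real (- ((?\<tau> N)\<^sup>2 / 2 * V z)))) = exp (of_real (- (t\<^sup>2 / (2 * \<sigma>\<^sup>2) * (x N / s N / \<alpha>\<^sup>2 + y N / s N / \<beta>\<^sup>2))))"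
      proof -
        have "(\<Sum>z\<in>A N. - ((?\<tau> N)\<^sup>2 / 2 * V z)) = - ((?\<tau> N)\<^sup>2 / 2) * (\<Sum>z\<in>A N. V z)"
          by (simp add: sum_distrib_left)
        also have "(\<Sum>z\<in>A N. V z) = y N / \<beta>\<^sup>2 + x N / \<alpha>\<^sup>2" by (simp add: sum_A V_def)
        also have "- ((?\<tau> N)\<^sup>2 / 2) * (y N / \<beta>\<^sup>2 + x N / \<alpha>\<^sup>2) = - (t\<^sup>2 / (2 * \<sigma>\<^sup>2) * (x N / s N / \<alpha>\<^sup>2 + y N / s N / \<beta>\<^sup>2))"
          unfolding \<tau>2 by (simp add: algebra_simps)
        finally have sum: "(\<Sum>z\<in>A N. - ((?\<tau> N)\<^sup>2 / 2 * V z)) = - (t\<^sup>2 / (2 * \<sigma>\<^sup>2) * (x N / s N / \<alpha>\<^sup>2 + y N / s N / \<beta>\<^sup>2))" .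
        have fin: "finite (A N)" by (simp add: A_def)
        show ?thesis unfolding sum[symmetric] of_real_sum exp_sum[OF fin] ..
      qed
      then have "cmod (char (distr M borel (Z N)) t - exp (of_real (- (t\<^sup>2 / (2 * \<sigma>\<^sup>2) * (x N / s N / \<alpha>\<^sup>2 + y N / s N / \<beta>\<^sup>2)))))
        = cmod ((\<Prod>z\<in>A N. char (distr M borel (Y z)) (?\<tau> N)) - (\<Prod>z\<in>A N. exp (complex_of_real (- ((?\<tau> N)\<^sup>2 / 2 * V z)))))"
        by (simp add: char_Z)
      also have "\<dots> \<le> (\<Sum>z\<in>A N. cmod (char (distr M borel (Y z)) (?\<tau> N) - exp (complex_of_real (- ((?\<tau> N)\<^sup>2 / 2 * V z)))))"
      proof (rule norm_prod_diff)
        fix z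
        interpret Yd: real_distribution "distr M borel (Y z)" by (rule real_distribution_distr) simp
        show "cmod (char (distr M borel (Y z)) (?\<tau> N)) \<le> 1" by (rule Yd.cmod_char_le_1)
        have "0 \<le> (?\<tau> N)\<^sup>2 / 2 * V z" by (simp add: V_def)
        then show "cmod (exp (complex_of_real (- ((?\<tau> N)\<^sup>2 / 2 * V z)))) \<le> 1"
          unfolding norm_exp_eq_Re by simp
      qed
      also have "\<dots> \<le> (\<Sum>z\<in>A N. K * \<bar>?\<tau> N\<bar> ^ 3)"
        unfolding exp_of_real by (intro sum_mono factor[OF elim(1)])
      also have "\<dots> = (x N + y N) * (K * \<bar>?\<tau> N\<bar> ^ 3)" by (simp add: cardA)
      also have "\<dots> = (x N / s N + y N / s N) * (K * (\<bar>t\<bar> ^ 3 / \<sigma> ^ 3)) * inverse (sqrt (s N))"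
        unfolding \<tau>3 by (simp add: algebra_simps add_divide_distrib)
      finally show ?case unfolding exp_of_real .
    qed
    moreover have "(\<lambda>N. (x N / s N + y N / s N) * (K * (\<bar>t\<bar> ^ 3 / \<sigma> ^ 3)) * inverse (sqrt (s N))) \<longlonglongrightarrow>
        (cx + cy) * (K * (\<bar>t\<bar> ^ 3 / \<sigma> ^ 3)) * 0"
      by (rule tendsto_mult[OF tendsto_mult[OF tendsto_add[OF lim] tendsto_const]
        tendsto_inverse_0_at_top[OF filterlim_compose[OF sqrt_at_top s]]])
    ultimately have "(\<lambda>N. char (distr M borel (Z N)) t - exp (- (t\<^sup>2 / (2 * \<sigma>\<^sup>2) * (x N / s N / \<alpha>\<^sup>2 + y N / s N / \<beta>\<^sup>2)))) \<longlonglongrightarrow> 0"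
      by (rule_tac Lim_null_comparison) simp_all
    moreover have "(\<lambda>N. complex_of_real (exp (- (t\<^sup>2 / (2 * \<sigma>\<^sup>2) * (x N / s N / \<alpha>\<^sup>2 + y N / s N / \<beta>\<^sup>2)))))
      \<longlonglongrightarrow> complex_of_real (exp (- (t\<^sup>2 / (2 * \<sigma>\<^sup>2) * (cx / \<alpha>\<^sup>2 + cy / \<beta>\<^sup>2))))"
      using pos by (intro tendsto_intros lim) auto
    ultimately have "(\<lambda>N. char (distr M borel (Z N)) t) \<longlonglongrightarrow> complex_of_real (exp (- (t\<^sup>2 / (2 * \<sigma>\<^sup>2) * (cx / \<alpha>\<^sup>2 + cy / \<beta>\<^sup>2))))"
      by (rule_tac Lim_transform)
    also have "t\<^sup>2 / (2 * \<sigma>\<^sup>2) * (cx / \<alpha>\<^sup>2 + cy / \<beta>\<^sup>2) = t\<^sup>2 / 2"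
      unfolding \<sigma>(2)[symmetric] using \<sigma>(1) by simp
    finally show "(\<lambda>N. char (distr M borel (Z N)) t) \<longlonglongrightarrow> char std_normal_distribution t"
      by (simp add: char_std_normal_distribution)
  qed
  then show ?thesis by (simp add: Z[abs_def])
qed

text \<open>When \<open>R\<close> and the shift of the threshold are both at most half of
  \<open>?h\<close>, the event lies between \<open>Z \<le> \<theta>0 - ?h\<close> and
  \<open>Z \<le> \<theta>0 + ?h\<close>; continuity of the limit distribution function closes the
  gap.\<close>

lemma slutsky_cdf:
  fixes Z R :: "nat \<Rightarrow> 'a \<Rightarrow> real" and \<theta> :: "nat \<Rightarrow> real"
  assumes Z: "\<And>N. Z N \<in> borel_measurable M" and R: "\<And>N. R N \<in> borel_measurable M"
    and conv: "weak_conv_m (\<lambda>N. distr M borel (Z N)) \<mu>" and cont: "\<And>x. isCont (cdf \<mu>) x"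
    and R0: "\<And>\<epsilon>. 0 < \<epsilon> \<Longrightarrow> (\<lambda>N. prob {x \<in> space M. \<epsilon> < \<bar>R N x\<bar>}) \<longlonglongrightarrow> 0"
    and \<theta>: "\<theta> \<longlonglongrightarrow> \<theta>0"
  shows "(\<lambda>N. prob {x \<in> space M. Z N x + R N x \<le> \<theta> N}) \<longlonglongrightarrow> cdf \<mu> \<theta>0"
proof (rule LIMSEQ_I)
  note [measurable] = Z R
  fix e :: real assume e: "0 < e"
  have cdfZ: "(\<lambda>N. prob {x \<in> space M. Z N x \<le> a}) \<longlonglongrightarrow> cdf \<mu> a" for a
  proof -
    have "cdf (distr M borel (Z N)) a = prob {x \<in> space M. Z N x \<le> a}" for N
      by (simp add: cdf_def measure_distr vimage_def Int_def conj_commute)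
    moreover have "(\<lambda>N. cdf (distr M borel (Z N)) a) \<longlonglongrightarrow> cdf \<mu> a"
      using conv cont by (simp add: weak_conv_m_def weak_conv_def)
    ultimately show ?thesis by simp
  qed
  obtain \<eta> where \<eta>: "0 < \<eta>" "\<And>x. \<bar>x - \<theta>0\<bar> < \<eta> \<Longrightarrow> \<bar>cdf \<mu> x - cdf \<mu> \<theta>0\<bar> < e / 2"
    using cont[of \<theta>0] e unfolding continuous_at_eps_delta dist_real_def by (metis half_gt_zero)
  let ?h = "\<eta> / 2"
  have near: "\<bar>cdf \<mu> (\<theta>0 + ?h) - cdf \<mu> \<theta>0\<bar> < e / 2" "\<bar>cdf \<mu> (\<theta>0 - ?h) - cdf \<mu> \<theta>0\<bar> < e / 2"
    using \<eta>(1) \<eta>(2)[of "\<theta>0 + ?h"] \<eta>(2)[of "\<theta>0 - ?h"] by simp_all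
  have "eventually (\<lambda>N. \<bar>\<theta> N - \<theta>0\<bar> < ?h / 2) sequentially"
    using \<theta> \<eta>(1) by (auto dest!: tendstoD[of _ _ _ "?h / 2"] simp: dist_real_def)
  moreover have "eventually (\<lambda>N. prob {x \<in> space M. ?h / 2 < \<bar>R N x\<bar>} < e / 4) sequentially"
    using order_tendstoD(2)[OF R0[of "?h / 2"], of "e / 4"] \<eta>(1) e by simp
  moreover have "eventually (\<lambda>N. \<bar>prob {x \<in> space M. Z N x \<le> \<theta>0 + ?h} - cdf \<mu> (\<theta>0 + ?h)\<bar> < e / 4) sequentially"
    using tendstoD[OF cdfZ[of "\<theta>0 + ?h"], of "e / 4"] e by (simp add: dist_real_def)
  moreover have "eventually (\<lambda>N. \<bar>prob {x \<in> space M. Z N x \<le> \<theta>0 - ?h} - cdf \<mu> (\<theta>0 - ?h)\<bar> < e / 4) sequentially"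
    using tendstoD[OF cdfZ[of "\<theta>0 - ?h"], of "e / 4"] e by (simp add: dist_real_def)
  ultimately have "eventually (\<lambda>N. \<bar>prob {x \<in> space M. Z N x + R N x \<le> \<theta> N} - cdf \<mu> \<theta>0\<bar> < e) sequentially"
  proof eventually_elim
    case (elim N)
    let ?bad = "{x \<in> space M. ?h / 2 < \<bar>R N x\<bar>}"
    have "prob {x \<in> space M. Z N x + R N x \<le> \<theta> N} \<le> prob ({x \<in> space M. Z N x \<le> \<theta>0 + ?h} \<union> ?bad)"
      using elim(1) by (intro finite_measure_mono) (auto simp: abs_if split: if_splits)
    also have "\<dots> \<le> prob {x \<in> space M. Z N x \<le> \<theta>0 + ?h} + prob ?bad"
      by (rule measure_Un_le) simp_all
    finally have up: "prob {x \<in> space M. Z N x + R N x \<le> \<theta> N} \<le> prob {x \<in> space M. Z N x \<le> \<theta>0 + ?h} + prob ?bad" .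
    have "prob {x \<in> space M. Z N x \<le> \<theta>0 - ?h} \<le> prob ({x \<in> space M. Z N x + R N x \<le> \<theta> N} \<union> ?bad)"
      using elim(1) by (intro finite_measure_mono) (auto simp: abs_if split: if_splits)
    also have "\<dots> \<le> prob {x \<in> space M. Z N x + R N x \<le> \<theta> N} + prob ?bad"
      by (rule measure_Un_le) simp_all
    finally have low: "prob {x \<in> space M. Z N x \<le> \<theta>0 - ?h} \<le> prob {x \<in> space M. Z N x + R N x \<le> \<theta> N} + prob ?bad" .
    show ?case using up low elim(2-4) near by linarith
  qed
  then show "\<exists>N0. \<forall>N\<ge>N0. norm (prob {x \<in> space M. Z N x + R N x \<le> \<theta> N} - cdf \<mu> \<theta>0) < e"
    by (simp add: eventually_sequentially)
qed

end

text \<open>The substitution by \<open>- y / \<sigma>\<close> both rescales and reflects, turning a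
  lower tail into an upper one.\<close>

lemma cdf_std_normal_eq_tail:
  fixes c \<sigma> :: real
  assumes \<sigma>: "0 < \<sigma>"
  shows "cdf std_normal_distribution (- c / \<sigma>) =
    (LBINT y:{c..}. exp (- (y ^ 2) / (2 * \<sigma>\<^sup>2)) / sqrt (2 * pi * \<sigma>\<^sup>2))"
proof -
  have "cdf std_normal_distribution (- c / \<sigma>) = (LINT x|std_normal_distribution. indicator {.. - c / \<sigma>} x)"
    by (simp add: cdf_def)
  also have "\<dots> = (LBINT x. std_normal_density x * indicator {.. - c / \<sigma>} x)"
    by (subst integral_density) simp_all
  also have "\<dots> = \<bar>- 1 / \<sigma>\<bar> *\<^sub>R (LBINT x. std_normal_density (0 + (- 1 / \<sigma>) * x) * indicator {.. - c / \<sigma>} (0 + (- 1 / \<sigma>) * x))"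
    by (rule lborel_integral_real_affine) (use \<sigma> in simp)
  also have "\<dots> = (LBINT x. \<bar>- 1 / \<sigma>\<bar> *\<^sub>R (std_normal_density (0 + (- 1 / \<sigma>) * x) * indicator {.. - c / \<sigma>} (0 + (- 1 / \<sigma>) * x)))"
    by simp
  also have "\<dots> = (LBINT y:{c..}. exp (- (y ^ 2) / (2 * \<sigma>\<^sup>2)) / sqrt (2 * pi * \<sigma>\<^sup>2))"
    unfolding set_lebesgue_integral_def
  proof (rule Bochner_Integration.integral_cong[OF refl])
    fix x :: real
    have "indicator {.. - c / \<sigma>} (0 + (- 1 / \<sigma>) * x) = (indicator {c..} x :: real)"
      using \<sigma> by (auto simp: indicator_def field_simps)
    moreover have "\<bar>- 1 / \<sigma>\<bar> * std_normal_density (0 + (- 1 / \<sigma>) * x) = exp (- (x ^ 2) / (2 * \<sigma>\<^sup>2)) / sqrt (2 * pi * \<sigma>\<^sup>2)"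
      using \<sigma> by (simp add: std_normal_density_def real_sqrt_mult power_divide mult.commute)
    ultimately show "\<bar>- 1 / \<sigma>\<bar> *\<^sub>R (std_normal_density (0 + (- 1 / \<sigma>) * x) * indicator {.. - c / \<sigma>} (0 + (- 1 / \<sigma>) * x))
      = indicator {c..} x *\<^sub>R (exp (- (x ^ 2) / (2 * \<sigma>\<^sup>2)) / sqrt (2 * pi * \<sigma>\<^sup>2))"
      by (simp add: mult.assoc[symmetric])
  qed
  finally show ?thesis .
qed

section \<open>The limit law of the interface\<close>

context prob_space
begin

text \<open>The two strict inequalities in \<open>ab\<close> put the direction \<open>(a, b)\<close>
  strictly between the characteristics of the two densities, so \<open>Lplus\<close> and
  \<open>Lminus\<close> each profit from their own axis up to a macroscopic point. Hypothesis
  \<open>d\<close> says that their centrings differ only on the fluctuation scale.\<close>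

lemma Lplus_minus_Lminus_limit:
  fixes s :: "nat \<Rightarrow> real" and m n :: "nat \<Rightarrow> nat" and \<rho>m \<rho>p a b d0 :: real
  assumes w: "boundary_field (1 - \<rho>p) \<rho>m w" "\<forall>x\<in>space M. w (0, 0) x = 0"
    and \<rho>: "0 < \<rho>m" "\<rho>m < 1" "0 < \<rho>p" "\<rho>p < 1"
    and s: "filterlim s at_top sequentially"
    and lim: "(\<lambda>N. m N / s N) \<longlonglongrightarrow> a" "(\<lambda>N. n N / s N) \<longlonglongrightarrow> b"
    and ab: "0 < a" "0 < b" "a / (1 - \<rho>m)\<^sup>2 < b / \<rho>m\<^sup>2" "b / \<rho>p\<^sup>2 < a / (1 - \<rho>p)\<^sup>2"
    and d: "(\<lambda>N. (m N * (1 / (1 - \<rho>m) - 1 / (1 - \<rho>p)) + n N * (1 / \<rho>m - 1 / \<rho>p)) / sqrt (s N)) \<longlonglongrightarrow> d0"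
  defines "\<sigma> \<equiv> sqrt ((a / (1 - \<rho>p)\<^sup>2 - b / \<rho>p\<^sup>2) + (b / \<rho>m\<^sup>2 - a / (1 - \<rho>m)\<^sup>2))"
  shows "(\<lambda>N. prob {x \<in> space M. Lplus (\<lambda>z. w z x) (m N, n N) \<le> Lminus (\<lambda>z. w z x) (m N, n N)})
    \<longlonglongrightarrow> cdf std_normal_distribution (- d0 / \<sigma>)"
proof -
  \<comment> \<open>From \<open>(0, cy * s)\<close> and \<open>(cx * s, 0)\<close> the target is
    seen in the characteristic directions of \<open>\<rho>m\<close> and \<open>\<rho>p\<close>
    respectively.\<close>
  define cy where "cy = b - a * \<rho>m\<^sup>2 / (1 - \<rho>m)\<^sup>2"
  define cx where "cx = a - b * (1 - \<rho>p)\<^sup>2 / \<rho>p\<^sup>2"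
  have cy: "cy / \<rho>m\<^sup>2 = b / \<rho>m\<^sup>2 - a / (1 - \<rho>m)\<^sup>2"
    using \<rho> by (simp add: cy_def diff_divide_distrib)
  have cx: "cx / (1 - \<rho>p)\<^sup>2 = a / (1 - \<rho>p)\<^sup>2 - b / \<rho>p\<^sup>2"
    using \<rho> by (simp add: cx_def diff_divide_distrib)
  have cpos: "0 < cy / \<rho>m\<^sup>2" "0 < cx / (1 - \<rho>p)\<^sup>2" using ab cx cy by simp_all
  then have c0: "0 \<le> cy" "0 \<le> cx" using \<rho> by (auto simp: zero_less_divide_iff)
  have \<sigma>: "\<sigma> = sqrt (cx / (1 - \<rho>p)\<^sup>2 + cy / \<rho>m\<^sup>2)" "0 < \<sigma>"
    using cpos by (auto simp: \<sigma>_def cx cy)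
  define y where "y N = nat \<lfloor>cy * s N\<rfloor>" for N
  define x where "x N = nat \<lfloor>cx * s N\<rfloor>" for N
  have y: "(\<lambda>N. y N / s N) \<longlonglongrightarrow> cy" unfolding y_def by (rule nat_floor_ratio_tendsto[OF s c0(1)])
  have x: "(\<lambda>N. x N / s N) \<longlonglongrightarrow> cx" unfolding x_def by (rule nat_floor_ratio_tendsto[OF s c0(2)])
  \<comment> \<open>Reflection in the diagonal turns \<open>Lminus\<close> into
    \<open>Lplus\<close>. The reflected vertical axis has rate \<open>1 - \<rho>p\<close>, so the
    fluctuation result is applied at density \<open>1 - \<rho>p\<close>.\<close>
  define w' where "w' = (\<lambda>z. w (prod.swap z))"
  have w': "boundary_field \<rho>m (1 - \<rho>p) w'" "\<forall>x\<in>space M. w' (0, 0) x = 0"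
  proof -
    have "indep_vars (\<lambda>_. borel) w' UNIV"
      unfolding w'_def using w(1) by (rule_tac indep_vars_inj_reindex) (simp_all add: boundary_field_def)
    then show "boundary_field \<rho>m (1 - \<rho>p) w'" using w(1) by (auto simp: boundary_field_def w'_def)
    show "\<forall>x\<in>space M. w' (0, 0) x = 0" using w(2) by (simp add: w'_def)
  qed
  have Lm: "Lminus (\<lambda>z. w z \<xi>) (i, j) = Lplus (\<lambda>z. w' z \<xi>) (j, i)" for \<xi> i j
    by (simp add: Lminus_eq_Lplus_swap w'_def comp_def)
  have [measurable]: "w z \<in> borel_measurable M" "w' z \<in> borel_measurable M" for z
    using boundary_field_measurable[OF w(1)] boundary_field_measurable[OF w'(1)] by auto
  have spos: "eventually (\<lambda>N. 0 < s N) sequentially"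
    using s by (simp add: filterlim_at_top_dense)
  define Rp where "Rp N \<xi> = Lplus (\<lambda>z. w z \<xi>) (m N, n N) - (\<Sum>j=1..y N. w (0, j) \<xi>)
      - (m N / (1 - \<rho>m) + (real (n N) - y N) / \<rho>m)" for N \<xi>
  define Rm where "Rm N \<xi> = Lplus (\<lambda>z. w' z \<xi>) (n N, m N) - (\<Sum>i=1..x N. w' (0, i) \<xi>)
      - (n N / (1 - (1 - \<rho>p)) + (real (m N) - x N) / (1 - \<rho>p))" for N \<xi>
  have Rp: "(\<lambda>N. prob {\<xi> \<in> space M. \<epsilon> * sqrt (s N) < \<bar>Rp N \<xi>\<bar>}) \<longlonglongrightarrow> 0" if "0 < \<epsilon>" for \<epsilon>
    unfolding Rp_def using \<rho> ab y that
    by (intro Lplus_fluctuations[where a = a and b = b, OF w _ _ _ s lim]) (auto simp: cy_def)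
  have Rm: "(\<lambda>N. prob {\<xi> \<in> space M. \<epsilon> * sqrt (s N) < \<bar>Rm N \<xi>\<bar>}) \<longlonglongrightarrow> 0" if "0 < \<epsilon>" for \<epsilon>
    unfolding Rm_def using \<rho> ab x that
    by (intro Lplus_fluctuations[where a = b and b = a, OF w' _ _ _ s lim(2,1)]) (auto simp: cx_def)
  define Z where "Z N \<xi> = (((\<Sum>j=1..y N. w (0, j) \<xi>) - y N / \<rho>m) - ((\<Sum>i=1..x N. w (i, 0) \<xi>) - x N / (1 - \<rho>p))) / (\<sigma> * sqrt (s N))" for N \<xi>
  define R where "R N \<xi> = (Rp N \<xi> - Rm N \<xi>) / (\<sigma> * sqrt (s N))" for N \<xi>
  have [measurable]: "Rp N \<in> borel_measurable M" "Rm N \<in> borel_measurable M" for N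
    unfolding Rp_def[abs_def] Rm_def[abs_def] by measurable
  define \<theta> where "\<theta> N = - ((m N * (1 / (1 - \<rho>m) - 1 / (1 - \<rho>p)) + n N * (1 / \<rho>m - 1 / \<rho>p)) / sqrt (s N) / \<sigma>)" for N
  have "(\<lambda>N. prob {\<xi> \<in> space M. Z N \<xi> + R N \<xi> \<le> \<theta> N}) \<longlonglongrightarrow> cdf std_normal_distribution (- (d0 / \<sigma>))"
  proof (rule slutsky_cdf)
    show "Z N \<in> borel_measurable M" for N unfolding Z_def[abs_def] by measurable
    show "R N \<in> borel_measurable M" for N unfolding R_def[abs_def] by measurable
    show "weak_conv_m (\<lambda>N. distr M borel (Z N)) std_normal_distribution"
      unfolding Z_def[abs_def] \<sigma>(1) using \<rho> cpos by (intro boundary_sums_clt w s x y) auto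
    show "isCont (cdf std_normal_distribution) a" for a by (rule isCont_cdf_std_normal)
    show "\<theta> \<longlonglongrightarrow> - (d0 / \<sigma>)" unfolding \<theta>_def using \<sigma>(2) by (intro tendsto_intros d) auto
    fix \<epsilon> :: real assume \<epsilon>: "0 < \<epsilon>"
    let ?e = "\<epsilon> * \<sigma> / 2"
    have e: "0 < ?e" using \<epsilon> \<sigma>(2) by simp
    have "eventually (\<lambda>N. prob {\<xi> \<in> space M. \<epsilon> < \<bar>R N \<xi>\<bar>} \<le> prob {\<xi> \<in> space M. ?e * sqrt (s N) < \<bar>Rp N \<xi>\<bar>} +
        prob {\<xi> \<in> space M. ?e * sqrt (s N) < \<bar>Rm N \<xi>\<bar>}) sequentially"
      using spos
    proof eventually_elim
      case (elim N)
      have "prob {\<xi> \<in> space M. \<epsilon> < \<bar>R N \<xi>\<bar>} \<le> prob ({\<xi> \<in> space M. ?e * sqrt (s N) < \<bar>Rp N \<xi>\<bar>} \<union> {\<xi> \<in> space M. ?e * sqrt (s N) < \<bar>Rm N \<xi>\<bar>})"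
      proof (intro finite_measure_mono subsetI)
        fix \<xi> assume "\<xi> \<in> {\<xi> \<in> space M. \<epsilon> < \<bar>R N \<xi>\<bar>}"
        then have \<xi>: "\<xi> \<in> space M" "\<epsilon> * (\<sigma> * sqrt (s N)) < \<bar>Rp N \<xi> - Rm N \<xi>\<bar>"
          using elim \<sigma>(2) by (auto simp: R_def abs_mult pos_less_divide_eq)
        then have "\<epsilon> * (\<sigma> * sqrt (s N)) < \<bar>Rp N \<xi>\<bar> + \<bar>Rm N \<xi>\<bar>"
          using abs_triangle_ineq4[of "Rp N \<xi>" "Rm N \<xi>"] by linarith
        moreover have "\<epsilon> * (\<sigma> * sqrt (s N)) = ?e * sqrt (s N) + ?e * sqrt (s N)" by simp
        ultimately have "?e * sqrt (s N) < \<bar>Rp N \<xi>\<bar> \<or> ?e * sqrt (s N) < \<bar>Rm N \<xi>\<bar>" by linarith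
        then show "\<xi> \<in> {\<xi> \<in> space M. ?e * sqrt (s N) < \<bar>Rp N \<xi>\<bar>} \<union> {\<xi> \<in> space M. ?e * sqrt (s N) < \<bar>Rm N \<xi>\<bar>}"
          using \<xi>(1) by blast
      qed measurable
      also have "\<dots> \<le> prob {\<xi> \<in> space M. ?e * sqrt (s N) < \<bar>Rp N \<xi>\<bar>} + prob {\<xi> \<in> space M. ?e * sqrt (s N) < \<bar>Rm N \<xi>\<bar>}"
        by (rule measure_Un_le) measurable
      finally show ?case .
    qed
    moreover have "(\<lambda>N. prob {\<xi> \<in> space M. ?e * sqrt (s N) < \<bar>Rp N \<xi>\<bar>} +
        prob {\<xi> \<in> space M. ?e * sqrt (s N) < \<bar>Rm N \<xi>\<bar>}) \<longlonglongrightarrow> 0"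
      using tendsto_add[OF Rp[OF e] Rm[OF e]] by simp
    ultimately show "(\<lambda>N. prob {\<xi> \<in> space M. \<epsilon> < \<bar>R N \<xi>\<bar>}) \<longlonglongrightarrow> 0"
      by (rule_tac tendsto_sandwich[OF _ _ tendsto_const]) auto
  qed
  moreover have "eventually (\<lambda>N. prob {\<xi> \<in> space M. Z N \<xi> + R N \<xi> \<le> \<theta> N}
     = prob {\<xi> \<in> space M. Lplus (\<lambda>z. w z \<xi>) (m N, n N) \<le> Lminus (\<lambda>z. w z \<xi>) (m N, n N)}) sequentially"
    using spos
  proof eventually_elim
    case (elim N)
    have "Z N \<xi> + R N \<xi> \<le> \<theta> N \<longleftrightarrow> Lplus (\<lambda>z. w z \<xi>) (m N, n N) \<le> Lminus (\<lambda>z. w z \<xi>) (m N, n N)" for \<xi>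
    proof -
      let ?d = "m N * (1 / (1 - \<rho>m) - 1 / (1 - \<rho>p)) + n N * (1 / \<rho>m - 1 / \<rho>p)"
      have r: "0 < \<sigma> * sqrt (s N)" using elim \<sigma>(2) by simp
      \<comment> \<open>The means of the axis sums, subtracted here, complete the centrings inside
        \<open>Rp\<close> and \<open>Rm\<close>; what remains deterministic is \<open>?d\<close>,
        free of \<open>x\<close> and \<open>y\<close>.\<close>
      have num: "Lplus (\<lambda>z. w z \<xi>) (m N, n N) - Lminus (\<lambda>z. w z \<xi>) (m N, n N) =
        ((\<Sum>j=1..y N. w (0, j) \<xi>) - y N / \<rho>m) - ((\<Sum>i=1..x N. w (i, 0) \<xi>) - x N / (1 - \<rho>p)) + (Rp N \<xi> - Rm N \<xi>) + ?d"
        unfolding Rp_def Rm_def Lm w'_def by (simp add: algebra_simps diff_divide_distrib)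
      have "(Lplus (\<lambda>z. w z \<xi>) (m N, n N) - Lminus (\<lambda>z. w z \<xi>) (m N, n N)) / (\<sigma> * sqrt (s N)) = Z N \<xi> + R N \<xi> - \<theta> N"
        unfolding num Z_def R_def \<theta>_def by (simp add: add_divide_distrib mult.commute)
      then have "Z N \<xi> + R N \<xi> \<le> \<theta> N \<longleftrightarrow> (Lplus (\<lambda>z. w z \<xi>) (m N, n N) - Lminus (\<lambda>z. w z \<xi>) (m N, n N)) / (\<sigma> * sqrt (s N)) \<le> 0"
        by simp
      then show ?thesis using r by (simp add: divide_le_0_iff)
    qed
    then show ?case by simp
  qed
  ultimately show ?thesis
    by (simp add: tendsto_cong)
qed

end

lemma real_le_iff_le_nat_floor:
  fixes r :: real
  assumes "0 \<le> r"
  shows "real i \<le> r \<longleftrightarrow> i \<le> nat \<lfloor>r\<rfloor>"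
  using assms by linarith

theorem theorem2p9:
  fixes M :: "'a measure"
    and \<omega> :: "nat \<times> nat \<Rightarrow> 'a \<Rightarrow> real"
    and \<rho>m \<rho>p u :: real
  assumes "prob_space M"
    and "0 < \<rho>m" and "\<rho>m < \<rho>p" and "\<rho>p < 1"
    and "prob_space.indep_vars M (\<lambda>_. borel) \<omega> UNIV"
    and "\<forall>x\<in>space M. \<omega> (0,0) x = 0"
    and "\<And>i j. i > 0 \<Longrightarrow> j > 0 \<Longrightarrow> distributed M lborel (\<omega> (i,j)) (exponential_density 1)"
    and "\<And>j. j \<ge> 1 \<Longrightarrow> distributed M lborel (\<omega> (0,j)) (exponential_density \<rho>m)"
    and "\<And>i. i \<ge> 1 \<Longrightarrow> distributed M lborel (\<omega> (i,0)) (exponential_density (1 - \<rho>p))"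
  shows
    "let \<eta> = (1 - \<rho>p) * (1 - \<rho>m) / (\<rho>m * \<rho>p);
         vp = 1 / \<rho>m ^ 2 - \<eta> / (1 - \<rho>m) ^ 2;
         vm = \<eta> / (1 - \<rho>p) ^ 2 - 1 / \<rho>p ^ 2;
         mp = 1 / (1 - \<rho>m);
         mm = 1 / (1 - \<rho>p)
     in ((\<lambda>t::real. measure M
            {x \<in> space M.
               real (fst (comp_interface (\<lambda>z. \<omega> z x) (nat \<lfloor>t\<rfloor>)))
               - real (snd (comp_interface (\<lambda>z. \<omega> z x) (nat \<lfloor>t\<rfloor>)))
               \<le> - t * (1 - \<eta>) / (1 + \<eta>) + 2 * u * sqrt t / (1 + \<eta>) powr (3/2)})
         \<longlongrightarrow> (LBINT y:{u * (mp - mm)..}.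
                 exp (- (y ^ 2) / (2 * (vm + vp))) / sqrt (2 * pi * (vm + vp)))) at_top"
proof -
  interpret prob_space M by fact
  define \<eta> where "\<eta> = (1 - \<rho>p) * (1 - \<rho>m) / (\<rho>m * \<rho>p)"
  define vp where "vp = 1 / \<rho>m ^ 2 - \<eta> / (1 - \<rho>m) ^ 2"
  define vm where "vm = \<eta> / (1 - \<rho>p) ^ 2 - 1 / \<rho>p ^ 2"
  define p where "p = 1 / (1 - \<rho>m) - 1 / (1 - \<rho>p)"
  define q where "q = 1 / \<rho>m - 1 / \<rho>p"
  have \<rho>: "0 < \<rho>m" "\<rho>m < \<rho>p" "\<rho>p < 1" "0 < \<rho>p" "\<rho>m < 1" using assms by auto
  have \<eta>: "0 < \<eta>" using \<rho> by (simp add: \<eta>_def)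
  \<comment> \<open>In the direction \<open>(\<eta>, 1)\<close> the leading terms of
    \<open>Lplus\<close> and \<open>Lminus\<close> coincide, since
    \<open>\<eta> * p + q = 0\<close>. This is what determines \<eta>.\<close>
  have q: "q = - \<eta> * p"
    using \<rho> by (simp add: q_def p_def \<eta>_def divide_simps)
  \<comment> \<open>This puts the direction \<open>(\<eta>, 1)\<close> strictly between the two
    characteristics, and thereby makes both \<open>vp\<close> and \<open>vm\<close>
    positive.\<close>
  have ord: "(1 - \<rho>p) * \<rho>m < (1 - \<rho>m) * \<rho>p" using \<rho> by (simp add: algebra_simps)
  have vp: "\<eta> / (1 - \<rho>m)\<^sup>2 < 1 / \<rho>m\<^sup>2"
  proof -
    have "\<eta> / (1 - \<rho>m)\<^sup>2 = ((1 - \<rho>p) * \<rho>m) / ((1 - \<rho>m) * \<rho>p) * (1 / \<rho>m\<^sup>2)"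
      using \<rho> by (simp add: \<eta>_def power2_eq_square)
    also have "\<dots> < 1 * (1 / \<rho>m\<^sup>2)"
      using \<rho> ord by (intro mult_strict_right_mono) simp_all
    finally show ?thesis by simp
  qed
  have vm: "1 / \<rho>p\<^sup>2 < \<eta> / (1 - \<rho>p)\<^sup>2"
  proof -
    have "\<eta> / (1 - \<rho>p)\<^sup>2 = ((1 - \<rho>m) * \<rho>p) / ((1 - \<rho>p) * \<rho>m) * (1 / \<rho>p\<^sup>2)"
      using \<rho> by (simp add: \<eta>_def power2_eq_square)
    also have "\<dots> > 1 * (1 / \<rho>p\<^sup>2)"
      using \<rho> ord by (intro mult_strict_right_mono) simp_all
    finally show ?thesis by simp
  qed
  have w: "boundary_field (1 - \<rho>p) \<rho>m \<omega>" unfolding boundary_field_def using assms by auto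
  define \<sigma> where "\<sigma> = sqrt (vm + vp)"
  have \<sigma>: "0 < \<sigma>" "\<sigma>\<^sup>2 = vm + vp" using vp vm by (auto simp: \<sigma>_def vp_def vm_def)
  define thr where "thr t = - t * (1 - \<eta>) / (1 + \<eta>) + 2 * u * sqrt t / (1 + \<eta>) powr (3/2)" for t
  define f where "f t = measure M {x \<in> space M.
               real (fst (comp_interface (\<lambda>z. \<omega> z x) (nat \<lfloor>t\<rfloor>)))
               - real (snd (comp_interface (\<lambda>z. \<omega> z x) (nat \<lfloor>t\<rfloor>))) \<le> thr t}" for t
  have "(f \<longlongrightarrow> cdf std_normal_distribution (- (u * p) / \<sigma>)) at_top"
  \<comment> \<open>The real parameter is reduced to arbitrary sequences tending to infinity, the
    setting of all preceding asymptotics.\<close>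
  proof (rule tendsto_at_topI_sequentially)
    fix t :: "nat \<Rightarrow> real" assume t: "filterlim t at_top sequentially"
    \<comment> \<open>The target is close to \<open>(\<eta> * s, s)\<close>, whose coordinates add
      up to \<open>t\<close>.\<close>
    define s where "s N = t N / (1 + \<eta>)" for N
    have s: "filterlim s at_top sequentially"
      unfolding s_def divide_inverse using \<eta>
      by (intro filterlim_at_top_mult_tendsto_pos[OF tendsto_const _ t]) simp
    have ts: "t N = (1 + \<eta>) * s N" for N using \<eta> by (simp add: s_def)
    have spos: "eventually (\<lambda>N. 1 < s N) sequentially"
      using s by (simp add: filterlim_at_top_dense)
    \<comment> \<open>The coordinates of the interface add up to the floor of \<open>t\<close>, so
      the bound on their difference is the bound \<open>r\<close> on the first one. The point tested
      is then the first beyond it on the next antidiagonal, \<open>m = k + 1\<close>.\<close>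
    define r where "r N = (real (nat \<lfloor>t N\<rfloor>) + thr (t N)) / 2" for N
    define k where "k N = nat \<lfloor>r N\<rfloor>" for N
    define m where "m N = Suc (k N)" for N
    define n where "n N = nat \<lfloor>t N\<rfloor> - k N" for N
    \<comment> \<open>Passing from \<open>sqrt t\<close> to \<open>sqrt s\<close> releases a factor
      \<open>sqrt (1 + \<eta>)\<close>, which reduces the power 3/2 to 1.\<close>
    have thr: "thr (t N) = - (1 - \<eta>) * s N + 2 * u * sqrt (s N) / (1 + \<eta>)" if "1 < s N" for N
    proof -
      have "(1 + \<eta>) powr (3/2) = (1 + \<eta>) * sqrt (1 + \<eta>)"
        using \<eta> powr_add[of "1 + \<eta>" 1 "1/2"] by (simp add: powr_half_sqrt)
      then show ?thesis
        using \<eta> unfolding thr_def ts by (simp add: real_sqrt_mult) (simp add: algebra_simps)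
    qed
    have r: "\<bar>r N - (\<eta> * s N + u * sqrt (s N) / (1 + \<eta>))\<bar> \<le> 1" if "1 < s N" for N
    proof -
      have "0 < t N" using that \<eta> by (simp add: ts)
      then have "\<bar>real (nat \<lfloor>t N\<rfloor>) - t N\<bar> \<le> 1" by linarith
      moreover have "r N - (\<eta> * s N + u * sqrt (s N) / (1 + \<eta>)) = (real (nat \<lfloor>t N\<rfloor>) - t N) / 2"
      proof -
        have "(t N + thr (t N)) / 2 = \<eta> * s N + u * sqrt (s N) / (1 + \<eta>)"
        proof -
          define g where "g = u * sqrt (s N) / (1 + \<eta>)"
          have "thr (t N) = - (1 - \<eta>) * s N + 2 * g" unfolding thr[OF that] g_def by simp
          then have "(t N + thr (t N)) / 2 = \<eta> * s N + g"
            by (simp only: ts) (simp add: algebra_simps)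
          then show ?thesis by (simp add: g_def)
        qed
        then show ?thesis by (simp add: r_def add_divide_distrib diff_divide_distrib)
      qed
      moreover have "\<bar>y\<bar> \<le> 1" if "\<bar>x\<bar> \<le> 1" "y = x / 2" for x y :: real
        using that by simp
      ultimately show ?thesis by blast
    qed
    have sq0: "(\<lambda>N. inverse (sqrt (s N))) \<longlonglongrightarrow> 0"
      by (rule tendsto_inverse_0_at_top[OF filterlim_compose[OF sqrt_at_top s]])
    have s0: "(\<lambda>N. inverse (s N)) \<longlonglongrightarrow> 0" by (rule tendsto_inverse_0_at_top[OF s])
    have rlim: "(\<lambda>N. r N / s N) \<longlonglongrightarrow> \<eta>"
    proof -
      have "(\<lambda>N. r N / s N - (\<eta> + u / (1 + \<eta>) * inverse (sqrt (s N)))) \<longlonglongrightarrow> 0"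
      proof (rule Lim_null_comparison[OF _ s0])
        show "eventually (\<lambda>N. norm (r N / s N - (\<eta> + u / (1 + \<eta>) * inverse (sqrt (s N)))) \<le> inverse (s N)) sequentially"
          using spos
        proof eventually_elim
          case (elim N)
          have "inverse (sqrt (s N)) = sqrt (s N) / s N"
            using elim by (simp add: inverse_eq_divide real_div_sqrt field_simps)
          then have "r N / s N - (\<eta> + u / (1 + \<eta>) * inverse (sqrt (s N))) = (r N - (\<eta> * s N + u * sqrt (s N) / (1 + \<eta>))) / s N"
            using elim by (simp add: diff_divide_distrib add_divide_distrib)
          then show ?case using r[OF elim] elim by (simp add: inverse_eq_divide divide_right_mono)
        qed
      qed
      moreover have "(\<lambda>N. \<eta> + u / (1 + \<eta>) * inverse (sqrt (s N))) \<longlonglongrightarrow> \<eta> + u / (1 + \<eta>) * 0"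
        by (intro tendsto_intros sq0)
      ultimately show ?thesis using Lim_transform by fastforce
    qed
    have rpos: "eventually (\<lambda>N. 0 < r N) sequentially"
      using order_tendstoD(1)[OF rlim \<eta>] spos by eventually_elim (simp add: zero_less_divide_iff)
    have rlt: "eventually (\<lambda>N. r N + 1 < t N) sequentially"
    proof -
      have "(\<lambda>N. r N / s N + inverse (s N)) \<longlonglongrightarrow> \<eta> + 0" by (intro tendsto_intros rlim s0)
      then have "eventually (\<lambda>N. r N / s N + inverse (s N) < 1 + \<eta>) sequentially"
        by (rule order_tendstoD) simp
      then show ?thesis using spos
        by eventually_elim (simp add: ts inverse_eq_divide add_divide_distrib[symmetric] pos_divide_less_eq)
    qed
    have kn: "eventually (\<lambda>N. k N < nat \<lfloor>t N\<rfloor>) sequentially"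
      using rpos rlt by eventually_elim (simp add: k_def, linarith)
    have mr: "eventually (\<lambda>N. \<bar>m N - r N\<bar> \<le> 1) sequentially"
      using rpos by eventually_elim (simp add: m_def k_def, linarith)
    have nr: "eventually (\<lambda>N. \<bar>n N - (t N - r N)\<bar> \<le> 2) sequentially"
      using rpos kn spos
    proof eventually_elim
      case (elim N)
      have "0 < t N" using elim \<eta> by (simp add: ts)
      moreover have "real (n N) = real (nat \<lfloor>t N\<rfloor>) - real (k N)" using elim by (simp add: n_def of_nat_diff)
      ultimately show ?case using elim unfolding k_def by linarith
    qed
    have m_lim: "(\<lambda>N. m N / s N) \<longlonglongrightarrow> \<eta>"
    proof -
      have "(\<lambda>N. m N / s N - r N / s N) \<longlonglongrightarrow> 0"
      proof (rule Lim_null_comparison[OF _ s0])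
        show "eventually (\<lambda>N. norm (m N / s N - r N / s N) \<le> inverse (s N)) sequentially"
          using mr spos
          by eventually_elim (simp add: inverse_eq_divide diff_divide_distrib[symmetric] divide_right_mono)
      qed
      from tendsto_add[OF this rlim] show ?thesis by simp
    qed
    have n_lim: "(\<lambda>N. n N / s N) \<longlonglongrightarrow> 1"
    proof -
      have "(\<lambda>N. n N / s N - (1 + \<eta> - r N / s N)) \<longlonglongrightarrow> 0"
      proof (rule Lim_null_comparison)
        show "(\<lambda>N. 2 * inverse (s N)) \<longlonglongrightarrow> 0" using tendsto_mult_right_zero[OF s0, of 2] by simp
        show "eventually (\<lambda>N. norm (n N / s N - (1 + \<eta> - r N / s N)) \<le> 2 * inverse (s N)) sequentially"
          using nr spos
        proof eventually_elim
          case (elim N)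
          have "n N / s N - (1 + \<eta> - r N / s N) = (n N - (t N - r N)) / s N"
            using elim by (simp add: ts diff_divide_distrib)
          then show ?case using elim by (simp add: inverse_eq_divide divide_right_mono)
        qed
      qed
      moreover have "(\<lambda>N. 1 + \<eta> - r N / s N) \<longlonglongrightarrow> 1 + \<eta> - \<eta>" by (intro tendsto_intros rlim)
      ultimately show ?thesis using Lim_transform by fastforce
    qed
    \<comment> \<open>The quantity is \<open>p * (m - \<eta> * n)\<close>. Displacing
      \<open>m\<close> by \<open>u * sqrt s / (1 + \<eta>)\<close> along the antidiagonal displaces
      \<open>n\<close> by the opposite amount, so \<open>m - \<eta> * n\<close> is close to
      \<open>u * sqrt s\<close>.\<close>
    have d: "(\<lambda>N. (m N * p + n N * q) / sqrt (s N)) \<longlonglongrightarrow> u * p"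
    proof -
      have "(\<lambda>N. (m N * p + n N * q) / sqrt (s N) - u * p) \<longlonglongrightarrow> 0"
      proof (rule Lim_null_comparison)
        \<comment> \<open>The rounding errors of \<open>r\<close>, \<open>m\<close> and
          \<open>n\<close> are at most 1, 1 and 2 and enter with coefficients
          \<open>1 + \<eta>\<close>, 1 and \<open>\<eta>\<close>; together this is
          \<open>2 + 3 * \<eta>\<close>.\<close>
        show "(\<lambda>N. (\<bar>p\<bar> * (2 + 3 * \<eta>)) * inverse (sqrt (s N))) \<longlonglongrightarrow> 0"
          using tendsto_mult_right_zero[OF sq0] by simp
        show "eventually (\<lambda>N. norm ((m N * p + n N * q) / sqrt (s N) - u * p) \<le> (\<bar>p\<bar> * (2 + 3 * \<eta>)) * inverse (sqrt (s N))) sequentially"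
          using mr nr spos
        proof eventually_elim
          case (elim N)
          define e0 where "e0 = r N - (\<eta> * s N + u * sqrt (s N) / (1 + \<eta>))"
          define e1 where "e1 = m N - r N"
          define e2 where "e2 = n N - (t N - r N)"
          have e: "\<bar>e0\<bar> \<le> 1" "\<bar>e1\<bar> \<le> 1" "\<bar>e2\<bar> \<le> 2" using r elim by (auto simp: e0_def e1_def e2_def)
          have "m N - \<eta> * n N = (1 + \<eta>) * r N - \<eta> * t N + e1 - \<eta> * e2"
            by (simp add: e1_def e2_def algebra_simps)
          also have "(1 + \<eta>) * r N - \<eta> * t N = u * sqrt (s N) + (1 + \<eta>) * e0"
            using \<eta> by (simp add: e0_def ts field_simps)
          finally have "m N - \<eta> * n N = u * sqrt (s N) + ((1 + \<eta>) * e0 + e1 - \<eta> * e2)" by simp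
          moreover have "m N * p + n N * q = p * (m N - \<eta> * n N)"
            unfolding q by (simp add: algebra_simps)
          ultimately have mn: "m N * p + n N * q = p * (u * sqrt (s N) + ((1 + \<eta>) * e0 + e1 - \<eta> * e2))"
            by (simp only:)
          have "(m N * p + n N * q) / sqrt (s N) - u * p = p * ((1 + \<eta>) * e0 + e1 - \<eta> * e2) * inverse (sqrt (s N))"
            unfolding mn using elim by (simp add: field_simps)
          moreover have "\<bar>(1 + \<eta>) * e0 + e1 - \<eta> * e2\<bar> \<le> 2 + 3 * \<eta>"
          proof -
            have "\<bar>(1 + \<eta>) * e0\<bar> \<le> 1 + \<eta>" "\<bar>\<eta> * e2\<bar> \<le> \<eta> * 2"
              using e \<eta> by (auto simp: abs_mult intro!: mult_left_le mult_left_mono)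
            then show ?thesis using e(2) by linarith
          qed
          ultimately show ?case using elim
            by (simp add: abs_mult mult_right_mono mult_left_mono)
        qed
      qed
      then show ?thesis by (simp add: LIM_zero_iff)
    qed
    have "(\<lambda>N. prob {x \<in> space M. Lplus (\<lambda>z. \<omega> z x) (m N, n N) \<le> Lminus (\<lambda>z. \<omega> z x) (m N, n N)})
      \<longlonglongrightarrow> cdf std_normal_distribution (- (u * p) / \<sigma>)"
      unfolding \<sigma>_def vm_def vp_def p_def
      by (rule Lplus_minus_Lminus_limit[OF w assms(6) \<rho>(1,5,4,3) s m_lim n_lim \<eta> _ _ _ d[unfolded p_def q_def]])
        (use vp vm in auto)
    moreover have "eventually (\<lambda>N. prob {x \<in> space M. Lplus (\<lambda>z. \<omega> z x) (m N, n N) \<le> Lminus (\<lambda>z. \<omega> z x) (m N, n N)} = f (t N)) sequentially"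
      using kn rpos
    proof eventually_elim
      case (elim N)
      have "real (fst (comp_interface v (nat \<lfloor>t N\<rfloor>))) - real (snd (comp_interface v (nat \<lfloor>t N\<rfloor>))) \<le> thr (t N)
        \<longleftrightarrow> Lplus v (m N, n N) \<le> Lminus v (m N, n N)" for v
      proof -
        have half: "x - y \<le> c \<longleftrightarrow> x \<le> (x + y + c) / 2" for x y c :: real
          by auto
        have "real (fst (comp_interface v (nat \<lfloor>t N\<rfloor>))) - real (snd (comp_interface v (nat \<lfloor>t N\<rfloor>))) \<le> thr (t N)
          \<longleftrightarrow> real (fst (comp_interface v (nat \<lfloor>t N\<rfloor>))) \<le> r N"
          unfolding half r_def of_nat_add[symmetric] comp_interface_sum ..
        also have "\<dots> \<longleftrightarrow> fst (comp_interface v (nat \<lfloor>t N\<rfloor>)) \<le> k N"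
          unfolding k_def using elim by (intro real_le_iff_le_nat_floor) simp
        finally show ?thesis using comp_interface_le_iff[OF elim(1), of v] by (simp add: m_def n_def)
      qed
      then show ?case by (simp add: f_def)
    qed
    ultimately show "(\<lambda>N. f (t N)) \<longlonglongrightarrow> cdf std_normal_distribution (- (u * p) / \<sigma>)"
      by (rule Lim_transform_eventually)
  qed
  then show ?thesis
    unfolding Let_def f_def thr_def cdf_std_normal_eq_tail[OF \<sigma>(1)] \<sigma>(2) vm_def vp_def p_def \<eta>_def .
qed

end
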